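(* Let $n\ge 4$ and $0\le t\le n-4$, let $c,d\in\mathbb Z$, and let $a_1,\dots,a_p,b_1,\dots,b_q$ be integers. The following are equivalent. (i) There is a long Bourbaki sequence $$0\to\bigoplus_{i=1}^pS(-a_i)\to\bigoplus_{i=1}^qS(-b_i)\to E_{t+1}\oplus E_{n-1}(d)\to I(c)\to 0\quad(\text{exact}),$$ where $I\subset S$ is a graded ideal. (ii) There are $\beta_1,\dots,\beta_q\in (K_{t+1}\oplus K_{n-1}(d))\setminus(E_{t+2}\oplus E_n(d))$ and $\varphi=(a,b)$ with $a\in\mathbf A$ and $b\in\mathbf B$ such that: (a) $\varphi: K_{t+1}\oplus K_{n-1}(d)\to S(-n)$ is a homomorphism of degree $n+c$, and $\operatorname{Ker}(\varphi)=\langle\beta_1,\dots,\beta_q\rangle+(E_{t+2}\oplus E_n(d))$; and (b) with $p=q-n+2-\binom{n-1}{t}$, there is a commutative diagram with exact rows and exact columns $$\begin{array}{ccccccc} & & 0 & & 0 & & \\ & & \downarrow & & \downarrow & & \\ 0&\to&\operatorname{Ker}\operatorname{Res}(\beta)&\to&\operatorname{Ker}\beta&\to&0\\ & & \downarrow & & \downarrow & & \\ 0&\to&\bigoplus_{i=1}^pS(-a_i)&\to&\bigoplus_{i=1}^qS(-b_i)& & \\ & & {\scriptstyle \operatorname{Res}(\beta)}\downarrow & & {\scriptstyle\beta}\downarrow & & \\ 0&\to&\langle\beta_1,\dots,\beta_q\rangle\cap(E_{t+2}\oplus E_n(d))&\to&\langle\beta_1,\dots,\beta_q\rangle& & \\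 & & \downarrow & & \downarrow & & \\ & & 0 & & 0 & & \end{array}$$ where $\beta(g_i)=\beta_i$ for all $i$, with $g_1,\dots,g_q$ the free basis of $\bigoplus_{i=1}^qS(-b_i)$, and $\operatorname{Res}(-)$ denotes restriction of maps. In this case, $I=\varphi(K_{t+1}\oplus K_{n-1}(d))(-c)$.
   Context: $K$ is a field, $S=K[x_1,\dots,x_n]$ has the standard grading, $\mathfrak m=(x_1,\dots,x_n)$. All modules and ideals are graded; $M(d)_i=M_{d+i}$. $(K_\bullet,\partial_\bullet)$ is the graded Koszul complex of $x_1,\dots,x_n$ over $S$, $K_j\cong S(-j)^{\binom nj}$, with basis elements $e_J=e_{i_1\cdots i_j}$ for $J=\{i_1<\dots<i_j\}\subset[n]=\{1,\dots,n\}$; $e_J^*$ denotes the dual basis of the dual of $K_j$, where $(-)^*=\operatorname{Hom}_S(-,S(-n))$. $E_j=\operatorname{Im}(\partial_j)\subset K_{j-1}$ is the $j$-th syzygy module of $S/\mathfrak m$ over $S$. $\langle\cdots\rangle$ denotes the $S$-submodule generated. A homomorphism $\varphi$ of degree $n+c$ into $S(-n)$ is the same as a degree-$0$ homomorphism into $S(c)$, and its image is viewed in $S(c)$. For disjoint $J,L\subset[n]$, $\sigma(J,L)=(-1)^i$ with $i=\#\{(j,k)\in J\times L\mid j>k\}$. The submodules $\mathbf A\subset K_{t+1}^*$ and $\mathbf B\subset K_{n-1}^*$ are $$\mathbf A=\Big\langle\sum_{j=1}^{n-t}(-1)^{j+1}\sigma\big(L\setminus\{i_j\},([n]\setminus L)\cup\{i_j\}\big)\,x_{i_j}\,e^*_{([n]\setminus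 L)\cup\{i_j\}}\ \Big|\ L=\{i_1<\dots<i_{n-t}\}\subset[n]\Big\rangle,$$ $$\mathbf B=\big\langle(-1)^ix_j\,e^*_{[n]\setminus\{i\}}-(-1)^jx_i\,e^*_{[n]\setminus\{j\}}\ \big|\ 1\le i<j\le n\big\rangle .$$ $\varphi=(a,b)$ means $\varphi(u,v)=a(u)+b(v)$.
   Formalization: In (i) it is additionally required that no basis element of the middle free module ⊕S(-b_i) is sent to 0 in E_{t+1}⊕E_{n-1}(d); without this (i)⇒(ii) fails, e.g. after adding a split summand S(-r)→S(-r) with r very negative, where β_i would have to be 0. *)

theory Defs
  imports
    Complex_Main
    "HOL-Library.Cardinality"
    "HOL-Library.Poly_Mapping"
    "HOL-Library.Function_Algebras"
    "HOL-Library.Product_Plus"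
begin

section \<open>The polynomial ring\<close>

text \<open>
  The polynomial ring \<open>S = K[x_1,...,x_n]\<close> has one variable for each element of the finite
  linearly ordered type \<open>'n\<close>, so that \<open>n = CARD('n)\<close> and \<open>[n]\<close> is \<open>UNIV :: 'n set\<close>; the integer
  named by \<open>i :: 'n\<close> is its position \<open>rank UNIV i\<close>.
\<close>

type_synonym ('n, 'k) poly_ring = "('n \<Rightarrow>\<^sub>0 nat) \<Rightarrow>\<^sub>0 'k"

definition Var :: "'n \<Rightarrow> ('n, 'k::comm_ring_1) poly_ring" where
  "Var i = Poly_Mapping.single (Poly_Mapping.single i 1) 1"

definition homogeneous :: "int \<Rightarrow> ('n::finite, 'k::zero) poly_ring \<Rightarrow> bool" where
  "homogeneous m f \<longleftrightarrow> (\<forall>\<mu>\<in>Poly_Mapping.keys f. int (\<Sum>i\<in>UNIV. Poly_Mapping.lookup \<mu> i) = m)"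

text \<open>\<open>rank L i\<close> is the index \<open>j\<close> with \<open>i = i_j\<close>, where \<open>L = {i_1 < i_2 < ...}\<close> and \<open>i \<in> L\<close>.\<close>

definition rank :: "'n::linorder set \<Rightarrow> 'n \<Rightarrow> nat" where
  "rank L i = card {k \<in> L. k \<le> i}"

definition sigma :: "'n::linorder set \<Rightarrow> 'n set \<Rightarrow> 'a::ring_1" where
  "sigma J L = (-1) ^ card {(j, k). j \<in> J \<and> k \<in> L \<and> j > k}"


section \<open>Graded modules\<close>

text \<open>
  A graded module lives on a subset of an additive group type; \<open>gpart M m\<close> is the set of its
  homogeneous elements of degree \<open>m\<close>.
\<close>

record ('s, 'm) graded_module =
  gcarrier :: "'m set"
  gscale :: "'s \<Rightarrow> 'm \<Rightarrow> 'm"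
  gpart :: "int \<Rightarrow> 'm set"

definition ring_mod :: "(('n::finite, 'k::comm_ring_1) poly_ring, ('n, 'k) poly_ring) graded_module" where
  "ring_mod = \<lparr>gcarrier = UNIV, gscale = (*), gpart = (\<lambda>m. {f. homogeneous m f})\<rparr>"

definition shift :: "('s, 'm) graded_module \<Rightarrow> int \<Rightarrow> ('s, 'm) graded_module" where
  "shift M d = M\<lparr>gpart := (\<lambda>m. gpart M (d + m))\<rparr>"

definition sub_mod :: "('s, 'm) graded_module \<Rightarrow> 'm set \<Rightarrow> ('s, 'm) graded_module" where
  "sub_mod M A = M\<lparr>gcarrier := A, gpart := (\<lambda>m. gpart M m \<inter> A)\<rparr>"

definition dsum :: "('s, 'a) graded_module \<Rightarrow> ('s, 'b) graded_module \<Rightarrow> ('s, 'a \<times> 'b) graded_module" where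
  "dsum M N = \<lparr>gcarrier = gcarrier M \<times> gcarrier N,
     gscale = (\<lambda>r (u, v). (gscale M r u, gscale N r v)),
     gpart = (\<lambda>m. gpart M m \<times> gpart N m)\<rparr>"

definition fscale :: "'s::times \<Rightarrow> ('i \<Rightarrow> 's) \<Rightarrow> 'i \<Rightarrow> 's" where
  "fscale r u = (\<lambda>i. r * u i)"

text \<open>
  \<open>free_mod B d\<close> is the direct sum of the modules \<open>S(-d i)\<close> over \<open>i \<in> B\<close>, consisting of the
  coordinate functions that vanish outside \<open>B\<close>; \<open>unit_vec i\<close> is its basis element with index \<open>i\<close>.
\<close>

definition free_mod ::
  "'i set \<Rightarrow> ('i \<Rightarrow> int) \<Rightarrow> (('n::finite, 'k::comm_ring_1) poly_ring, 'i \<Rightarrow> ('n, 'k) poly_ring) graded_module" where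
  "free_mod B d = \<lparr>gcarrier = {u. \<forall>i. i \<notin> B \<longrightarrow> u i = 0},
     gscale = fscale,
     gpart = (\<lambda>m. {u. (\<forall>i. i \<notin> B \<longrightarrow> u i = 0) \<and>
                      (\<forall>i\<in>B. u i \<in> gpart (shift ring_mod (- d i)) m)})\<rparr>"

definition unit_vec :: "'i \<Rightarrow> 'i \<Rightarrow> 's::zero_neq_one" where
  "unit_vec i = (\<lambda>j. if j = i then 1 else 0)"

lemma module_fscale: "module (fscale :: 's::comm_ring_1 \<Rightarrow> ('i \<Rightarrow> 's) \<Rightarrow> 'i \<Rightarrow> 's)"
  by unfold_locales (simp_all add: fscale_def fun_eq_iff algebra_simps)

lemma module_gscale_dsum:
  assumes "module (gscale M)" "module (gscale N)"
  shows "module (gscale (dsum M N))"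
  using assms by (auto simp: dsum_def module_def)

definition ghom ::
  "int \<Rightarrow> ('s, 'a::ab_group_add) graded_module \<Rightarrow> ('s, 'b::ab_group_add) graded_module \<Rightarrow> ('a \<Rightarrow> 'b) \<Rightarrow> bool" where
  "ghom k M N f \<longleftrightarrow>
     f ` gcarrier M \<subseteq> gcarrier N \<and>
     (\<forall>x\<in>gcarrier M. \<forall>y\<in>gcarrier M. f (x + y) = f x + f y) \<and>
     (\<forall>r. \<forall>x\<in>gcarrier M. f (gscale M r x) = gscale N r (f x)) \<and>
     (\<forall>m. f ` gpart M m \<subseteq> gpart N (m + k))"

definition gker :: "('s, 'a) graded_module \<Rightarrow> ('a \<Rightarrow> 'b::zero) \<Rightarrow> 'a set" where
  "gker M f = {x \<in> gcarrier M. f x = 0}"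

definition graded_ideal :: "('n::finite, 'k::comm_ring_1) poly_ring set \<Rightarrow> bool" where
  "graded_ideal I \<longleftrightarrow> (\<exists>H. (\<forall>h\<in>H. \<exists>m. homogeneous m h) \<and> I = module.span (*) H)"


section \<open>The Koszul complex\<close>

definition Koszul :: "nat \<Rightarrow> (('n::finite, 'k::comm_ring_1) poly_ring, 'n set \<Rightarrow> ('n, 'k) poly_ring) graded_module" where
  "Koszul j = free_mod {J. card J = j} (\<lambda>J. int j)"

text \<open>
  The differential sends \<open>e_J\<close>, \<open>J = {i_1 < ... < i_j}\<close>, to the sum over \<open>k\<close> of
  \<open>(-1)^(k+1) x_(i_k) e_(J - {i_k})\<close>; this is one map on the exterior algebra, whose restriction
  to \<open>Koszul j\<close> is the \<open>j\<close>-th differential.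
\<close>

definition koszul_d :: "('n set \<Rightarrow> ('n::{finite,linorder}, 'k::comm_ring_1) poly_ring) \<Rightarrow> 'n set \<Rightarrow> ('n, 'k) poly_ring" where
  "koszul_d u = (\<Sum>J\<in>UNIV. fscale (u J)
            (\<Sum>i\<in>J. fscale ((-1) ^ (rank J i + 1) * Var i) (unit_vec (J - {i}))))"

text \<open>The syzygy module \<open>E_j\<close>, a submodule of \<open>Koszul (j - 1)\<close> for \<open>j \<ge> 1\<close>.\<close>

definition Syz :: "nat \<Rightarrow> ('n set \<Rightarrow> ('n::{finite,linorder}, 'k::comm_ring_1) poly_ring) set" where
  "Syz j = koszul_d ` gcarrier (Koszul j)"

text \<open>
  Elements of the dual of \<open>Koszul j\<close> are represented as functionals on all coordinate functions;
  a combination of the \<open>dual_vec J\<close> with \<open>card J = j\<close> is determined by its restriction to \<open>Koszul j\<close>.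
\<close>

definition dual_vec :: "'i \<Rightarrow> ('i \<Rightarrow> 's) \<Rightarrow> 's" where
  "dual_vec J = (\<lambda>u. u J)"

definition \<A> :: "nat \<Rightarrow> (('n set \<Rightarrow> ('n::{finite,linorder}, 'k::comm_ring_1) poly_ring) \<Rightarrow> ('n, 'k) poly_ring) set" where
  "\<A> t = module.span fscale
     {\<Sum>i\<in>L. fscale ((-1) ^ (rank L i + 1) * sigma (L - {i}) ((UNIV - L) \<union> {i}) * Var i)
                (dual_vec ((UNIV - L) \<union> {i})) | L. card L = CARD('n) - t}"

definition \<B> :: "(('n set \<Rightarrow> ('n::{finite,linorder}, 'k::comm_ring_1) poly_ring) \<Rightarrow> ('n, 'k) poly_ring) set" where
  "\<B> = module.span fscale
     {fscale ((-1) ^ rank UNIV i * Var j) (dual_vec (UNIV - {i}))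
      - fscale ((-1) ^ rank UNIV j * Var i) (dual_vec (UNIV - {j})) | i j. i < j}"


section \<open>Long Bourbaki sequences for \<open>E_(t+1) \<oplus> E_(n-1)(d)\<close>\<close>

definition KK :: "nat \<Rightarrow> int \<Rightarrow> (('n::finite, 'k::comm_ring_1) poly_ring,
    ('n set \<Rightarrow> ('n, 'k) poly_ring) \<times> ('n set \<Rightarrow> ('n, 'k) poly_ring)) graded_module" where
  "KK t d = dsum (Koszul (t + 1)) (shift (Koszul (CARD('n) - 1)) d)"

definition EE_mod :: "nat \<Rightarrow> int \<Rightarrow> (('n::{finite,linorder}, 'k::comm_ring_1) poly_ring,
    ('n set \<Rightarrow> ('n, 'k) poly_ring) \<times> ('n set \<Rightarrow> ('n, 'k) poly_ring)) graded_module" where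
  "EE_mod t d = dsum (sub_mod (Koszul t) (Syz (t + 1))) (shift (sub_mod (Koszul (CARD('n) - 2)) (Syz (CARD('n) - 1))) d)"

text \<open>The submodule \<open>E_(t+2) \<oplus> E_n(d)\<close> of \<open>KK t d\<close>.\<close>

definition EE_next :: "nat \<Rightarrow>
    (('n::{finite,linorder} set \<Rightarrow> ('n, 'k::comm_ring_1) poly_ring) \<times> ('n set \<Rightarrow> ('n, 'k) poly_ring)) set" where
  "EE_next t = Syz (t + 2) \<times> Syz CARD('n)"

text \<open>
  The last clause asks that no basis element of the middle free module is sent to \<open>0\<close>. It
  rules out split summands \<open>0 \<rightarrow> S(-r) \<rightarrow> S(-r) \<rightarrow> 0\<close> of the sequence that do not interact with
  \<open>E_(t+1) \<oplus> E_(n-1)(d)\<close>; with such a summand no \<open>\<beta>_i\<close> outside \<open>E_(t+2) \<oplus> E_n(d)\<close> need exist: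
  for very negative \<open>r\<close>, \<open>KK t d\<close> is zero in degree \<open>r\<close>.
\<close>

definition long_bourbaki ::
  "nat \<Rightarrow> int \<Rightarrow> int \<Rightarrow> nat \<Rightarrow> (nat \<Rightarrow> int) \<Rightarrow> nat \<Rightarrow> (nat \<Rightarrow> int) \<Rightarrow>
   ('n::{finite,linorder}, 'k::field) poly_ring set \<Rightarrow> bool" where
  "long_bourbaki t d c p a q b I \<longleftrightarrow>
     (let F = free_mod {1..p} a; G = free_mod {1..q} b; M = EE_mod t d;
          N = shift (sub_mod ring_mod I) c
      in \<exists>f g h. ghom 0 F G f \<and> ghom 0 G M g \<and> ghom 0 M N h \<and>
           inj_on f (gcarrier F) \<and>
           f ` gcarrier F = gker G g \<and>
           g ` gcarrier G = gker M h \<and>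
           h ` gcarrier M = gcarrier N \<and>
           (\<forall>i\<in>{1..q}. g (unit_vec i) \<noteq> 0))"

text \<open>
  The commutative diagram inside an ambient module \<open>P\<close> with a submodule \<open>U\<close>, where \<open>\<beta>\<close> is the
  family of the \<open>\<beta>_i\<close> and \<open>W\<close> is the submodule it generates. Here \<open>\<iota>\<close> is the middle row,
  \<open>\<kappa>\<close> the top row, \<open>\<gamma>\<close> the map called \<open>\<beta>\<close> and \<open>\<rho>\<close> the map \<open>Res(\<beta>)\<close> of the diagram; the bottom
  row and the two upper vertical maps are inclusions, so the last two clauses express the
  commutativity of the upper and of the lower square.
\<close>

definition res_diagram ::
  "(('n::finite, 'k::comm_ring_1) poly_ring, 'm::ab_group_add) graded_module \<Rightarrow> 'm set \<Rightarrow>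
   nat \<Rightarrow> (nat \<Rightarrow> int) \<Rightarrow> nat \<Rightarrow> (nat \<Rightarrow> int) \<Rightarrow> (nat \<Rightarrow> 'm) \<Rightarrow> bool" where
  "res_diagram P U p a q b \<beta> \<longleftrightarrow>
     (let F = free_mod {1..p} a; G = free_mod {1..q} b;
          W = module.span (gscale P) (\<beta> ` {1..q});
          right = sub_mod P W; left = sub_mod P (W \<inter> U)
      in \<exists>\<iota> \<kappa> \<gamma> \<rho>.
           ghom 0 G right \<gamma> \<and> (\<forall>i\<in>{1..q}. \<gamma> (unit_vec i) = \<beta> i) \<and> \<gamma> ` gcarrier G = gcarrier right \<and>
           ghom 0 F left \<rho> \<and> \<rho> ` gcarrier F = gcarrier left \<and>
           ghom 0 F G \<iota> \<and> inj_on \<iota> (gcarrier F) \<and>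
           ghom 0 (sub_mod F (gker F \<rho>)) (sub_mod G (gker G \<gamma>)) \<kappa> \<and>
           bij_betw \<kappa> (gker F \<rho>) (gker G \<gamma>) \<and>
           (\<forall>x\<in>gker F \<rho>. \<kappa> x = \<iota> x) \<and>
           (\<forall>x\<in>gcarrier F. \<rho> x = \<gamma> (\<iota> x)))"

text \<open>The homomorphism \<open>(a, b)\<close>; the names \<open>a\<close> and \<open>b\<close> are used for the degrees.\<close>

definition pair_hom :: "('u \<Rightarrow> 's::plus) \<Rightarrow> ('v \<Rightarrow> 's) \<Rightarrow> 'u \<times> 'v \<Rightarrow> 's" where
  "pair_hom \<alpha>\<^sub>1 \<alpha>\<^sub>2 = (\<lambda>(u, v). \<alpha>\<^sub>1 u + \<alpha>\<^sub>2 v)"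

definition bourbaki_data ::
  "nat \<Rightarrow> int \<Rightarrow> int \<Rightarrow> nat \<Rightarrow> (nat \<Rightarrow> int) \<Rightarrow> nat \<Rightarrow> (nat \<Rightarrow> int) \<Rightarrow>
   (nat \<Rightarrow> ('n::{finite,linorder} set \<Rightarrow> ('n, 'k::field) poly_ring) \<times> ('n set \<Rightarrow> ('n, 'k) poly_ring)) \<Rightarrow>
   (('n set \<Rightarrow> ('n, 'k) poly_ring) \<times> ('n set \<Rightarrow> ('n, 'k) poly_ring) \<Rightarrow> ('n, 'k) poly_ring) \<Rightarrow> bool" where
  "bourbaki_data t d c p a q b \<beta> \<phi> \<longleftrightarrow>
     (\<forall>i\<in>{1..q}. \<beta> i \<in> gcarrier (KK t d) - EE_next t) \<and>
     (\<exists>\<alpha>\<^sub>1\<in>\<A> t. \<exists>\<alpha>\<^sub>2\<in>\<B>. \<phi> = pair_hom \<alpha>\<^sub>1 \<alpha>\<^sub>2) \<and>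
     ghom (int CARD('n) + c) (KK t d) (shift ring_mod (- int CARD('n))) \<phi> \<and>
     gker (KK t d) \<phi> = {x + y | x y. x \<in> module.span (gscale (KK t d)) (\<beta> ` {1..q}) \<and> y \<in> EE_next t} \<and>
     int p = int q - int CARD('n) + 2 - int ((CARD('n) - 1) choose t) \<and>
     res_diagram (KK t d) (EE_next t) p a q b \<beta>"

end

theory Submission
  imports Defs
begin

text \<open>
  Write \<open>\<partial>\<close> for the map \<open>K_(t+1) \<oplus> K_(n-1)(d) \<rightarrow> E_(t+1) \<oplus> E_(n-1)(d)\<close> given by the Koszul differentials. It is
  onto, and by exactness of the Koszul complex its kernel is \<open>E_(t+2) \<oplus> E_n(d)\<close>. Everything rests on
  pulling a long Bourbaki sequence back along \<open>\<partial>\<close>, and on pushing the data of the diagram forward along it.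

  The maps \<open>h\<close> from \<open>E_(t+1) \<oplus> E_(n-1)(d)\<close> to \<open>S(c)\<close> correspond to the maps \<open>\<phi> = h \<circ> \<partial>\<close> that vanish on \<open>ker \<partial>\<close>. The
  components of such a \<open>\<phi>\<close> are cocycles of the dual Koszul complex, which is exact below degree \<open>n\<close>, so they
  are combinations of the functionals \<open>e_J^* \<circ> \<partial>\<close>, and these are, up to sign, the generators of \<open>\<A> t\<close> and \<open>\<B>\<close>
  (\<open>functional_vanishing_on_Syz\<close>, \<open>sum_in_\<A>\<close>, \<open>sum_in_\<B>\<close>). The map from the middle free module
  corresponds to the lifts \<open>\<beta>_i\<close> of the images of the basis elements; its image is \<open>ker h\<close> exactly if
  \<open>ker \<phi>\<close> is the sum of \<open>\<langle>\<beta>_1,...,\<beta>_q\<rangle>\<close> and \<open>ker \<partial>\<close>, and its kernel consists of the elements that \<open>\<beta>\<close> sends to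
  \<open>\<langle>\<beta>_1,...,\<beta>_q\<rangle> \<inter> ker \<partial>\<close>, which is what the diagram records. Exactness of the Koszul complex and the
  homogeneous lifts both come from one explicit contraction, \<open>koszul_h\<close>, that preserves degrees; the dual
  complex is reduced to the complex itself by passing to complements.

  The formula for \<open>p\<close> is a count of ranks, with \<open>rank E_(j+1) = (n-1 choose j)\<close> and \<open>rank I = 1\<close>
  (\<open>long_bourbaki_rank\<close>). The point is that \<open>I\<close> cannot be \<open>0\<close>. Otherwise \<open>E_(t+1)\<close> would be a direct summand of
  a module with a free resolution of length one, hence \<open>E_(t+2)\<close> projective, and \<open>K_(t+2) \<rightarrow> E_(t+2)\<close> would have
  a section. The kernel \<open>E_(t+3)\<close> would then be a direct summand of \<open>K_(t+2)\<close> inside \<open>\<mm> K_(t+2)\<close>; but this forces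
  it into \<open>\<mm>\<^sup>2 K_(t+2)\<close>, whereas \<open>\<partial> e_J\<close> has variables as coordinates (\<open>no_linear_section_of_koszul_d\<close>,
  \<open>no_short_resolution\<close>). Here \<open>t \<le> n - 4\<close> guarantees that there is a basis element \<open>e_J\<close> of \<open>K_(t+3)\<close>.
\<close>

section \<open>Monomials and homogeneous polynomials\<close>

lemma lookup_single_times:
  fixes f :: "('a::cancel_comm_monoid_add) \<Rightarrow>\<^sub>0 'k::comm_ring_1"
  shows "Poly_Mapping.lookup (Poly_Mapping.single a 1 * f) (a + \<mu>) = Poly_Mapping.lookup f \<mu>"
proof -
  have "Poly_Mapping.lookup (Poly_Mapping.single a 1 * f) (a + \<mu>)
      = (\<Sum>l. Poly_Mapping.lookup (Poly_Mapping.single a 1) l * (\<Sum>q. Poly_Mapping.lookup f q when a + \<mu> = l + q))"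
    by (simp add: Poly_Mapping.lookup_mult)
  also have "\<dots> = (\<Sum>l. ((\<Sum>q. Poly_Mapping.lookup f q when a + \<mu> = a + q) when a = l))"
    by (rule Sum_any.cong) (auto simp: lookup_single when_def)
  also have "\<dots> = (\<Sum>q. Poly_Mapping.lookup f q when \<mu> = q)" by simp
  finally show ?thesis by simp
qed

lemma lookup_single_times_eq_0:
  fixes f :: "('a::cancel_comm_monoid_add) \<Rightarrow>\<^sub>0 'k::comm_ring_1"
  assumes "\<And>\<nu>. \<mu> \<noteq> a + \<nu>"
  shows "Poly_Mapping.lookup (Poly_Mapping.single a 1 * f) \<mu> = 0"
proof -
  have "\<mu> \<notin> Poly_Mapping.keys (Poly_Mapping.single a (1::'k) * f)"
    using Poly_Mapping.keys_mult[of "Poly_Mapping.single a (1::'k)" f] assms by (force split: if_splits)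
  then show ?thesis by (simp add: in_keys_iff)
qed

lemma lookup_Var_times:
  "Poly_Mapping.lookup (Var i * f) \<mu> =
     (if Poly_Mapping.lookup \<mu> i = 0 then 0
      else Poly_Mapping.lookup f (\<mu> - Poly_Mapping.single i 1))"
proof (cases "Poly_Mapping.lookup \<mu> i = 0")
  case True
  have "\<mu> \<noteq> Poly_Mapping.single i 1 + \<nu>" for \<nu>
    using True by (auto simp: lookup_add lookup_single)
  then show ?thesis using True unfolding Var_def by (simp add: lookup_single_times_eq_0)
next
  case False
  have "\<mu> = Poly_Mapping.single i 1 + (\<mu> - Poly_Mapping.single i 1)"
    using False by (intro poly_mapping_eqI) (auto simp: lookup_add lookup_minus lookup_single when_def)
  then show ?thesis using False lookup_single_times[of "Poly_Mapping.single i 1" f "\<mu> - Poly_Mapping.single i 1"]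
    unfolding Var_def by simp
qed

lemma homogeneous_0 [simp]: "homogeneous m 0"
  by (simp add: homogeneous_def)

lemma homogeneous_iff:
  "homogeneous m f \<longleftrightarrow>
    (\<forall>\<mu>. Poly_Mapping.lookup f \<mu> \<noteq> 0 \<longrightarrow> int (\<Sum>i\<in>UNIV. Poly_Mapping.lookup \<mu> i) = m)"
  by (simp add: homogeneous_def in_keys_iff Ball_def)

lemma homogeneous_add: "homogeneous m f \<Longrightarrow> homogeneous m g \<Longrightarrow> homogeneous m (f + g)"
  using Poly_Mapping.keys_add[of f g] by (auto simp: homogeneous_def)

lemma homogeneous_sum: "(\<And>x. x \<in> A \<Longrightarrow> homogeneous m (f x)) \<Longrightarrow> homogeneous m (sum f A)"
  by (induction A rule: infinite_finite_induct) (auto intro: homogeneous_add)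

lemma homogeneous_mult:
  fixes f g :: "('n::finite, 'k::comm_ring_1) poly_ring"
  assumes "homogeneous m f" "homogeneous l g"
  shows "homogeneous (m + l) (f * g)"
  using assms Poly_Mapping.keys_mult[of f g]
  by (fastforce simp: homogeneous_def lookup_add sum.distrib)

lemma homogeneous_1 [simp]: "homogeneous 0 (1 :: ('n::finite, 'k::comm_ring_1) poly_ring)"
  by (auto simp: homogeneous_iff lookup_one when_def split: if_splits)

lemma homogeneous_Var: "homogeneous 1 (Var i :: ('n::finite, 'k::comm_ring_1) poly_ring)"
  by (auto simp: homogeneous_iff Var_def lookup_single when_def simp flip: of_nat_sum split: if_splits)

lemma homogeneous_uminus: "homogeneous m f \<Longrightarrow> homogeneous m (- f)"
  for f :: "('n::finite, 'k::comm_ring_1) poly_ring"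
  by (auto simp: homogeneous_iff)

lemma homogeneous_sign: "homogeneous m f \<Longrightarrow> homogeneous m ((-1) ^ k * f)"
  for f :: "('n::finite, 'k::comm_ring_1) poly_ring"
  by (cases "even k") (auto intro: homogeneous_uminus)

section \<open>The Koszul differential in coordinates\<close>

text \<open>
  The sign of \<open>e_J\<close> in \<open>\<partial> e_(J \<union> {i})\<close> and of \<open>e_(J \<union> {i})\<close> in \<open>e_i \<and> e_J\<close>, for \<open>i \<notin> J\<close>. Counting elements
  below \<open>i\<close> gives the same value for \<open>J\<close> and \<open>J \<union> {i}\<close>, so that no case distinction on \<open>i \<in> J\<close> arises.
\<close>

definition ksign :: "'n::linorder \<Rightarrow> 'n set \<Rightarrow> 'a::ring_1" where
  "ksign i J = (-1) ^ card {k \<in> J. k < i}"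

lemma ksign_square [simp]: "ksign i J * ksign i J = (1 :: 'a::ring_1)"
  by (simp add: ksign_def flip: power_add)

lemma ksign_insert_less:
  fixes J :: "'n::{finite,linorder} set"
  assumes "k < i" "k \<notin> J"
  shows "ksign i (insert k J) = - (ksign i J :: 'a::ring_1)"
proof -
  have "{l \<in> insert k J. l < i} = insert k {l \<in> J. l < i}" using assms by auto
  then show ?thesis using assms by (simp add: ksign_def)
qed

lemma ksign_insert_ge:
  assumes "i \<le> k"
  shows "ksign i (insert k J) = ksign i J"
proof -
  have "{l \<in> insert k J. l < i} = {l \<in> J. l < i}" using assms by auto
  then show ?thesis by (simp add: ksign_def)
qed

lemma rank_conv_ksign:
  fixes J :: "'n::{finite,linorder} set"
  assumes "i \<in> J"
  shows "(-1) ^ (rank J i + 1) = (ksign i (J - {i}) :: 'a::ring_1)"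
proof -
  have "{k \<in> J. k \<le> i} = insert i {k \<in> J - {i}. k < i}" using assms by auto
  then show ?thesis by (simp add: rank_def ksign_def)
qed

lemma koszul_d_apply:
  fixes u :: "'n set \<Rightarrow> ('n::{finite,linorder}, 'k::comm_ring_1) poly_ring"
  shows "koszul_d u J = (\<Sum>i\<in>-J. ksign i J * Var i * u (insert i J))"
proof -
  have sum_app: "(\<Sum>x\<in>X. f x) J = (\<Sum>x\<in>X. f x J)" for X :: "'b set" and f :: "'b \<Rightarrow> 'n set \<Rightarrow> ('n, 'k) poly_ring"
    by (induction X rule: infinite_finite_induct) auto
  have "koszul_d u J = (\<Sum>J'\<in>UNIV. \<Sum>i\<in>J'. if J = J' - {i} then ksign i J * Var i * u J' else 0)"
    unfolding koszul_d_def fscale_def sum_app unit_vec_def sum_distrib_left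
    by (intro sum.cong refl, subst rank_conv_ksign) (simp_all add: mult_ac)
  also have "\<dots> = (\<Sum>(J', i)\<in>(SIGMA J':UNIV. J'). if J = J' - {i} then ksign i J * Var i * u J' else 0)"
    by (rule sum.Sigma) auto
  also have "\<dots> = (\<Sum>(J', i)\<in>(\<lambda>i. (insert i J, i)) ` (-J). ksign i J * Var i * u J')"
    by (rule sum.mono_neutral_cong_right) auto
  also have "\<dots> = (\<Sum>i\<in>-J. ksign i J * Var i * u (insert i J))"
    by (subst sum.reindex) (auto simp: inj_on_def)
  finally show ?thesis .
qed

lemma koszul_d_add: "koszul_d (u + v) = koszul_d u + koszul_d v"
  by (rule ext) (simp add: koszul_d_apply algebra_simps sum.distrib)

lemma koszul_d_0 [simp]: "koszul_d 0 = 0"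
  by (rule ext) (simp add: koszul_d_apply)

lemma koszul_d_uminus: "koszul_d (- u) = - koszul_d u"
  by (rule ext) (simp add: koszul_d_apply sum_negf)

lemma koszul_d_diff: "koszul_d (u - v) = koszul_d u - koszul_d v"
  using koszul_d_add[of u "-v"] by (simp add: koszul_d_uminus)

lemma koszul_d_scale: "koszul_d (fscale r u) = fscale r (koszul_d u)"
  by (rule ext) (simp add: koszul_d_apply fscale_def sum_distrib_left mult_ac)

lemma koszul_d_sum: "koszul_d (sum f A) = (\<Sum>x\<in>A. koszul_d (f x))"
  for f :: "'b \<Rightarrow> 'n set \<Rightarrow> ('n::{finite,linorder}, 'k::comm_ring_1) poly_ring"
  using sum_comp_morphism[where h = koszul_d, OF koszul_d_0 koszul_d_add, of f A] by (simp only: comp_def)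

text \<open>
  Every basis element of \<open>\<partial>\<partial>e\<close> arises by removing two indices in either order, and the
  two orders have opposite signs. The terms are paired explicitly, since an antisymmetric
  double sum need not vanish in characteristic two.
\<close>

lemma koszul_d_koszul_d: "koszul_d (koszul_d u) = 0"
  for u :: "'n set \<Rightarrow> ('n::{finite,linorder}, 'k::comm_ring_1) poly_ring"
proof (rule ext)
  fix J :: "'n set"
  define c :: "'n \<times> 'n \<Rightarrow> ('n, 'k) poly_ring" where
    "c = (\<lambda>(i, k). ksign i J * ksign k (insert i J) * (Var i * Var k * u (insert i (insert k J))))"
  define P where "P = {(i, k). i \<notin> J \<and> k \<notin> J \<and> i < k}"
  have anti: "c (k, i) = - c (i, k)" if "i < k" "i \<notin> J" for i k
    using that by (simp add: c_def ksign_insert_less ksign_insert_ge insert_commute mult_ac)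
  have "koszul_d (koszul_d u) J = (\<Sum>i\<in>-J. \<Sum>k\<in>-insert i J. c (i, k))"
    by (simp add: koszul_d_apply c_def sum_distrib_left mult_ac insert_commute)
  also have "\<dots> = (\<Sum>x\<in>(SIGMA i:-J. -insert i J). c x)"
    by (subst sum.Sigma) auto
  also have "(SIGMA i:-J. -insert i J) = P \<union> prod.swap ` P"
    by (auto simp: P_def image_iff)
  also have "(\<Sum>x\<in>P \<union> prod.swap ` P. c x) = (\<Sum>x\<in>P. c x) + (\<Sum>x\<in>prod.swap ` P. c x)"
    by (rule sum.union_disjoint) (auto simp: P_def)
  also have "(\<Sum>x\<in>prod.swap ` P. c x) = (\<Sum>x\<in>P. c (prod.swap x))"
    by (subst sum.reindex) (auto simp: inj_on_def)
  also have "\<dots> = (\<Sum>x\<in>P. - c x)"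
    by (rule sum.cong) (auto simp: P_def anti)
  finally show "koszul_d (koszul_d u) J = 0 J" by (simp add: sum_negf)
qed

section \<open>Exactness of the Koszul complex\<close>

text \<open>
  The terms of \<open>f\<close> whose smallest variable is \<open>x_j\<close>, divided by \<open>x_j\<close>. Apart from its constant term,
  \<open>f\<close> is the sum of the polynomials \<open>x_j * min_part j f\<close>.
\<close>

lift_definition min_part :: "'n::linorder \<Rightarrow> ('n, 'k::comm_ring_1) poly_ring \<Rightarrow> ('n, 'k) poly_ring" is
  "\<lambda>j f \<mu>. if \<forall>k<j. Poly_Mapping.lookup \<mu> k = 0 then f (\<mu> + Poly_Mapping.single j 1) else 0"
proof -
  fix j :: 'n and f :: "('n \<Rightarrow>\<^sub>0 nat) \<Rightarrow> 'k"
  assume "finite {x. f x \<noteq> 0}"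
  then have "finite ((\<lambda>\<mu>. \<mu> + Poly_Mapping.single j 1) -` {x. f x \<noteq> 0})"
    by (rule finite_vimageI) (auto simp: inj_on_def)
  then show "finite {\<mu>. (if \<forall>k<j. Poly_Mapping.lookup \<mu> k = 0 then f (\<mu> + Poly_Mapping.single j 1) else 0) \<noteq> 0}"
    by (rule rev_finite_subset) auto
qed

lemma min_part_0 [simp]: "min_part j 0 = 0"
  by transfer auto

text \<open>
  In each multidegree, with support \<open>T\<close>, the Koszul complex is the chain complex of the full simplex
  on \<open>T\<close>. Coning off with the vertex \<open>Min T\<close> contracts it; this is the contraction, written on the target:
  \<open>x^\<mu> e_J\<close> occurs in its image only if \<open>Min J\<close> is the cone vertex. It is linear only over the
  coefficient field, but it works in every characteristic and preserves degrees.
\<close>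

definition koszul_h :: "('n set \<Rightarrow> ('n::{finite,linorder}, 'k::comm_ring_1) poly_ring) \<Rightarrow> 'n set \<Rightarrow> ('n, 'k) poly_ring" where
  "koszul_h u J = (if J = {} then 0 else min_part (Min J) (u (J - {Min J})))"

lemma homogeneous_min_part:
  fixes f :: "('n::{finite,linorder}, 'k::comm_ring_1) poly_ring"
  assumes "homogeneous m f"
  shows "homogeneous (m - 1) (min_part j f)"
proof -
  have "int (\<Sum>i\<in>UNIV. Poly_Mapping.lookup \<mu> i) = m - 1"
    if "Poly_Mapping.lookup f (\<mu> + Poly_Mapping.single j 1) \<noteq> 0" for \<mu>
  proof -
    have "int (\<Sum>i\<in>UNIV. Poly_Mapping.lookup (\<mu> + Poly_Mapping.single j 1) i) = m"
      using assms that unfolding homogeneous_iff by blast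
    then show ?thesis by (simp add: lookup_add lookup_single when_def sum.distrib)
  qed
  then show ?thesis unfolding homogeneous_iff by (auto simp: min_part.rep_eq split: if_splits)
qed

text \<open>
  The contraction yields preimages of cycles, except in multidegree \<open>0\<close>, where \<open>T\<close> is empty; hence the
  condition on the constant term. The coefficient of \<open>x^\<mu> e_J\<close> is compared in multidegree
  \<open>T = J \<union> supp \<mu>\<close>, according to whether the cone vertex \<open>m = Min T\<close> lies in \<open>J\<close>.
\<close>

lemma koszul_d_koszul_h:
  fixes u :: "'n set \<Rightarrow> ('n::{finite,linorder}, 'k::comm_ring_1) poly_ring"
  assumes cycle: "koszul_d u = 0" and const: "Poly_Mapping.lookup (u {}) 0 = 0"
  shows "koszul_d (koszul_h u) = u"
proof (intro ext poly_mapping_eqI)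
  fix J :: "'n set" and \<mu> :: "'n \<Rightarrow>\<^sub>0 nat"
  define e where "e = (\<lambda>i::'n. Poly_Mapping.single i (1::nat))"
  have e_fold: "Poly_Mapping.single i (Suc 0) = e i" for i by (simp add: e_def)
  define I where "I = {i \<in> -J. Poly_Mapping.lookup \<mu> i \<noteq> 0}"
  have coeff: "Poly_Mapping.lookup (koszul_d v A) \<nu> =
      (\<Sum>i\<in>{i\<in>-A. Poly_Mapping.lookup \<nu> i \<noteq> 0}. ksign i A * Poly_Mapping.lookup (v (insert i A)) (\<nu> - e i))"
    for v :: "'n set \<Rightarrow> ('n, 'k) poly_ring" and A \<nu>
  proof -
    have "Poly_Mapping.lookup (ksign i A * (Var i * v (insert i A))) \<nu> =
      ksign i A * Poly_Mapping.lookup (Var i * v (insert i A)) \<nu>" for i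
      by (cases "even (card {k \<in> A. k < i})") (auto simp: ksign_def)
    then have "Poly_Mapping.lookup (koszul_d v A) \<nu> =
       (\<Sum>i\<in>-A. if Poly_Mapping.lookup \<nu> i = 0 then 0 else ksign i A * Poly_Mapping.lookup (v (insert i A)) (\<nu> - e i))"
      by (auto simp: koszul_d_apply lookup_sum lookup_Var_times e_def mult.assoc intro!: sum.cong)
    then show ?thesis
      by (simp add: sum.If_cases Int_def)
  qed
  define T where "T = J \<union> {i. Poly_Mapping.lookup \<mu> i \<noteq> 0}"
  show "Poly_Mapping.lookup (koszul_d (koszul_h u) J) \<mu> = Poly_Mapping.lookup (u J) \<mu>"
  proof (cases "T = {}")
    case True
    then have "J = {}" "\<mu> = 0" "I = {}"
      by (auto simp: T_def I_def intro!: poly_mapping_eqI)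
    then show ?thesis using const by (simp add: coeff)
  next
    case False
    define m where "m = Min T"
    have mT: "m \<in> T" and mle: "\<And>i. i \<in> T \<Longrightarrow> m \<le> i"
      using False by (auto simp: m_def)
    have low: "Poly_Mapping.lookup \<mu> k = 0" if "k < m" for k
      using mle[of k] that by (cases "Poly_Mapping.lookup \<mu> k = 0") (auto simp: T_def)
    show ?thesis
    proof (cases "m \<in> J")
      case mJ: False
      have mI: "m \<in> I" using mT mJ by (auto simp: T_def I_def)
      have ksm: "ksign m J = (1::'k)"
      proof -
        have emp: "{k \<in> J. k < m} = {}" using mle by (fastforce simp: T_def)
        show ?thesis unfolding ksign_def emp by simp
      qed
      \<comment> \<open>only \<open>i = m\<close> contributes: for the other \<open>i\<close> the monomial still contains \<open>x_m\<close>,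
        which is smaller than the smallest element of \<open>insert i J\<close>\<close>
      have summand: "Poly_Mapping.lookup (koszul_h u (insert i J)) (\<mu> - e i) =
          (if i = m then Poly_Mapping.lookup (u J) \<mu> else 0)" if i: "i \<in> I" for i
      proof (cases "i = m")
        case True
        have Min: "Min (insert m J) = m"
          by (rule Min_eqI) (use mle in \<open>force simp: T_def\<close>)+
        have "\<mu> - e m + e m = \<mu>"
          using mI by (intro poly_mapping_eqI) (auto simp: I_def e_def lookup_add lookup_minus lookup_single when_def)
        then show ?thesis using True mJ low
          by (simp add: koszul_h_def Min min_part.rep_eq lookup_minus e_fold)
      next
        case False
        have iT: "i \<in> T" using i by (auto simp: I_def T_def)
        have "m < k" if "k \<in> insert i J" for k
          using mle[of k] iT False mJ that by (cases "k = m") (auto simp: T_def)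
        then have "m < Min (insert i J)" by simp
        moreover have "Poly_Mapping.lookup (\<mu> - e i) m \<noteq> 0"
          using False mI by (simp add: lookup_minus e_def lookup_single I_def)
        ultimately show ?thesis using False by (auto simp add: koszul_h_def min_part.rep_eq simp del: Min_gr_iff)
      qed
      have "Poly_Mapping.lookup (koszul_d (koszul_h u) J) \<mu> =
          (\<Sum>i\<in>I. ksign i J * (if i = m then Poly_Mapping.lookup (u J) \<mu> else 0))"
        unfolding coeff I_def[symmetric] by (rule sum.cong) (auto simp: summand)
      also have "\<dots> = (\<Sum>i\<in>I. if i = m then Poly_Mapping.lookup (u J) \<mu> else 0)"
        by (rule sum.cong) (auto simp: ksm)
      also have "\<dots> = Poly_Mapping.lookup (u J) \<mu>" using mI by simp
      finally show ?thesis .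
    next
      case mJ: True
      define A where "A = J - {m}"
      have J: "J = insert m A" "m \<notin> A" using mJ by (auto simp: A_def)
      have ksm: "ksign m A = (1::'k)"
      proof -
        have emp: "{k \<in> A. k < m} = {}" using mle by (fastforce simp: T_def A_def)
        show ?thesis unfolding ksign_def emp by simp
      qed
      have mI: "m \<notin> I" using mJ by (auto simp: I_def)
      have gt: "m < i" if "i \<in> I" for i
        using that mle[of i] mI by (cases "i = m") (auto simp: I_def T_def)
      have summand: "Poly_Mapping.lookup (koszul_h u (insert i J)) (\<mu> - e i) =
          Poly_Mapping.lookup (u (insert i A)) (\<mu> + e m - e i)" if i: "i \<in> I" for i
      proof -
        have Min: "Min (insert i J) = m"
          by (rule Min_eqI) (use mle mJ gt[OF i] in \<open>auto simp: T_def\<close>)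
        have "insert i J - {m} = insert i A" using gt[OF i] by (auto simp: A_def)
        moreover have "\<mu> - e i + e m = \<mu> + e m - e i"
          using i gt[OF i] by (intro poly_mapping_eqI) (auto simp: I_def e_def lookup_add lookup_minus lookup_single when_def)
        ultimately show ?thesis using low
          by (simp add: koszul_h_def Min min_part.rep_eq lookup_minus e_fold)
      qed
      \<comment> \<open>the cycle condition at \<open>J - {m}\<close> expresses the coefficient of \<open>u J\<close> by the summands of
        \<open>\<partial> (h u) J\<close>, up to the sign caused by the additional smaller index \<open>m\<close>\<close>
      have "0 = Poly_Mapping.lookup (koszul_d u A) (\<mu> + e m)" using cycle by simp
      also have "{i\<in>-A. Poly_Mapping.lookup (\<mu> + e m) i \<noteq> 0} = insert m I"
        by (auto simp: A_def I_def e_def lookup_add lookup_single when_def)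
      then have "Poly_Mapping.lookup (koszul_d u A) (\<mu> + e m)
         = (\<Sum>i\<in>insert m I. ksign i A * Poly_Mapping.lookup (u (insert i A)) (\<mu> + e m - e i))"
        by (simp add: coeff)
      also have "\<dots> = Poly_Mapping.lookup (u J) \<mu> +
          (\<Sum>i\<in>I. ksign i A * Poly_Mapping.lookup (u (insert i A)) (\<mu> + e m - e i))"
        using mI by (simp add: ksm flip: J(1))
      finally have u: "Poly_Mapping.lookup (u J) \<mu> =
          - (\<Sum>i\<in>I. ksign i A * Poly_Mapping.lookup (u (insert i A)) (\<mu> + e m - e i))"
        by (simp add: eq_neg_iff_add_eq_0)
      have "Poly_Mapping.lookup (koszul_d (koszul_h u) J) \<mu> =
          (\<Sum>i\<in>I. - (ksign i A * Poly_Mapping.lookup (u (insert i A)) (\<mu> + e m - e i)))"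
        unfolding coeff I_def[symmetric]
        by (rule sum.cong) (auto simp: summand[unfolded J(1)] J ksign_insert_less gt)
      then show ?thesis using u by (simp add: sum_negf)
    qed
  qed
qed

section \<open>Koszul modules and syzygy modules\<close>

lemma sum_fun_apply: "(\<Sum>x\<in>A. f x) i = (\<Sum>x\<in>A. f x i)"
  by (induction A rule: infinite_finite_induct) auto

lemma gcarrier_free_mod: "u \<in> gcarrier (free_mod B d) \<longleftrightarrow> (\<forall>i. i \<notin> B \<longrightarrow> u i = 0)"
  by (simp add: free_mod_def)

lemma gpart_free_mod:
  "u \<in> gpart (free_mod B d) m \<longleftrightarrow> (\<forall>i. i \<notin> B \<longrightarrow> u i = 0) \<and> (\<forall>i\<in>B. homogeneous (m - d i) (u i))"
  by (simp add: free_mod_def shift_def ring_mod_def)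

lemma gcarrier_Koszul: "u \<in> gcarrier (Koszul j) \<longleftrightarrow> (\<forall>J. card J \<noteq> j \<longrightarrow> u J = 0)"
  by (simp add: Koszul_def gcarrier_free_mod)

lemma gpart_Koszul:
  "u \<in> gpart (Koszul j) m \<longleftrightarrow> u \<in> gcarrier (Koszul j) \<and> (\<forall>J. homogeneous (m - int j) (u J))"
  by (auto simp: Koszul_def gpart_free_mod gcarrier_free_mod)

lemma koszul_d_Koszul:
  assumes "u \<in> gcarrier (Koszul (Suc j))"
  shows "koszul_d u \<in> gcarrier (Koszul j)"
  using assms by (auto simp: gcarrier_Koszul koszul_d_apply)

lemma koszul_d_gpart:
  assumes "u \<in> gpart (Koszul (Suc j)) m"
  shows "koszul_d u \<in> gpart (Koszul j) m"
proof -
  have "homogeneous (m - int j) (ksign i J * Var i * u (insert i J))" for i J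
    using homogeneous_mult[OF homogeneous_Var[of i], of "m - int (Suc j)" "u (insert i J)"] assms
    unfolding ksign_def mult.assoc by (intro homogeneous_sign) (simp add: gpart_Koszul)
  then show ?thesis using assms koszul_d_Koszul
    by (auto simp: gpart_Koszul koszul_d_apply intro!: homogeneous_sum)
qed

lemma koszul_h_Koszul:
  assumes "u \<in> gcarrier (Koszul j)"
  shows "koszul_h u \<in> gcarrier (Koszul (Suc j))"
proof -
  have "u (J - {Min J}) = 0" if "card J \<noteq> Suc j" "J \<noteq> {}" for J
  proof -
    have "card J = Suc (card (J - {Min J}))"
      using that by (intro card.remove Min_in) auto
    then show ?thesis using assms that by (auto simp: gcarrier_Koszul)
  qed
  then show ?thesis by (simp add: gcarrier_Koszul koszul_h_def)
qed

lemma koszul_h_gpart: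
  assumes "u \<in> gpart (Koszul j) m"
  shows "koszul_h u \<in> gpart (Koszul (Suc j)) m"
proof -
  have "homogeneous (m - int j - 1) (koszul_h u J)" for J
    using assms homogeneous_min_part[of "m - int j" "u (J - {Min J})" "Min J"] by (simp add: gpart_Koszul koszul_h_def)
  then show ?thesis using assms koszul_h_Koszul by (auto simp: gpart_Koszul algebra_simps)
qed

lemma lookup_koszul_d_0: "Poly_Mapping.lookup (koszul_d u J) 0 = 0"
proof -
  have "Poly_Mapping.lookup (ksign i J * (Var i * u (insert i J))) 0 = 0" for i
    by (cases "even (card {k \<in> J. k < i})") (auto simp: ksign_def lookup_Var_times)
  then show ?thesis by (simp add: koszul_d_apply lookup_sum mult.assoc)
qed

text \<open>
  Exactness in all degrees at once: the constant term matters only for \<open>j = 0\<close>, where the image of \<open>\<partial>\<close>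
  is the maximal ideal and not all of \<open>K_0\<close>.
\<close>

lemma mem_Syz_Suc_iff:
  "u \<in> Syz (Suc j) \<longleftrightarrow> u \<in> gcarrier (Koszul j) \<and> koszul_d u = 0 \<and> Poly_Mapping.lookup (u {}) 0 = 0"
proof safe
  assume "u \<in> Syz (Suc j)"
  then obtain v where "v \<in> gcarrier (Koszul (Suc j))" "u = koszul_d v" by (auto simp: Syz_def)
  then show "u \<in> gcarrier (Koszul j)" "koszul_d u = 0" "Poly_Mapping.lookup (u {}) 0 = 0"
    by (auto simp: koszul_d_Koszul koszul_d_koszul_d lookup_koszul_d_0)
next
  assume "u \<in> gcarrier (Koszul j)" "koszul_d u = 0" "Poly_Mapping.lookup (u {}) 0 = 0"
  then show "u \<in> Syz (Suc j)"
    unfolding Syz_def using koszul_h_Koszul[of u] koszul_d_koszul_h[of u]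
    by (intro image_eqI[of _ _ "koszul_h u"]) simp_all
qed

lemma mem_Syz_iff_cycle:
  assumes "0 < j"
  shows "u \<in> Syz (Suc j) \<longleftrightarrow> u \<in> gcarrier (Koszul j) \<and> koszul_d u = 0"
  using assms by (auto simp: mem_Syz_Suc_iff gcarrier_Koszul)

lemma koszul_d_koszul_h_Syz: "u \<in> Syz (Suc j) \<Longrightarrow> koszul_d (koszul_h u) = u"
  using mem_Syz_Suc_iff koszul_d_koszul_h by blast

lemma card_Compl: "card (- J) = CARD('n) - card J" for J :: "'n::finite set"
  by (simp add: Compl_eq_Diff_UNIV card_Diff_subset)

section \<open>Exactness of the dual Koszul complex\<close>

text \<open>
  The transpose of \<open>koszul_d\<close>, acting on the coefficients of functionals.
\<close>

definition koszul_delta :: "('n set \<Rightarrow> ('n::{finite,linorder}, 'k::comm_ring_1) poly_ring) \<Rightarrow> 'n set \<Rightarrow> ('n, 'k) poly_ring" where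
  "koszul_delta c J = (\<Sum>i\<in>J. ksign i (J - {i}) * Var i * c (J - {i}))"

text \<open>
  With these signs, passing to complements intertwines \<open>koszul_delta\<close> with \<open>koszul_d\<close>: deleting \<open>i\<close> from
  the complement of \<open>J\<close> has a sign counting the elements of \<open>- J\<close> below \<open>i\<close>, inserting it into \<open>J\<close> one counting those
  of \<open>J\<close>, and the product of the two signs does not depend on \<open>J\<close>.
\<close>

definition star_sign :: "'n::{finite,linorder} set \<Rightarrow> 'a::comm_ring_1" where
  "star_sign J = (\<Prod>k\<in>J. ksign k UNIV)"

definition star :: "('n set \<Rightarrow> ('n::{finite,linorder}, 'k::comm_ring_1) poly_ring) \<Rightarrow> 'n set \<Rightarrow> ('n, 'k) poly_ring" where
  "star c J = star_sign J * c (- J)"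

lemma star_sign_square: "star_sign J * star_sign J = (1 :: 'a::comm_ring_1)"
  unfolding star_sign_def by (simp flip: prod.distrib)

lemma star_sign_Compl:
  fixes J :: "'n::{finite,linorder} set"
  shows "star_sign J * star_sign (- J) = (star_sign (UNIV :: 'n set) :: 'a::comm_ring_1)"
  unfolding star_sign_def by (subst prod.union_disjoint[symmetric]) (auto simp: Compl_partition)

lemma star_star:
  fixes c :: "'n set \<Rightarrow> ('n::{finite,linorder}, 'k::comm_ring_1) poly_ring"
  shows "star (star c) = fscale (star_sign (UNIV :: 'n set)) c"
  by (rule ext) (simp add: star_def fscale_def star_sign_Compl flip: mult.assoc)

lemma ksign_Compl:
  fixes J :: "'n::{finite,linorder} set"
  shows "ksign i J * ksign i (- J) = (ksign i UNIV :: 'a::comm_ring_1)"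
proof -
  have "card {k \<in> UNIV. k < i} = card ({k \<in> J. k < i} \<union> {k \<in> - J. k < i})"
    by (rule arg_cong[where f = card]) auto
  also have "\<dots> = card {k \<in> J. k < i} + card {k \<in> - J. k < i}"
    by (rule card_Un_disjoint) auto
  finally show ?thesis unfolding ksign_def by (simp add: power_add)
qed

lemma koszul_d_star:
  fixes c :: "'n set \<Rightarrow> ('n::{finite,linorder}, 'k::comm_ring_1) poly_ring"
  shows "koszul_d (star c) = star (koszul_delta c)"
proof (rule ext)
  fix J :: "'n set"
  have "ksign i J * Var i * star c (insert i J) =
      star_sign J * (ksign i (- J - {i}) * Var i * c (- J - {i}))" if "i \<notin> J" for i
  proof -
    have "ksign i (insert i (- J - {i})) = (ksign i (- J - {i}) :: ('n, 'k) poly_ring)"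
      by (rule ksign_insert_ge) simp
    then have 1: "ksign i (- J - {i}) = (ksign i (- J) :: ('n, 'k) poly_ring)"
      using that by (simp add: insert_absorb)
    have 2: "ksign i J * ksign i UNIV = (ksign i (- J) :: ('n, 'k) poly_ring)"
      by (simp add: flip: ksign_Compl[of i J] mult.assoc)
    have "- insert i J = - J - {i}" by auto
    moreover have "star_sign (insert i J) = ksign i UNIV * (star_sign J :: ('n, 'k) poly_ring)"
      using that by (simp add: star_sign_def)
    ultimately have "ksign i J * Var i * star c (insert i J) =
        star_sign J * ((ksign i J * ksign i UNIV) * Var i * c (- J - {i}))"
      by (simp add: star_def mult_ac)
    then show ?thesis using 1 2 by simp
  qed
  then show "koszul_d (star c) J = star (koszul_delta c) J"
    unfolding koszul_d_apply star_def[of "koszul_delta c"] koszul_delta_def sum_distrib_left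
    by (intro sum.cong) auto
qed

lemma star_inject:
  fixes c c' :: "'n set \<Rightarrow> ('n::{finite,linorder}, 'k::comm_ring_1) poly_ring"
  assumes "star c = star c'"
  shows "c = c'"
proof -
  have "fscale (star_sign (UNIV :: 'n set)) (star (star c)) = fscale (star_sign (UNIV :: 'n set)) (star (star c'))"
    using assms by simp
  then show "c = c'"
    by (simp add: star_star fscale_def star_sign_square fun_eq_iff flip: mult.assoc)
qed

lemma star_scale: "star (fscale r c) = fscale r (star c)"
  by (rule ext) (simp add: star_def fscale_def mult_ac)

text \<open>
  Self-duality of the Koszul complex: the complements turn a cocycle into a cycle. The bound on \<open>j\<close>
  keeps the cocycle away from the coordinate \<open>[n]\<close>, whose complement is the empty set, so that the
  constant term of the cycle vanishes.
\<close>

lemma koszul_delta_exact: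
  fixes c :: "'n set \<Rightarrow> ('n::{finite,linorder}, 'k::comm_ring_1) poly_ring"
  assumes "koszul_delta c = 0" and "c \<in> gcarrier (Koszul (Suc j))" and "Suc j < CARD('n)"
  shows "\<exists>b\<in>gcarrier (Koszul j). c = koszul_delta b"
proof -
  have card_le: "card J \<le> CARD('n)" for J :: "'n set" by (simp add: card_mono)
  define b where "b = fscale (star_sign (UNIV :: 'n set)) (star (koszul_h (star c)))"
  have "star c {} = 0" using assms by (auto simp: star_def gcarrier_Koszul)
  moreover have "koszul_d (star c) = 0"
    using assms(1) by (simp add: koszul_d_star) (simp add: star_def fun_eq_iff)
  ultimately have cyc: "koszul_d (koszul_h (star c)) = star c"
    by (intro koszul_d_koszul_h) auto
  have "star b = koszul_h (star c)"
    by (simp add: b_def star_scale star_star) (simp add: fscale_def star_sign_square flip: mult.assoc)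
  then have "star (koszul_delta b) = star c" using cyc by (simp flip: koszul_d_star)
  then have "c = koszul_delta b" using star_inject by metis
  moreover have "b \<in> gcarrier (Koszul j)"
  proof -
    have "star c \<in> gcarrier (Koszul (CARD('n) - Suc j))"
    proof -
      have "card (- J) \<noteq> Suc j" if "card J \<noteq> CARD('n) - Suc j" for J :: "'n set"
        using that card_le[of J] by (simp add: card_Compl)
      then show ?thesis using assms(2) by (auto simp: gcarrier_Koszul star_def)
    qed
    then have h: "koszul_h (star c) \<in> gcarrier (Koszul (CARD('n) - j))"
      using koszul_h_Koszul assms(3) by (metis Suc_diff_Suc Suc_lessD)
    have "card (- J) \<noteq> CARD('n) - j" if "card J \<noteq> j" for J :: "'n set"
      using that card_le[of J] assms(3) by (simp add: card_Compl)
    then show ?thesis using h by (auto simp: gcarrier_Koszul b_def fscale_def star_def)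
  qed
  ultimately show ?thesis by blast
qed

lemma koszul_delta_adjoint:
  "(\<Sum>J\<in>UNIV. koszul_delta b J * u J) = (\<Sum>J\<in>UNIV. b J * koszul_d u J)"
proof -
  have "(\<Sum>J\<in>UNIV. koszul_delta b J * u J) =
      (\<Sum>(J, i)\<in>(SIGMA J:UNIV. J). ksign i (J - {i}) * Var i * b (J - {i}) * u J)"
    by (simp add: koszul_delta_def sum_distrib_right sum.Sigma)
  also have "\<dots> = (\<Sum>(J, i)\<in>(SIGMA J:UNIV. -J). ksign i J * Var i * b J * u (insert i J))"
    by (rule sum.reindex_bij_witness[where i = "\<lambda>(J, i). (insert i J, i)" and j = "\<lambda>(J, i). (J - {i}, i)"])
      (auto simp: insert_absorb)
  also have "\<dots> = (\<Sum>J\<in>UNIV. b J * koszul_d u J)"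
    by (simp add: koszul_d_apply sum_distrib_left sum.Sigma mult_ac)
  finally show ?thesis .
qed

lemma unit_vec_Koszul: "card J = j \<Longrightarrow> unit_vec J \<in> gcarrier (Koszul j)"
  by (auto simp: gcarrier_Koszul unit_vec_def)

lemma sum_mult_unit_vec: "(\<Sum>J\<in>UNIV. c J * unit_vec J' J) = c J'"
  for c :: "'i::finite \<Rightarrow> 's::comm_ring_1"
  by (simp add: unit_vec_def if_distrib[of "(*) _"] cong: if_cong)

text \<open>
  Evaluating the functional at the boundaries \<open>\<partial> e_J\<close> shows that its coefficients form a cocycle.
  By exactness they form a coboundary, and adjunction moves \<open>koszul_delta\<close> to the argument.
\<close>

lemma functional_vanishing_on_Syz:
  fixes c :: "'n set \<Rightarrow> ('n::{finite,linorder}, 'k::comm_ring_1) poly_ring"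
  assumes "c \<in> gcarrier (Koszul (Suc j))" and "Suc j < CARD('n)"
    and "\<And>u. u \<in> Syz (Suc (Suc j)) \<Longrightarrow> (\<Sum>J\<in>UNIV. c J * u J) = 0"
  shows "\<exists>b\<in>gcarrier (Koszul j). \<forall>u. (\<Sum>J\<in>UNIV. c J * u J) = (\<Sum>J\<in>UNIV. b J * koszul_d u J)"
proof -
  have "koszul_delta c J = 0" for J
  proof (cases "card J = Suc (Suc j)")
    case True
    then have "koszul_d (unit_vec J) \<in> (Syz (Suc (Suc j)) :: ('n set \<Rightarrow> ('n, 'k) poly_ring) set)"
      unfolding Syz_def by (intro imageI unit_vec_Koszul)
    then show ?thesis
      using assms(3) koszul_delta_adjoint[of c "unit_vec J"] by (simp add: sum_mult_unit_vec)
  next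
    case False
    then have "c (J - {i}) = 0" if "i \<in> J" for i
      using assms(1) that by (auto simp: gcarrier_Koszul card_Diff_singleton_if)
    then show ?thesis by (simp add: koszul_delta_def)
  qed
  then have "koszul_delta c = 0" by auto
  then obtain b where b: "b \<in> gcarrier (Koszul j)" "c = koszul_delta b"
    using koszul_delta_exact assms by blast
  then show ?thesis by (auto simp: koszul_delta_adjoint)
qed

text \<open>
  Shows that the complicated signs in the definition of \<open>\<A> t\<close> are those of the differential, up to a factor
  that is common to all terms of a generator: moving \<open>i\<close> from \<open>L\<close> to \<open>J\<close> removes from the inversions
  counted by \<open>sigma L J\<close> those between \<open>i\<close> and \<open>J\<close>, and adds those between \<open>i\<close> and the part of \<open>L\<close> above \<open>i\<close>.
\<close>

lemma sigma_conv_ksign: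
  fixes J L :: "'n::{finite,linorder} set"
  assumes "i \<in> L" "i \<notin> J"
  shows "(-1) ^ (rank L i + 1) * sigma (L - {i}) (insert i J) =
    (-1) ^ (card L + 1) * sigma L J * (ksign i J :: 'a::comm_ring_1)"
proof -
  define P where "P = {(j, k). j \<in> L - {i} \<and> k \<in> J \<and> j > k}"
  define A where "A = {k \<in> L. k \<le> i}"
  define B where "B = {j \<in> L - {i}. j > i}"
  define C where "C = {k \<in> J. k < i}"
  have 1: "{(j, k). j \<in> L - {i} \<and> k \<in> insert i J \<and> j > k} = P \<union> B \<times> {i}"
    by (auto simp: P_def B_def)
  have "card (P \<union> B \<times> {i}) = card P + card (B \<times> {i})"
    by (rule card_Un_disjoint) (use assms in \<open>auto simp: P_def\<close>)
  with 1 have s1: "sigma (L - {i}) (insert i J) = ((-1) ^ (card P + card B) :: 'a)"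
    unfolding sigma_def by (simp add: card_cartesian_product)
  have 2: "{(j, k). j \<in> L \<and> k \<in> J \<and> j > k} = P \<union> {i} \<times> C"
    using assms by (auto simp: P_def C_def)
  have "card (P \<union> {i} \<times> C) = card P + card ({i} \<times> C)"
    by (rule card_Un_disjoint) (auto simp: P_def)
  with 2 have s2: "sigma L J = ((-1) ^ (card P + card C) :: 'a)"
    unfolding sigma_def by (simp add: card_cartesian_product)
  have "L = A \<union> B" by (auto simp: A_def B_def)
  moreover have "card (A \<union> B) = card A + card B"
    by (rule card_Un_disjoint) (auto simp: A_def B_def)
  ultimately have s3: "card L = rank L i + card B" by (simp add: rank_def A_def)
  have "ksign i J * ksign i J = (1 :: 'a)" by simp
  then show ?thesis unfolding s1 s2 s3 by (simp add: ksign_def C_def power_add mult_ac)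
qed

text \<open>
  The functional \<open>e_J^* \<circ> \<partial>\<close> is the generator with \<open>L = - J\<close>, up to sign.
\<close>

lemma koszul_d_coord_in_\<A>:
  fixes J :: "'n::{finite,linorder} set"
  assumes "card J = t"
  shows "(\<lambda>u. koszul_d u J) \<in> (\<A> t :: (('n set \<Rightarrow> ('n, 'k::comm_ring_1) poly_ring) \<Rightarrow> _) set)"
proof -
  interpret F: module "fscale :: ('n, 'k) poly_ring \<Rightarrow> (('n set \<Rightarrow> ('n, 'k) poly_ring) \<Rightarrow> _) \<Rightarrow> _"
    by (rule module_fscale)
  define s :: "('n, 'k) poly_ring" where "s = (-1) ^ (card (- J) + 1) * sigma (- J) J"
  have ss: "s * s = 1"
    unfolding s_def sigma_def by (simp flip: power_add)
  define G where "G = (\<Sum>i\<in>-J. fscale ((-1) ^ (rank (- J) i + 1) * sigma (- J - {i}) ((UNIV - - J) \<union> {i}) * Var i)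
                (dual_vec ((UNIV - - J) \<union> {i}) :: ('n set \<Rightarrow> ('n, 'k) poly_ring) \<Rightarrow> _))"
  have "card (- J) = CARD('n) - t" using assms by (simp add: card_Compl)
  then have "G \<in> \<A> t" unfolding \<A>_def G_def by (intro F.span_base) blast
  then have "fscale s G \<in> \<A> t" unfolding \<A>_def by (rule F.span_scale)
  moreover have "fscale s G = (\<lambda>u. koszul_d u J)"
  proof
    fix u
    have "G u = (\<Sum>i\<in>-J. s * ksign i J * Var i * u (insert i J))"
      unfolding G_def sum_fun_apply fscale_def dual_vec_def
    proof (intro sum.cong refl)
      fix i assume "i \<in> - J"
      then show "(-1) ^ (rank (- J) i + 1) * sigma (- J - {i}) (UNIV - - J \<union> {i}) * Var i * u (UNIV - - J \<union> {i}) =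
            s * ksign i J * Var i * u (insert i J)"
        using sigma_conv_ksign[of i "- J" J, where 'a = "('n, 'k) poly_ring"]
        by (simp add: s_def double_complement flip: Compl_eq_Diff_UNIV)
    qed
    then show "fscale s G u = koszul_d u J"
      by (simp add: fscale_def koszul_d_apply sum_distrib_left ss flip: mult.assoc)
  qed
  ultimately show ?thesis by simp
qed

text \<open>
  The functional \<open>e_J^* \<circ> \<partial>\<close> is the generator for the two elements \<open>i < j\<close> outside \<open>J\<close>, up to sign.
\<close>

lemma koszul_d_coord_in_\<B>:
  fixes J :: "'n::{finite,linorder} set"
  assumes "card J + 2 = CARD('n)"
  shows "(\<lambda>u. koszul_d u J) \<in> (\<B> :: (('n set \<Rightarrow> ('n, 'k::comm_ring_1) poly_ring) \<Rightarrow> _) set)"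
proof -
  interpret F: module "fscale :: ('n, 'k) poly_ring \<Rightarrow> (('n set \<Rightarrow> ('n, 'k) poly_ring) \<Rightarrow> _) \<Rightarrow> _"
    by (rule module_fscale)
  have "card (- J) = 2" using assms by (simp add: card_Compl)
  then obtain i j where "- J = {i, j}" "i \<noteq> j" by (auto simp: card_2_iff)
  then obtain i j where CJ: "- J = {i, j}" and ij: "i < j" by (metis insert_commute neqE)
  then have J: "J = - {i, j}" by (metis double_complement)
  have ri: "(-1) ^ rank UNIV i = (- ksign i J :: ('n, 'k) poly_ring)"
  proof -
    have "{k \<in> UNIV. k \<le> i} = insert i {k \<in> J. k < i}" using ij by (auto simp: J)
    then show ?thesis by (simp add: rank_def ksign_def)
  qed
  have rj: "(-1) ^ rank UNIV j = (ksign j J :: ('n, 'k) poly_ring)"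
  proof -
    have "{k \<in> UNIV. k \<le> j} = insert i (insert j {k \<in> J. k < j})" using ij by (auto simp: J)
    then show ?thesis using ij by (simp add: rank_def ksign_def J)
  qed
  define s :: "('n, 'k) poly_ring" where "s = - (ksign i J * ksign j J)"
  define G where "G = fscale ((-1) ^ rank UNIV i * Var j) (dual_vec (UNIV - {i}))
      - fscale ((-1) ^ rank UNIV j * Var i) (dual_vec (UNIV - {j}) :: ('n set \<Rightarrow> ('n, 'k) poly_ring) \<Rightarrow> _)"
  have "G \<in> \<B>" unfolding \<B>_def G_def using ij by (intro F.span_base) blast
  then have "fscale s G \<in> \<B>" unfolding \<B>_def by (rule F.span_scale)
  moreover have "fscale s G = (\<lambda>u. koszul_d u J)"
  proof
    fix u
    have e: "UNIV - {i} = insert j J" "UNIV - {j} = insert i J" using ij by (auto simp: J)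
    have kk: "ksign l J * (ksign l J * x) = x" for x :: "('n, 'k) poly_ring" and l
      by (simp flip: mult.assoc)
    have "G u = - (ksign i J * Var j * u (insert j J)) - ksign j J * Var i * u (insert i J)"
      by (simp add: G_def fscale_def dual_vec_def ri rj e)
    then have "fscale s G u = s * (- (ksign i J * Var j * u (insert j J)) - ksign j J * Var i * u (insert i J))"
      by (simp add: fscale_def)
    also have "\<dots> = Var j * (ksign j J * u (insert j J)) + Var i * (ksign i J * u (insert i J))"
      by (simp add: s_def right_diff_distrib) (simp add: mult_ac kk)
    also have "\<dots> = koszul_d u J"
      using ij by (simp add: koszul_d_apply CJ mult_ac)
    finally show "fscale s G u = koszul_d u J" .
  qed
  ultimately show ?thesis by simp
qed

lemma sum_in_\<A>:
  fixes b :: "'n set \<Rightarrow> ('n::{finite,linorder}, 'k::comm_ring_1) poly_ring"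
  assumes "b \<in> gcarrier (Koszul t)"
  shows "(\<lambda>u. \<Sum>J\<in>UNIV. b J * koszul_d u J) \<in> \<A> t"
proof -
  interpret F: module "fscale :: ('n, 'k) poly_ring \<Rightarrow> (('n set \<Rightarrow> ('n, 'k) poly_ring) \<Rightarrow> _) \<Rightarrow> _"
    by (rule module_fscale)
  have "(\<Sum>J\<in>UNIV. fscale (b J) (\<lambda>u. koszul_d u J)) \<in> \<A> t"
    unfolding \<A>_def
  proof (rule F.span_sum)
    fix J
    show "fscale (b J) (\<lambda>u. koszul_d u J) \<in> F.span {\<Sum>i\<in>L. fscale ((-1) ^ (rank L i + 1) * sigma (L - {i}) ((UNIV - L) \<union> {i}) * Var i)
                (dual_vec ((UNIV - L) \<union> {i})) | L. card L = CARD('n) - t}"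
    proof (cases "card J = t")
      case True
      then show ?thesis using koszul_d_coord_in_\<A>[of J t] unfolding \<A>_def by (intro F.span_scale)
    next
      case False
      then have "fscale (b J) (\<lambda>u. koszul_d u J) = 0" using assms by (auto simp: gcarrier_Koszul fscale_def)
      then show ?thesis using F.span_zero by simp
    qed
  qed
  also have "(\<Sum>J\<in>UNIV. fscale (b J) (\<lambda>u. koszul_d u J)) = (\<lambda>u. \<Sum>J\<in>UNIV. b J * koszul_d u J)"
    by (rule ext) (simp add: sum_fun_apply fscale_def)
  finally show ?thesis .
qed

lemma sum_in_\<B>:
  fixes b :: "'n set \<Rightarrow> ('n::{finite,linorder}, 'k::comm_ring_1) poly_ring"
  assumes "b \<in> gcarrier (Koszul j)" and "j + 2 = CARD('n)"
  shows "(\<lambda>u. \<Sum>J\<in>UNIV. b J * koszul_d u J) \<in> \<B>"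
proof -
  interpret F: module "fscale :: ('n, 'k) poly_ring \<Rightarrow> (('n set \<Rightarrow> ('n, 'k) poly_ring) \<Rightarrow> _) \<Rightarrow> _"
    by (rule module_fscale)
  have "fscale (b J) (\<lambda>u. koszul_d u J) \<in> \<B>" for J
  proof (cases "card J = j")
    case True
    then show ?thesis using koszul_d_coord_in_\<B>[of J] assms unfolding \<B>_def by (intro F.span_scale) auto
  next
    case False
    then have "fscale (b J) (\<lambda>u. koszul_d u J) = 0" using assms by (auto simp: gcarrier_Koszul fscale_def)
    then show ?thesis unfolding \<B>_def using F.span_zero by simp
  qed
  then have "(\<Sum>J\<in>UNIV. fscale (b J) (\<lambda>u. koszul_d u J)) \<in> \<B>"
    unfolding \<B>_def by (intro F.span_sum) auto
  also have "(\<Sum>J\<in>UNIV. fscale (b J) (\<lambda>u. koszul_d u J)) = (\<lambda>u. \<Sum>J\<in>UNIV. b J * koszul_d u J)"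
    by (rule ext) (simp add: sum_fun_apply fscale_def)
  finally show ?thesis .
qed

section \<open>Rank of modules over a domain\<close>

lemma underdetermined_linear_system:
  fixes m :: "'b \<Rightarrow> 'a \<Rightarrow> 's::idom"
  assumes "finite B" and "finite A" and "card B < card A"
  shows "\<exists>x. (\<exists>a\<in>A. x a \<noteq> 0) \<and> (\<forall>b\<in>B. (\<Sum>a\<in>A. m b a * x a) = 0)"
  using assms
proof (induction B arbitrary: A m rule: finite_induct)
  case empty
  then have "A \<noteq> {}" by auto
  then show ?case by (intro exI[of _ "\<lambda>_. 1"]) auto
next
  case (insert b B)
  show ?case
  proof (cases "\<forall>a\<in>A. m b a = 0")
    case True
    then show ?thesis using insert.IH[of A m] insert.prems insert.hyps by auto
  next
    case False
    then obtain p where p: "p \<in> A" "m b p \<noteq> 0" by auto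
    \<comment> \<open>elimination of the unknown \<open>p\<close> without division\<close>
    define m' where "m' b' a = m b p * m b' a - m b' p * m b a" for b' a
    have "card B < card (A - {p})" using insert p by simp
    then obtain x where x: "\<exists>a\<in>A - {p}. x a \<noteq> 0" "\<And>b'. b' \<in> B \<Longrightarrow> (\<Sum>a\<in>A - {p}. m' b' a * x a) = 0"
      using insert.IH[of "A - {p}" m'] insert.prems by auto
    define y where "y a = (if a = p then - (\<Sum>a\<in>A - {p}. m b a * x a) else m b p * x a)" for a
    have split: "(\<Sum>a\<in>A. m b' a * y a) =
        (\<Sum>a\<in>A - {p}. m b' a * (m b p * x a)) - m b' p * (\<Sum>a\<in>A - {p}. m b a * x a)" for b'
    proof -
      have "(\<Sum>a\<in>A. m b' a * y a) = m b' p * y p + (\<Sum>a\<in>A - {p}. m b' a * y a)"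
        using p insert.prems by (intro sum.remove) auto
      also have "(\<Sum>a\<in>A - {p}. m b' a * y a) = (\<Sum>a\<in>A - {p}. m b' a * (m b p * x a))"
        by (intro sum.cong) (auto simp: y_def)
      finally show ?thesis by (simp add: y_def)
    qed
    have "(\<Sum>a\<in>A. m b' a * y a) = 0" if "b' \<in> insert b B" for b'
    proof (cases "b' = b")
      case True
      then show ?thesis unfolding split by (simp add: sum_distrib_left mult_ac)
    next
      case False
      then have "b' \<in> B" using that by simp
      then show ?thesis using x(2)[of b'] unfolding split m'_def
        by (simp add: algebra_simps sum_subtractf sum_distrib_left)
    qed
    moreover have "\<exists>a\<in>A. y a \<noteq> 0" using x(1) p by (auto simp: y_def)
    ultimately show ?thesis by blast
  qed
qed

text \<open>
  The rank is the size of an independent subset that spans up to torsion, that is, of a basis after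
  passage to the field of fractions. This form of the definition avoids the localisation.
\<close>

definition has_rank :: "('s::idom \<Rightarrow> 'm::ab_group_add \<Rightarrow> 'm) \<Rightarrow> 'm set \<Rightarrow> nat \<Rightarrow> bool" where
  "has_rank s M r \<longleftrightarrow> (\<exists>X\<subseteq>M. finite X \<and> \<not> module.dependent s X \<and> card X = r \<and>
      (\<forall>v\<in>M. \<exists>c. c \<noteq> 0 \<and> s c v \<in> module.span s X))"

lemma has_rankI:
  assumes "X \<subseteq> M" "finite X" "\<not> module.dependent s X" "card X = r"
    "\<And>v. v \<in> M \<Longrightarrow> \<exists>c. c \<noteq> 0 \<and> s c v \<in> module.span s X"
  shows "has_rank s M r"
  using assms unfolding has_rank_def by blast

text \<open>
  Multiples of the elements of \<open>X\<close> are combinations of \<open>Y\<close>. If \<open>X\<close> had more elements than \<open>Y\<close>, a nontrivial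
  solution of the homogeneous system given by the coefficients would be a relation on \<open>X\<close>.
\<close>

lemma independent_card_le_torsion_spanning:
  fixes s :: "'s::idom \<Rightarrow> 'm::ab_group_add \<Rightarrow> 'm"
  assumes "module s" and "finite X" and "\<not> module.dependent s X" and "finite Y"
    and "\<And>v. v \<in> X \<Longrightarrow> \<exists>c. c \<noteq> 0 \<and> s c v \<in> module.span s Y"
  shows "card X \<le> card Y"
proof (rule ccontr)
  interpret module s by fact
  assume "\<not> card X \<le> card Y"
  then have less: "card Y < card X" by simp
  have "\<exists>c w. c \<noteq> 0 \<and> s c v = (\<Sum>y\<in>Y. s (w y) y)" if "v \<in> X" for v
    using assms(5)[OF that] by (auto simp: span_finite[OF assms(4)])
  then obtain c w where c: "\<And>v. v \<in> X \<Longrightarrow> c v \<noteq> 0"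
    and w: "\<And>v. v \<in> X \<Longrightarrow> s (c v) v = (\<Sum>y\<in>Y. s (w v y) y)" by metis
  obtain z where z: "\<exists>v\<in>X. z v \<noteq> 0" and zero: "\<And>y. y \<in> Y \<Longrightarrow> (\<Sum>v\<in>X. w v y * z v) = 0"
    using underdetermined_linear_system[OF assms(4,2) less, of "\<lambda>y v. w v y"] by auto
  have "(\<Sum>v\<in>X. s (z v * c v) v) = (\<Sum>v\<in>X. s (z v) (\<Sum>y\<in>Y. s (w v y) y))"
    by (intro sum.cong) (simp_all add: w flip: scale_scale)
  also have "\<dots> = (\<Sum>y\<in>Y. s (\<Sum>v\<in>X. w v y * z v) y)"
    by (simp add: scale_sum_right scale_sum_left mult.commute sum.swap[of _ Y])
  also have "\<dots> = 0" by (simp add: zero)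
  finally have "(\<Sum>v\<in>X. s (z v * c v) v) = 0" .
  then have "z v * c v = 0" if "v \<in> X" for v
    using independentD[OF assms(3,2) subset_refl, of "\<lambda>v. z v * c v"] that by auto
  then show False using z c by auto
qed

lemma has_rank_unique:
  assumes "module s" "has_rank s M r" "has_rank s M r'"
  shows "r = r'"
proof -
  have le: "k \<le> l" if "has_rank s M k" "has_rank s M l" for k l
  proof -
    obtain X where X: "X \<subseteq> M" "finite X" "\<not> module.dependent s X" "card X = k"
      using \<open>has_rank s M k\<close> unfolding has_rank_def by blast
    obtain Y where Y: "finite Y" "card Y = l" "\<And>v. v \<in> M \<Longrightarrow> \<exists>c. c \<noteq> 0 \<and> s c v \<in> module.span s Y"
      using \<open>has_rank s M l\<close> unfolding has_rank_def by blast
    have "card X \<le> card Y"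
      by (rule independent_card_le_torsion_spanning[OF assms(1) X(2,3) Y(1)]) (use X(1) Y(3) in blast)
    then show ?thesis using X Y by simp
  qed
  show ?thesis using le[OF assms(2,3)] le[OF assms(3,2)] by simp
qed

text \<open>
  An independent subset of the largest possible size spans up to torsion; the rank of the larger
  module bounds the sizes.
\<close>

lemma has_rank_exists_subset:
  fixes s :: "'s::idom \<Rightarrow> 'm::ab_group_add \<Rightarrow> 'm"
  assumes "module s" "has_rank s N k" "M \<subseteq> N"
  shows "\<exists>r. has_rank s M r"
proof -
  interpret module s by fact
  obtain Y where Y: "finite Y" "card Y = k" "\<And>v. v \<in> N \<Longrightarrow> \<exists>c. c \<noteq> 0 \<and> s c v \<in> span Y"
    using \<open>has_rank s N k\<close> unfolding has_rank_def by blast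
  define P where "P X \<longleftrightarrow> X \<subseteq> M \<and> finite X \<and> independent X" for X
  have bound: "card X \<le> k" if "P X" for X
  proof -
    have "card X \<le> card Y"
      by (rule independent_card_le_torsion_spanning[OF assms(1) _ _ Y(1)])
        (use that assms(3) Y(3) in \<open>auto simp: P_def\<close>)
    then show ?thesis using Y(2) by simp
  qed
  have "P {}" by (simp add: P_def independent_empty)
  moreover have "\<forall>X. P X \<longrightarrow> card X < Suc k" using bound by (simp add: less_Suc_eq_le)
  ultimately obtain X where X: "P X" and max: "\<And>X'. P X' \<Longrightarrow> card X' \<le> card X"
    using ex_has_greatest_nat[of P "{}" card "Suc k"] by (auto simp: less_Suc_eq_le)
  have fin: "finite X" and ind: "independent X" and sub: "X \<subseteq> M" using X by (auto simp: P_def)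
  have "\<exists>c. c \<noteq> 0 \<and> s c v \<in> span X" if v: "v \<in> M" for v
  proof (cases "v \<in> X")
    case True
    then show ?thesis by (intro exI[of _ 1]) (auto intro: span_base)
  next
    case False
    have "\<not> P (insert v X)" using max[of "insert v X"] fin False by auto
    then have "dependent (insert v X)" using fin sub v by (auto simp: P_def)
    then obtain t u where t: "finite t" "t \<subseteq> insert v X" "(\<Sum>x\<in>t. s (u x) x) = 0" "\<exists>x\<in>t. u x \<noteq> 0"
      unfolding dependent_explicit by blast
    have vt: "v \<in> t"
    proof (rule ccontr)
      assume "v \<notin> t"
      then have "t \<subseteq> X" using t by auto
      then show False using t independentD[OF ind] by metis
    qed
    have "u v \<noteq> 0"
    proof
      assume "u v = 0"
      then have "(\<Sum>x\<in>t - {v}. s (u x) x) = 0" using t vt by (simp add: sum.remove[of t v])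
      moreover have "t - {v} \<subseteq> X" "finite (t - {v})" using t by auto
      ultimately have "\<forall>x\<in>t - {v}. u x = 0" using independentD[OF ind] by metis
      then show False using t(4) \<open>u v = 0\<close> by auto
    qed
    moreover have "s (u v) v \<in> span X"
    proof -
      have "s (u v) v + (\<Sum>x\<in>t - {v}. s (u x) x) = 0" using t vt by (simp add: sum.remove[of t v])
      then have "s (u v) v = - (\<Sum>x\<in>t - {v}. s (u x) x)" by (simp add: eq_neg_iff_add_eq_0)
      moreover have "(\<Sum>x\<in>t - {v}. s (u x) x) \<in> span X"
        using t by (intro span_sum span_scale span_base) auto
      ultimately show ?thesis by (simp add: span_neg)
    qed
    ultimately show ?thesis by blast
  qed
  then show ?thesis using fin ind sub by (intro exI[of _ "card X"] has_rankI[of X]) auto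
qed

text \<open>
  Linearity on a submodule only, because the homomorphisms between graded modules are constrained
  only on carriers.
\<close>

definition linear_on :: "('s \<Rightarrow> 'a \<Rightarrow> 'a) \<Rightarrow> ('s \<Rightarrow> 'b \<Rightarrow> 'b) \<Rightarrow> 'a::ab_group_add set \<Rightarrow> ('a \<Rightarrow> 'b::ab_group_add) \<Rightarrow> bool" where
  "linear_on s1 s2 M f \<longleftrightarrow> (\<forall>x\<in>M. \<forall>y\<in>M. f (x + y) = f x + f y) \<and> (\<forall>r. \<forall>x\<in>M. f (s1 r x) = s2 r (f x))"

lemma linear_on_zero:
  assumes "linear_on s1 s2 M f" "0 \<in> M" shows "f 0 = 0"
proof -
  have "f (0 + 0) = f 0 + f 0" using assms unfolding linear_on_def by blast
  then show ?thesis by simp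
qed

lemma linear_on_sum:
  fixes s1 :: "'s::comm_ring_1 \<Rightarrow> 'a::ab_group_add \<Rightarrow> 'a"
  assumes lin: "linear_on s1 s2 M f" and "module s1" and "module.subspace s1 M"
    and "\<And>x. x \<in> A \<Longrightarrow> v x \<in> M"
  shows "f (\<Sum>x\<in>A. s1 (c x) (v x)) = (\<Sum>x\<in>A. s2 (c x) (f (v x)))"
proof -
  interpret module s1 by fact
  have f0: "f 0 = 0" using linear_on_zero[OF lin] subspace_0 assms(3) by blast
  show ?thesis using assms(4)
  proof (induction A rule: infinite_finite_induct)
    case (insert a A)
    have 1: "s1 (c a) (v a) \<in> M" "(\<Sum>x\<in>A. s1 (c x) (v x)) \<in> M"
      using insert assms(3) by (auto intro!: subspace_scale subspace_sum)
    have "f (\<Sum>x\<in>insert a A. s1 (c x) (v x)) = f (s1 (c a) (v a) + (\<Sum>x\<in>A. s1 (c x) (v x)))"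
      using insert.hyps by simp
    also have "\<dots> = f (s1 (c a) (v a)) + f (\<Sum>x\<in>A. s1 (c x) (v x))"
      using lin 1 unfolding linear_on_def by blast
    also have "f (s1 (c a) (v a)) = s2 (c a) (f (v a))"
      using lin insert.prems unfolding linear_on_def by blast
    finally show ?case using insert by simp
  qed (simp_all add: f0)
qed

lemma linear_on_diff:
  assumes lin: "linear_on s1 s2 M f" and "module s1" and "module s2" and "module.subspace s1 M"
    and "x \<in> M" "y \<in> M"
  shows "f (x - y) = f x - f y"
proof -
  interpret M1: module s1 by fact
  interpret M2: module s2 by fact
  have "s1 (-1) y \<in> M" using assms M1.subspace_scale by blast
  then have "f (x + s1 (-1) y) = f x + s2 (-1) (f y)"
    using lin assms unfolding linear_on_def by metis
  then show ?thesis by simp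
qed

text \<open>
  As for dimensions of vector spaces: a basis of the kernel together with preimages of a basis of the
  image. The union spans up to torsion, with one denominator from the image and one from the kernel.
\<close>

lemma has_rank_additive:
  fixes s1 :: "'s::idom \<Rightarrow> 'a::ab_group_add \<Rightarrow> 'a" and s2 :: "'s \<Rightarrow> 'b::ab_group_add \<Rightarrow> 'b"
  assumes m1: "module s1" and m2: "module s2" and sub: "module.subspace s1 M" and lin: "linear_on s1 s2 M f"
    and ker: "has_rank s1 {x \<in> M. f x = 0} r1" and im: "has_rank s2 (f ` M) r2"
  shows "has_rank s1 M (r1 + r2)"
proof -
  interpret M1: module s1 by fact
  interpret M2: module s2 by fact
  have f0: "f 0 = 0" using linear_on_zero[OF lin] M1.subspace_0 sub by blast
  obtain X where X: "X \<subseteq> {x \<in> M. f x = 0}" "finite X" "M1.independent X" "card X = r1"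
    and Xs: "\<And>v. v \<in> M \<Longrightarrow> f v = 0 \<Longrightarrow> \<exists>c. c \<noteq> 0 \<and> s1 c v \<in> M1.span X"
    using ker unfolding has_rank_def by blast
  obtain Y where Y: "Y \<subseteq> f ` M" "finite Y" "M2.independent Y" "card Y = r2"
    and Ys: "\<And>v. v \<in> M \<Longrightarrow> \<exists>c. c \<noteq> 0 \<and> s2 c (f v) \<in> M2.span Y"
    using im unfolding has_rank_def by blast
  obtain Z where Z: "Z \<subseteq> M" "inj_on f Z" "Y = f ` Z"
    using Y(1) by (metis subset_image_inj)
  have finZ: "finite Z" using Z Y(2) finite_imageD by blast
  have disj: "X \<inter> Z = {}"
  proof -
    have "0 \<notin> Y" using Y(3) M2.dependent_zero by blast
    then show ?thesis using X(1) Z(3) by force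
  qed
  show ?thesis
  proof (rule has_rankI[of "X \<union> Z"])
    show "X \<union> Z \<subseteq> M" "finite (X \<union> Z)" using X Z finZ by auto
    show "card (X \<union> Z) = r1 + r2"
      using X Y Z finZ disj by (simp add: card_Un_disjoint card_image)
    show "M1.independent (X \<union> Z)"
      unfolding M1.independent_explicit_module
    proof (intro allI impI)
      fix t u v assume t: "finite t" "t \<subseteq> X \<union> Z" "(\<Sum>v\<in>t. s1 (u v) v) = 0" "v \<in> t"
      have tM: "\<And>x. x \<in> t \<Longrightarrow> x \<in> M" using t X(1) Z(1) by auto
      have tt: "t = (t \<inter> X) \<union> (t \<inter> Z)" using t by auto
      have "0 = f (\<Sum>v\<in>t. s1 (u v) v)" using t f0 by simp
      also have "\<dots> = (\<Sum>v\<in>t. s2 (u v) (f v))"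
        using tM by (intro linear_on_sum[OF lin m1 sub])
      also have "\<dots> = (\<Sum>v\<in>t \<inter> X. s2 (u v) (f v)) + (\<Sum>v\<in>t \<inter> Z. s2 (u v) (f v))"
        by (subst tt, rule sum.union_disjoint) (use t disj in auto)
      also have "(\<Sum>v\<in>t \<inter> X. s2 (u v) (f v)) = 0" using X(1) by (intro sum.neutral) auto
      also have "(\<Sum>v\<in>t \<inter> Z. s2 (u v) (f v)) = (\<Sum>y\<in>f ` (t \<inter> Z). s2 (u (the_inv_into Z f y)) y)"
        using Z(2) by (subst sum.reindex) (auto simp: inj_on_def the_inv_into_f_f[OF Z(2)] intro!: sum.cong)
      finally have "(\<Sum>y\<in>f ` (t \<inter> Z). s2 (u (the_inv_into Z f y)) y) = 0" by simp
      then have "u (the_inv_into Z f y) = 0" if "y \<in> f ` (t \<inter> Z)" for y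
        using M2.independentD[OF Y(3), of "f ` (t \<inter> Z)" "\<lambda>y. u (the_inv_into Z f y)"] t(1) Z(3) that by auto
      then have uZ: "u z = 0" if "z \<in> t \<inter> Z" for z
        using that the_inv_into_f_f[OF Z(2)] by force
      have "(\<Sum>v\<in>t. s1 (u v) v) = (\<Sum>v\<in>t \<inter> X. s1 (u v) v) + (\<Sum>v\<in>t \<inter> Z. s1 (u v) v)"
        by (subst tt, rule sum.union_disjoint) (use t disj in auto)
      also have "(\<Sum>v\<in>t \<inter> Z. s1 (u v) v) = 0" by (intro sum.neutral) (simp add: uZ)
      finally have "(\<Sum>v\<in>t \<inter> X. s1 (u v) v) = 0" using t by simp
      then have "u x = 0" if "x \<in> t \<inter> X" for x
        using M1.independentD[OF X(3), of "t \<inter> X" u] t(1) that by auto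
      then show "u v = 0" using uZ t by auto
    qed
    fix v assume v: "v \<in> M"
    obtain c where c: "c \<noteq> 0" "s2 c (f v) \<in> M2.span Y" using Ys v by blast
    then obtain w where w: "s2 c (f v) = (\<Sum>y\<in>Y. s2 (w y) y)" by (auto simp: M2.span_finite[OF Y(2)])
    define z where "z = (\<Sum>x\<in>Z. s1 (w (f x)) x)"
    have zM: "z \<in> M" unfolding z_def using Z(1) sub by (intro M1.subspace_sum M1.subspace_scale) auto
    have "f z = (\<Sum>x\<in>Z. s2 (w (f x)) (f x))"
      unfolding z_def using Z(1) by (intro linear_on_sum[OF lin m1 sub]) auto
    also have "\<dots> = (\<Sum>y\<in>Y. s2 (w y) y)" using Z by (simp add: sum.reindex)
    finally have fz: "f z = s2 c (f v)" using w by simp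
    have cM: "s1 c v \<in> M" using sub v M1.subspace_scale by blast
    have "f (s1 c v - z) = f (s1 c v) - f z"
      using linear_on_diff[OF lin m1 m2 sub cM zM] .
    also have "f (s1 c v) = s2 c (f v)" using lin v unfolding linear_on_def by blast
    finally have "f (s1 c v - z) = 0" using fz by simp
    moreover have "s1 c v - z \<in> M" using cM zM sub M1.subspace_diff by blast
    ultimately obtain c' where c': "c' \<noteq> 0" "s1 c' (s1 c v - z) \<in> M1.span X" using Xs by blast
    have "s1 c' (s1 c v - z) \<in> M1.span (X \<union> Z)" using c' M1.span_mono[of X "X \<union> Z"] by blast
    moreover have "s1 c' z \<in> M1.span (X \<union> Z)"
      unfolding z_def by (intro M1.span_scale M1.span_sum M1.span_base) auto
    ultimately have "s1 c' (s1 c v - z) + s1 c' z \<in> M1.span (X \<union> Z)" by (rule M1.span_add)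
    then have "s1 (c' * c) v \<in> M1.span (X \<union> Z)" by (simp add: M1.scale_right_diff_distrib)
    then show "\<exists>c. c \<noteq> 0 \<and> s1 c v \<in> M1.span (X \<union> Z)" using c c' by (intro exI[of _ "c' * c"]) auto
  qed
qed

lemma has_rank_zero: "module s \<Longrightarrow> has_rank s {0} 0"
proof -
  assume m: "module s"
  interpret module s by fact
  show ?thesis by (rule has_rankI[of "{}"]) (auto simp: independent_empty intro: exI[of _ 1])
qed

lemma has_rank_ideal:
  fixes I :: "'s::idom set"
  assumes "g \<in> I" "g \<noteq> 0"
  shows "has_rank (*) I 1"
proof -
  interpret module "(*) :: 's \<Rightarrow> 's \<Rightarrow> 's" by unfold_locales (simp_all add: algebra_simps)
  show ?thesis
  proof (rule has_rankI[of "{g}"])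
    have "u v = 0" if t: "finite t" "t \<subseteq> {g}" "(\<Sum>v\<in>t. u v * v) = 0" "v \<in> t" for t u v
    proof -
      have "t = {g}" "v = g" using t by auto
      then show ?thesis using t assms by simp
    qed
    then show "independent {g}" unfolding independent_explicit_module by blast
    fix v
    have "g * v \<in> span {g}" by (simp add: span_singleton mult.commute image_iff)
    then show "\<exists>c. c \<noteq> 0 \<and> c * v \<in> span {g}" using assms by blast
  qed (use assms in auto)
qed

section \<open>Ranks of the syzygy modules\<close>

lemma subspace_free_mod: "module.subspace fscale (gcarrier (free_mod B d))"
proof -
  interpret module "fscale :: ('a, 'b) poly_ring \<Rightarrow> ('c \<Rightarrow> _) \<Rightarrow> _" by (rule module_fscale)
  show ?thesis by (rule subspaceI) (auto simp: gcarrier_free_mod fscale_def)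
qed

lemma subspace_Koszul: "module.subspace fscale (gcarrier (Koszul j))"
  by (simp add: Koszul_def subspace_free_mod)

lemma subspace_Syz:
  "module.subspace fscale (Syz j :: ('n set \<Rightarrow> ('n::{finite,linorder}, 'k::comm_ring_1) poly_ring) set)"
proof -
  interpret module "fscale :: ('n, 'k) poly_ring \<Rightarrow> ('n set \<Rightarrow> _) \<Rightarrow> _" by (rule module_fscale)
  show ?thesis
  proof (rule subspaceI)
    show "0 \<in> Syz j" unfolding Syz_def by (rule image_eqI[of _ _ 0]) (simp_all add: gcarrier_Koszul)
    fix x y :: "'n set \<Rightarrow> ('n, 'k) poly_ring" assume "x \<in> Syz j" "y \<in> Syz j"
    then show "x + y \<in> Syz j" unfolding Syz_def
      by (auto simp flip: koszul_d_add intro!: imageI subspace_add[OF subspace_Koszul])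
  next
    fix c and x :: "'n set \<Rightarrow> ('n, 'k) poly_ring" assume "x \<in> Syz j"
    then show "fscale c x \<in> Syz j" unfolding Syz_def
      by (auto simp flip: koszul_d_scale intro!: imageI subspace_scale[OF subspace_Koszul])
  qed
qed

lemma unit_vec_free_mod: "i \<in> B \<Longrightarrow> unit_vec i \<in> gcarrier (free_mod B d)"
  by (auto simp: gcarrier_free_mod unit_vec_def)

lemma free_mod_expansion:
  assumes "finite B" "u \<in> gcarrier (free_mod B d)"
  shows "u = (\<Sum>i\<in>B. fscale (u i) (unit_vec i))"
proof
  fix j
  have "(\<Sum>i\<in>B. fscale (u i) (unit_vec i)) j = (\<Sum>i\<in>B. if j = i then u i else 0)"
    by (auto simp: sum_fun_apply fscale_def unit_vec_def intro!: sum.cong)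
  then show "u j = (\<Sum>i\<in>B. fscale (u i) (unit_vec i)) j"
    using assms by (simp add: gcarrier_free_mod)
qed

lemma has_rank_free_mod:
  fixes d :: "'i \<Rightarrow> int"
  assumes "finite B"
  shows "has_rank (fscale :: ('n::{finite,linorder}, 'k::field) poly_ring \<Rightarrow> _) (gcarrier (free_mod B d)) (card B)"
proof -
  interpret module "fscale :: ('n, 'k) poly_ring \<Rightarrow> ('i \<Rightarrow> _) \<Rightarrow> _" by (rule module_fscale)
  have inj: "inj (unit_vec :: 'i \<Rightarrow> 'i \<Rightarrow> ('n, 'k) poly_ring)"
  proof (rule injI)
    fix i j :: 'i assume "unit_vec i = (unit_vec j :: 'i \<Rightarrow> ('n, 'k) poly_ring)"
    then have "unit_vec i i = (unit_vec j i :: ('n, 'k) poly_ring)" by simp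
    then show "i = j" by (auto simp: unit_vec_def split: if_splits)
  qed
  show ?thesis
  proof (rule has_rankI[of "unit_vec ` B"])
    show "independent (unit_vec ` B :: ('i \<Rightarrow> ('n, 'k) poly_ring) set)"
      unfolding independent_explicit_module
    proof (intro allI impI)
      fix t u and v :: "'i \<Rightarrow> ('n, 'k) poly_ring"
      assume t: "finite t" "t \<subseteq> unit_vec ` B" "(\<Sum>v\<in>t. fscale (u v) v) = 0" "v \<in> t"
      obtain C where C: "C \<subseteq> B" "t = unit_vec ` C" using t by (meson subset_imageE)
      obtain i where i: "i \<in> C" "v = unit_vec i" using t C by auto
      have inj': "inj_on (unit_vec :: 'i \<Rightarrow> 'i \<Rightarrow> ('n, 'k) poly_ring) C" using inj inj_on_subset by blast
      have "0 = (\<Sum>v\<in>t. fscale (u v) v) i" using t by simp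
      also have "\<dots> = (\<Sum>j\<in>C. u (unit_vec j) * unit_vec j i)"
        by (simp add: sum_fun_apply fscale_def C sum.reindex[OF inj'])
      also have "\<dots> = (\<Sum>j\<in>C. if i = j then u (unit_vec j) else 0)"
        by (intro sum.cong) (auto simp: unit_vec_def)
      also have "\<dots> = u v" using i finite_subset[OF C(1) assms] by simp
      finally show "u v = 0" by simp
    qed
    show "card (unit_vec ` B :: ('i \<Rightarrow> ('n, 'k) poly_ring) set) = card B"
      using inj inj_on_subset by (intro card_image) blast
    fix v :: "'i \<Rightarrow> ('n, 'k) poly_ring" assume v: "v \<in> gcarrier (free_mod B d)"
    have "v \<in> span (unit_vec ` B)"
      by (subst free_mod_expansion[OF assms v]) (intro span_sum span_scale span_base imageI)
    then show "\<exists>c. c \<noteq> 0 \<and> fscale c v \<in> span (unit_vec ` B)"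
      by (intro exI[of _ 1]) auto
  qed (use assms unit_vec_free_mod in auto)
qed

lemma has_rank_inj_image:
  fixes s1 :: "'s::idom \<Rightarrow> 'a::ab_group_add \<Rightarrow> 'a" and s2 :: "'s \<Rightarrow> 'b::ab_group_add \<Rightarrow> 'b"
  assumes "module s1" "module s2" "module.subspace s1 M" and lin: "linear_on s1 s2 M f"
    and inj: "\<And>x. x \<in> M \<Longrightarrow> f x = 0 \<Longrightarrow> x = 0"
    and "has_rank s2 (f ` M) r"
  shows "has_rank s1 M r"
proof -
  have "0 \<in> M" by (rule module.subspace_0[OF assms(1,3)])
  then have "{x \<in> M. f x = 0} = {0}" using inj linear_on_zero[OF lin] by auto
  then show ?thesis
    using has_rank_additive[OF assms(1-4), of 0 r] has_rank_zero[OF assms(1)] assms(6) by simp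
qed

lemma linear_on_koszul_d: "linear_on fscale fscale M koszul_d"
  by (simp add: linear_on_def koszul_d_add koszul_d_scale)

text \<open>
  Descending induction along \<open>0 \<rightarrow> E_(i+1) \<rightarrow> K_i \<rightarrow> E_i \<rightarrow> 0\<close>, where the ranks are related by Pascal's rule. It
  starts at \<open>E_(n+1) = 0\<close>; therefore \<open>j\<close> counts from the top.
\<close>

lemma has_rank_Syz_aux:
  assumes "j \<le> CARD('n)"
  shows "has_rank fscale (Syz (CARD('n) + 1 - j) :: ('n set \<Rightarrow> ('n::{finite,linorder}, 'k::field) poly_ring) set)
     ((CARD('n) - 1) choose (CARD('n) - j))"
  using assms
proof (induction j)
  case 0
  have "card J \<noteq> Suc CARD('n)" for J :: "'n set"
    using card_mono[of UNIV J] by auto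
  then have "u = 0" if "u \<in> gcarrier (Koszul (Suc CARD('n)))" for u :: "'n set \<Rightarrow> ('n, 'k) poly_ring"
    using that by (auto simp: gcarrier_Koszul)
  moreover have "(0 :: 'n set \<Rightarrow> ('n, 'k) poly_ring) \<in> gcarrier (Koszul (Suc CARD('n)))"
    by (simp add: gcarrier_Koszul)
  ultimately have "gcarrier (Koszul (Suc CARD('n))) = {0 :: 'n set \<Rightarrow> ('n, 'k) poly_ring}" by blast
  then have "Syz (Suc CARD('n)) = {0 :: 'n set \<Rightarrow> ('n, 'k) poly_ring}" by (simp add: Syz_def)
  then show ?case using has_rank_zero[OF module_fscale] by (simp add: binomial_eq_0)
next
  case (Suc j)
  define i where "i = CARD('n) - j"
  have i: "0 < i" "CARD('n) + 1 - j = Suc i" "CARD('n) + 1 - Suc j = i" "CARD('n) - Suc j = i - 1"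
    using Suc.prems by (auto simp: i_def)
  let ?K = "\<lambda>l. gcarrier (Koszul l) :: ('n set \<Rightarrow> ('n, 'k) poly_ring) set"
  have rK: "has_rank fscale (?K l) (CARD('n) choose l)" for l
    using has_rank_free_mod[of "{J :: 'n set. card J = l}" "\<lambda>_. int l"]
    by (simp add: Koszul_def n_subsets[of "UNIV :: 'n set", simplified])
  have "Syz i \<subseteq> ?K (i - 1)"
    using i(1) koszul_d_Koszul[of _ "i - 1"] by (auto simp: Syz_def)
  then obtain r where r: "has_rank fscale (Syz i :: ('n set \<Rightarrow> ('n, 'k) poly_ring) set) r"
    using has_rank_exists_subset[OF module_fscale rK] by blast
  have "{u \<in> ?K i. koszul_d u = 0} = Syz (Suc i)"
    using i(1) mem_Syz_iff_cycle by blast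
  then have ker: "has_rank fscale {u \<in> ?K i. koszul_d u = 0} ((CARD('n) - 1) choose i)"
    using Suc i by (simp add: i_def)
  have "has_rank fscale (?K i) (((CARD('n) - 1) choose i) + r)"
    by (rule has_rank_additive[OF module_fscale module_fscale _ linear_on_koszul_d ker])
      (use r in \<open>auto simp: Koszul_def subspace_free_mod Syz_def\<close>)
  then have "((CARD('n) - 1) choose i) + r = CARD('n) choose i"
    using has_rank_unique[OF module_fscale] rK by blast
  moreover have "CARD('n) choose i = ((CARD('n) - 1) choose (i - 1)) + ((CARD('n) - 1) choose i)"
    using i(1) choose_reduce_nat[of "CARD('n)" i] by (simp add: zero_less_card_finite)
  ultimately have "r = (CARD('n) - 1) choose (i - 1)" by simp
  then show ?case using r i by simp
qed

lemma has_rank_Syz: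
  assumes "j < CARD('n)"
  shows "has_rank fscale (Syz (Suc j) :: ('n set \<Rightarrow> ('n::{finite,linorder}, 'k::field) poly_ring) set)
     ((CARD('n) - 1) choose j)"
  using has_rank_Syz_aux[of "CARD('n) - j", where 'n = 'n and 'k = 'k] assms by simp

section \<open>Linear maps out of free modules\<close>

definition pscale where "pscale r = map_prod (fscale r) (fscale r)"

lemma module_pscale: "module (pscale :: 's::comm_ring_1 \<Rightarrow> ('i \<Rightarrow> 's) \<times> ('j \<Rightarrow> 's) \<Rightarrow> _)"
  by unfold_locales (auto simp: pscale_def fscale_def fun_eq_iff algebra_simps)

lemma linear_on_free_mod:
  fixes g :: "('i \<Rightarrow> ('n::finite, 'k::comm_ring_1) poly_ring) \<Rightarrow> 'm::ab_group_add"
  assumes "linear_on fscale s (gcarrier (free_mod B d)) g" "finite B" "u \<in> gcarrier (free_mod B d)"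
  shows "g u = (\<Sum>i\<in>B. s (u i) (g (unit_vec i)))"
  using linear_on_sum[OF assms(1) module_fscale subspace_free_mod, of B unit_vec u]
    unit_vec_free_mod free_mod_expansion[OF assms(2,3)] by metis

lemma linear_on_lincomb:
  fixes s :: "'s::comm_ring_1 \<Rightarrow> 'm::ab_group_add \<Rightarrow> 'm"
  assumes "module s"
  shows "linear_on fscale s M (\<lambda>u. \<Sum>i\<in>B. s (u i) (b i))"
proof -
  interpret module s by fact
  show ?thesis
    by (simp add: linear_on_def scale_left_distrib sum.distrib scale_sum_right fscale_def)
qed

lemma sum_unit_vec:
  fixes s :: "'s::comm_ring_1 \<Rightarrow> 'm::ab_group_add \<Rightarrow> 'm"
  assumes "module s" "finite B" "i \<in> B"
  shows "(\<Sum>j\<in>B. s (unit_vec i j) (b j)) = b i"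
proof -
  interpret module s by fact
  have "(\<Sum>j\<in>B. s (unit_vec i j) (b j)) = (\<Sum>j\<in>B. if j = i then b j else 0)"
    by (intro sum.cong) (auto simp: unit_vec_def)
  then show ?thesis using assms by simp
qed

section \<open>Absence of linear sections of the Koszul differential\<close>

lemma lookup_mult_linear:
  fixes f g :: "('n, 'k::comm_ring_1) poly_ring"
  assumes "Poly_Mapping.lookup f 0 = 0" "Poly_Mapping.lookup g 0 = 0"
  shows "Poly_Mapping.lookup (f * g) (Poly_Mapping.single k 1) = 0"
proof (rule ccontr)
  assume "Poly_Mapping.lookup (f * g) (Poly_Mapping.single k 1) \<noteq> 0"
  then have "Poly_Mapping.single k 1 \<in> Poly_Mapping.keys (f * g)" by (simp add: in_keys_iff)
  then obtain a b where ab: "a \<in> Poly_Mapping.keys f" "b \<in> Poly_Mapping.keys g" "Poly_Mapping.single k 1 = a + b"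
    using Poly_Mapping.keys_mult[of f g] by blast
  have sum: "Poly_Mapping.lookup a l + Poly_Mapping.lookup b l = (if l = k then 1 else 0)" for l
    using arg_cong[OF ab(3), of "\<lambda>m. Poly_Mapping.lookup m l"] by (auto simp: lookup_add lookup_single)
  have "a = 0 \<or> b = 0"
  proof (cases "Poly_Mapping.lookup a k = 0")
    case True
    have "Poly_Mapping.lookup a l = 0" for l using sum[of l] True by (cases "l = k") auto
    then show ?thesis by (auto intro: poly_mapping_eqI)
  next
    case False
    have "Poly_Mapping.lookup b l = 0" for l using sum[of l] False by (cases "l = k") auto
    then show ?thesis by (auto intro: poly_mapping_eqI)
  qed
  then show False using ab(1,2) assms by (auto simp: in_keys_iff)
qed

lemma koszul_d_unit_vec:
  assumes "k \<in> J"
  shows "koszul_d (unit_vec J) (J - {k}) = ksign k (J - {k}) * Var k"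
proof -
  have "koszul_d (unit_vec J) (J - {k}) = (\<Sum>i\<in>- (J - {k}). if i = k then ksign k (J - {k}) * Var k else 0)"
    unfolding koszul_d_apply using assms by (intro sum.cong) (auto simp: unit_vec_def)
  then show ?thesis using assms by simp
qed

text \<open>
  A section would make every element of \<open>E_(j+1)\<close> a combination, with coefficients in the maximal
  ideal, of elements of \<open>E_(j+1) \<subseteq> \<mm> K_j\<close>. But the coordinates of \<open>\<partial> e_J\<close> are variables up to sign,
  and these do not lie in \<open>\<mm>\<^sup>2\<close>.
\<close>

lemma no_linear_section_of_koszul_d:
  fixes \<sigma> :: "('n set \<Rightarrow> ('n::{finite,linorder}, 'k::field) poly_ring) \<Rightarrow> 'n set \<Rightarrow> ('n, 'k) poly_ring"
  assumes j: "0 < j" "j < CARD('n)"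
    and lin: "linear_on fscale fscale (Syz j) \<sigma>"
    and sec: "\<And>x. x \<in> Syz j \<Longrightarrow> \<sigma> x \<in> gcarrier (Koszul j) \<and> koszul_d (\<sigma> x) = x"
  shows False
proof -
  interpret module "fscale :: ('n, 'k) poly_ring \<Rightarrow> ('n set \<Rightarrow> _) \<Rightarrow> _" by (rule module_fscale)
  obtain J :: "'n set" where J: "card J = Suc j"
    using obtain_subset_with_card_n[of "Suc j" "UNIV :: 'n set"] j by auto
  then obtain k where k: "k \<in> J" by fastforce
  define B where "B = {A :: 'n set. card A = j}"
  define w where "w = koszul_d (unit_vec J :: 'n set \<Rightarrow> ('n, 'k) poly_ring)"
  define e where "e = (unit_vec :: 'n set \<Rightarrow> 'n set \<Rightarrow> ('n, 'k) poly_ring)"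
  have wK: "w \<in> gcarrier (Koszul j)"
    unfolding w_def by (intro koszul_d_Koszul unit_vec_Koszul J)
  have w: "w = (\<Sum>A\<in>B. fscale (w A) (e A))"
    using wK unfolding e_def Koszul_def B_def by (intro free_mod_expansion) auto
  have eS: "koszul_d (e A) \<in> Syz j" if "A \<in> B" for A
    using that unfolding Syz_def e_def B_def by (intro imageI unit_vec_Koszul) simp
  have "(\<Sum>A\<in>B. fscale (w A) (koszul_d (e A))) = koszul_d (\<Sum>A\<in>B. fscale (w A) (e A))"
    by (simp only: koszul_d_sum koszul_d_scale)
  also have "\<dots> = 0" using w by (simp add: w_def koszul_d_koszul_d)
  finally have "\<sigma> (\<Sum>A\<in>B. fscale (w A) (koszul_d (e A))) = 0"
    using linear_on_zero[OF lin] subspace_0[OF subspace_Syz] by metis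
  moreover have "\<sigma> (\<Sum>A\<in>B. fscale (w A) (koszul_d (e A))) = (\<Sum>A\<in>B. fscale (w A) (\<sigma> (koszul_d (e A))))"
    by (rule linear_on_sum[OF lin module_fscale subspace_Syz]) (rule eS)
  ultimately have "(\<Sum>A\<in>B. fscale (w A) (\<sigma> (koszul_d (e A)))) = 0" by simp
  then have w': "w = (\<Sum>A\<in>B. fscale (w A) (e A - \<sigma> (koszul_d (e A))))"
    by (subst (1) w) (simp add: scale_right_diff_distrib sum_subtractf)
  \<comment> \<open>the corrected vectors \<open>e_A - \<sigma> (\<partial> e_A)\<close> are cycles, and cycles have coordinates in the maximal ideal\<close>
  have small: "Poly_Mapping.lookup ((e A - \<sigma> (koszul_d (e A))) C) 0 = 0" if "A \<in> B" for A C
  proof -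
    have "koszul_d (e A - \<sigma> (koszul_d (e A))) = 0"
      using sec[OF eS[OF that]] by (simp add: koszul_d_diff)
    moreover have "e A - \<sigma> (koszul_d (e A)) \<in> gcarrier (Koszul j)"
      using sec[OF eS[OF that]] that unit_vec_Koszul[of A j]
      by (intro subspace_diff[OF subspace_Koszul]) (auto simp: e_def B_def)
    ultimately have "e A - \<sigma> (koszul_d (e A)) \<in> Syz (Suc j)"
      using mem_Syz_iff_cycle j(1) by blast
    then obtain v where "e A - \<sigma> (koszul_d (e A)) = koszul_d v" unfolding Syz_def by blast
    then show ?thesis by (simp add: lookup_koszul_d_0)
  qed
  have "w (J - {k}) = (\<Sum>A\<in>B. w A * (e A - \<sigma> (koszul_d (e A))) (J - {k}))"
    by (subst w') (simp only: sum_fun_apply fscale_def)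
  then have "Poly_Mapping.lookup (w (J - {k})) (Poly_Mapping.single k 1)
    = (\<Sum>A\<in>B. Poly_Mapping.lookup (w A * (e A - \<sigma> (koszul_d (e A))) (J - {k})) (Poly_Mapping.single k 1))"
    by (simp only: lookup_sum)
  also have "\<dots> = 0"
    by (intro sum.neutral ballI lookup_mult_linear small) (simp_all add: w_def lookup_koszul_d_0)
  finally have "Poly_Mapping.lookup (w (J - {k})) (Poly_Mapping.single k 1) = 0" .
  moreover have "w (J - {k}) = ksign k (J - {k}) * Var k"
    unfolding w_def using k by (rule koszul_d_unit_vec)
  ultimately have "Poly_Mapping.lookup (ksign k (J - {k}) * Var k :: ('n, 'k) poly_ring) (Poly_Mapping.single k 1) = 0"
    by simp
  moreover have "Poly_Mapping.lookup (Var k :: ('n, 'k) poly_ring) (Poly_Mapping.single k 1) = 1"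
    by (simp add: Var_def)
  ultimately show False by (cases "even (card {l \<in> J - {k}. l < k})") (auto simp: ksign_def)
qed

text \<open>
  If \<open>E_j\<close> were a direct summand of a module with a free resolution of length one, then comparing
  this resolution with \<open>K_j \<rightarrow> E_j\<close> shows that the kernel \<open>E_(j+1)\<close> is projective: with lifts
  \<open>r\<close> and \<open>s\<close> of the identity of \<open>E_j\<close> in the two directions, each \<open>x \<in> E_(j+1)\<close> is
  \<open>(x - r (s x)) + r (s x)\<close>, where the first summand depends on \<open>x \<in> K_j\<close> and the second one
  on the preimage of \<open>s x\<close> in the free kernel of the resolution. Both maps from free
  modules to \<open>E_(j+1)\<close> lift to \<open>K_(j+1)\<close>, which would give a section.
\<close>

lemma no_short_resolution:
  fixes f :: "('a \<Rightarrow> ('n::{finite,linorder}, 'k::field) poly_ring) \<Rightarrow> 'b \<Rightarrow> ('n, 'k) poly_ring"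
    and g :: "('b \<Rightarrow> ('n, 'k) poly_ring) \<Rightarrow> ('n set \<Rightarrow> ('n, 'k) poly_ring) \<times> ('n set \<Rightarrow> ('n, 'k) poly_ring)"
  assumes j: "0 < j" "Suc j < CARD('n)"
    and fin: "finite A" "finite B"
    and f: "linear_on fscale fscale (gcarrier (free_mod A a)) f"
    and g: "linear_on fscale pscale (gcarrier (free_mod B b)) g"
    and inj: "inj_on f (gcarrier (free_mod A a))"
    and ex: "f ` gcarrier (free_mod A a) = gker (free_mod B b) g"
    and surj: "\<And>x. x \<in> Syz j \<Longrightarrow> (x, 0) \<in> g ` gcarrier (free_mod B b)"
    and fst: "\<And>y. y \<in> gcarrier (free_mod B b) \<Longrightarrow> fst (g y) \<in> Syz j"
  shows False
proof -
  let ?F = "gcarrier (free_mod A a) :: ('a \<Rightarrow> ('n, 'k) poly_ring) set"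
  let ?G = "gcarrier (free_mod B b) :: ('b \<Rightarrow> ('n, 'k) poly_ring) set"
  let ?K = "gcarrier (Koszul j) :: ('n set \<Rightarrow> ('n, 'k) poly_ring) set"
  interpret N: module "fscale :: ('n, 'k) poly_ring \<Rightarrow> ('n set \<Rightarrow> _) \<Rightarrow> _" by (rule module_fscale)
  interpret G: module "fscale :: ('n, 'k) poly_ring \<Rightarrow> ('b \<Rightarrow> _) \<Rightarrow> _" by (rule module_fscale)
  interpret F: module "fscale :: ('n, 'k) poly_ring \<Rightarrow> ('a \<Rightarrow> _) \<Rightarrow> _" by (rule module_fscale)
  define C where "C = {J :: 'n set. card J = j}"
  have K: "?K = gcarrier (free_mod C (\<lambda>_. int j))" by (simp add: Koszul_def C_def)
  have finC: "finite C" by simp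
  have eK: "unit_vec J \<in> ?K" if "J \<in> C" for J using that unit_vec_Koszul by (auto simp: C_def)
  have "\<forall>J\<in>C. \<exists>y\<in>?G. g y = (koszul_d (unit_vec J), 0)"
    using surj eK unfolding Syz_def by fastforce
  then obtain sv where sv: "\<And>J. J \<in> C \<Longrightarrow> sv J \<in> ?G" "\<And>J. J \<in> C \<Longrightarrow> g (sv J) = (koszul_d (unit_vec J), 0)"
    by metis
  have "\<forall>i\<in>B. \<exists>x\<in>?K. koszul_d x = fst (g (unit_vec i))"
    using fst unit_vec_free_mod unfolding Syz_def by (metis imageE)
  then obtain rv where rv: "\<And>i. i \<in> B \<Longrightarrow> rv i \<in> ?K" "\<And>i. i \<in> B \<Longrightarrow> koszul_d (rv i) = fst (g (unit_vec i))"
    by metis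
  \<comment> \<open>lifts of the two surjections onto \<open>E_j\<close> through each other\<close>
  define s where "s u = (\<Sum>J\<in>C. fscale (u J) (sv J))" for u
  define r where "r y = (\<Sum>i\<in>B. fscale (y i) (rv i))" for y
  have lin_s: "linear_on fscale fscale UNIV s" unfolding s_def by (rule linear_on_lincomb[OF module_fscale])
  have lin_r: "linear_on fscale fscale UNIV r" unfolding r_def by (rule linear_on_lincomb[OF module_fscale])
  have sG: "s u \<in> ?G" for u
    unfolding s_def using sv by (intro G.subspace_sum G.subspace_scale subspace_free_mod) auto
  have rK: "r y \<in> ?K" for y
    unfolding r_def using rv by (intro N.subspace_sum N.subspace_scale subspace_Koszul) auto
  have gs: "g (s u) = (koszul_d u, 0)" if "u \<in> ?K" for u
  proof -
    have "g (s u) = (\<Sum>J\<in>C. pscale (u J) (g (sv J)))"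
      unfolding s_def using sv by (intro linear_on_sum[OF g module_fscale subspace_free_mod])
    also have "\<dots> = (\<Sum>J\<in>C. (fscale (u J) (koszul_d (unit_vec J)), 0))"
      using sv by (intro sum.cong) (auto simp: pscale_def)
    also have "\<dots> = (koszul_d u, 0)"
      using linear_on_free_mod[OF linear_on_koszul_d finC that[unfolded K]] by (simp add: sum_prod)
    finally show ?thesis .
  qed
  have dr: "koszul_d (r y) = fst (g y)" if "y \<in> ?G" for y
  proof -
    have "koszul_d (r y) = (\<Sum>i\<in>B. fscale (y i) (fst (g (unit_vec i))))"
      using rv by (simp add: r_def koszul_d_sum koszul_d_scale)
    also have "\<dots> = fst (\<Sum>i\<in>B. pscale (y i) (g (unit_vec i)))"
      by (simp add: fst_sum pscale_def)
    finally show ?thesis using linear_on_free_mod[OF g fin(2) that] by simp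
  qed
  have rs: "r (s (x + y)) = r (s x) + r (s y)" "r (s (fscale c x)) = fscale c (r (s x))" for x y c
    using lin_r lin_s unfolding linear_on_def by simp_all
  have gf: "g (f z) = 0" "f z \<in> ?G" if "z \<in> ?F" for z
    using ex that by (auto simp: gker_def)
  \<comment> \<open>both maps take values in the kernel of \<open>K_j \<rightarrow> E_j\<close>; being defined on free modules,
    they lift to \<open>K_(j+1)\<close>\<close>
  have S1: "x - r (s x) \<in> Syz (Suc j)" if "x \<in> ?K" for x
    unfolding mem_Syz_iff_cycle[OF j(1)]
    using that rK[of "s x"] dr[OF sG[of x]] gs[OF that]
    by (auto simp: koszul_d_diff intro!: N.subspace_diff[OF subspace_Koszul])
  have S2: "r (f z) \<in> Syz (Suc j)" if "z \<in> ?F" for z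
    unfolding mem_Syz_iff_cycle[OF j(1)] using rK dr[OF gf(2)[OF that]] gf(1)[OF that] by simp
  define \<psi> where "\<psi> u = (\<Sum>J\<in>C. fscale (u J) (koszul_h (unit_vec J - r (s (unit_vec J)))))" for u
  define \<chi> where "\<chi> z = (\<Sum>i\<in>A. fscale (z i) (koszul_h (r (f (unit_vec i)))))" for z
  have lin_\<psi>: "linear_on fscale fscale UNIV \<psi>" unfolding \<psi>_def by (rule linear_on_lincomb[OF module_fscale])
  have lin_\<chi>: "linear_on fscale fscale UNIV \<chi>" unfolding \<chi>_def by (rule linear_on_lincomb[OF module_fscale])
  have hK: "koszul_h x \<in> gcarrier (Koszul (Suc j))" if "x \<in> Syz (Suc j)" for x :: "'n set \<Rightarrow> ('n, 'k) poly_ring"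
    using that koszul_h_Koszul mem_Syz_iff_cycle[OF j(1)] by blast
  have d\<psi>: "koszul_d (\<psi> u) = u - r (s u)" if "u \<in> ?K" for u
  proof -
    have "koszul_d (\<psi> u) = (\<Sum>J\<in>C. fscale (u J) (unit_vec J - r (s (unit_vec J))))"
      unfolding \<psi>_def koszul_d_sum koszul_d_scale
      by (intro sum.cong refl) (simp add: koszul_d_koszul_h_Syz[OF S1[OF eK]])
    also have "\<dots> = (\<Sum>J\<in>C. fscale (u J) (unit_vec J)) - (\<Sum>J\<in>C. fscale (u J) (r (s (unit_vec J))))"
      by (simp add: N.scale_right_diff_distrib sum_subtractf)
    also have "(\<Sum>J\<in>C. fscale (u J) (unit_vec J)) = u"
      using free_mod_expansion[OF finC that[unfolded K]] by simp
    also have "(\<Sum>J\<in>C. fscale (u J) (r (s (unit_vec J)))) = r (s u)"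
      using linear_on_free_mod[of fscale C "\<lambda>_. int j" "\<lambda>x. r (s x)", OF _ finC that[unfolded K]] rs
      by (simp add: linear_on_def)
    finally show ?thesis .
  qed
  have d\<chi>: "koszul_d (\<chi> z) = r (f z)" if "z \<in> ?F" for z
  proof -
    have "koszul_d (\<chi> z) = (\<Sum>i\<in>A. fscale (z i) (r (f (unit_vec i))))"
      unfolding \<chi>_def koszul_d_sum koszul_d_scale
      by (intro sum.cong refl) (simp add: koszul_d_koszul_h_Syz[OF S2[OF unit_vec_free_mod]])
    also have "\<dots> = r (f z)"
      using linear_on_free_mod[of fscale A a "\<lambda>x. r (f x)", OF _ fin(1) that] f lin_r
      by (simp add: linear_on_def)
    finally show ?thesis .
  qed
  define \<zeta> where "\<zeta> x = the_inv_into ?F f (s x)" for x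
  have \<zeta>: "\<zeta> x \<in> ?F" "f (\<zeta> x) = s x" if "x \<in> Syz (Suc j)" for x
  proof -
    have "x \<in> ?K" "koszul_d x = 0" using that mem_Syz_iff_cycle[OF j(1)] by auto
    then have "s x \<in> f ` ?F" unfolding ex gker_def using gs sG by (simp add: zero_prod_def)
    then show "\<zeta> x \<in> ?F" "f (\<zeta> x) = s x"
      unfolding \<zeta>_def using the_inv_into_into[OF inj _ subset_refl] f_the_inv_into_f[OF inj] by blast+
  qed
  have Scl: "x + y \<in> Syz (Suc j)" "fscale c x \<in> Syz (Suc j)" if "x \<in> Syz (Suc j)" "y \<in> Syz (Suc j)"
    for c and x y :: "'n set \<Rightarrow> ('n, 'k) poly_ring"
    using that unfolding mem_Syz_iff_cycle[OF j(1)]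
    by (auto simp: koszul_d_add koszul_d_scale intro: N.subspace_add[OF subspace_Koszul] N.subspace_scale[OF subspace_Koszul])
  have \<zeta>_add: "\<zeta> (x + y) = \<zeta> x + \<zeta> y" if "x \<in> Syz (Suc j)" "y \<in> Syz (Suc j)" for x y
  proof (rule inj_onD[OF inj])
    show "f (\<zeta> (x + y)) = f (\<zeta> x + \<zeta> y)"
      using f lin_s \<zeta> that Scl(1)[OF that] by (simp add: linear_on_def)
  qed (use \<zeta> that Scl in \<open>auto intro: F.subspace_add[OF subspace_free_mod]\<close>)
  have \<zeta>_scale: "\<zeta> (fscale c x) = fscale c (\<zeta> x)" if "x \<in> Syz (Suc j)" for c x
  proof (rule inj_onD[OF inj])
    show "f (\<zeta> (fscale c x)) = f (fscale c (\<zeta> x))"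
      using f lin_s \<zeta> that Scl(2)[OF that that] by (simp add: linear_on_def)
  qed (use \<zeta> that Scl in \<open>auto intro: F.subspace_scale[OF subspace_free_mod]\<close>)
  have "linear_on fscale fscale (Syz (Suc j)) (\<lambda>x. \<psi> x + \<chi> (\<zeta> x))"
    using lin_\<psi> lin_\<chi> by (auto simp: linear_on_def \<zeta>_add \<zeta>_scale N.scale_right_distrib)
  moreover have "\<psi> x + \<chi> (\<zeta> x) \<in> gcarrier (Koszul (Suc j))" for x
    unfolding \<psi>_def \<chi>_def using hK S1[OF eK] S2[OF unit_vec_free_mod]
    by (intro N.subspace_add N.subspace_sum N.subspace_scale subspace_Koszul) auto
  moreover have "koszul_d (\<psi> x + \<chi> (\<zeta> x)) = x" if "x \<in> Syz (Suc j)" for x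
  proof -
    have "x \<in> ?K" using that mem_Syz_iff_cycle[OF j(1)] by blast
    then show ?thesis using that by (simp add: koszul_d_add d\<psi> d\<chi> \<zeta>)
  qed
  ultimately show False
    using no_linear_section_of_koszul_d[of "Suc j" "\<lambda>x. \<psi> x + \<chi> (\<zeta> x)"] j(2) by blast
qed

section \<open>The direct sum of two Koszul differentials\<close>

type_synonym ('n, 'k) kpair = "('n set \<Rightarrow> ('n, 'k) poly_ring) \<times> ('n set \<Rightarrow> ('n, 'k) poly_ring)"

lemma gscale_simps [simp]:
  "gscale (KK t d) = pscale" "gscale (EE_mod t d) = pscale" "gscale (free_mod B b) = fscale"
  "gscale (shift M l) = gscale M" "gscale (sub_mod M W) = gscale M" "gscale ring_mod = (*)"
  by (auto simp: KK_def EE_mod_def dsum_def free_mod_def shift_def sub_mod_def ring_mod_def Koszul_def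
      pscale_def fun_eq_iff map_prod_def)

lemma gcarrier_simps [simp]:
  "gcarrier (shift M l) = gcarrier M" "gcarrier (sub_mod M W) = W" "gcarrier ring_mod = UNIV"
  by (simp_all add: shift_def sub_mod_def ring_mod_def)

lemma gpart_simps [simp]:
  "gpart (shift M l) m = gpart M (l + m)" "gpart (sub_mod M W) m = gpart M m \<inter> W"
  "gpart ring_mod m = {f. homogeneous m f}"
  by (simp_all add: shift_def sub_mod_def ring_mod_def)

lemma ghom_linear_on: "ghom k M N f \<Longrightarrow> linear_on (gscale M) (gscale N) (gcarrier M) f"
  by (auto simp: ghom_def linear_on_def)

lemma ghomI:
  assumes "\<And>x. x \<in> gcarrier M \<Longrightarrow> f x \<in> gcarrier N" "linear_on (gscale M) (gscale N) (gcarrier M) f"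
    and "\<And>m x. x \<in> gpart M m \<Longrightarrow> f x \<in> gpart N (m + k)"
  shows "ghom k M N f"
  using assms by (auto simp: ghom_def linear_on_def)

lemma module_ring: "module ((*) :: 's::comm_ring_1 \<Rightarrow> 's \<Rightarrow> 's)"
  by unfold_locales (simp_all add: algebra_simps)

lemma gcarrier_KK:
  "x \<in> gcarrier (KK t d :: (_, ('n::finite set \<Rightarrow> ('n, 'k::comm_ring_1) poly_ring) \<times> _) graded_module) \<longleftrightarrow>
     fst x \<in> gcarrier (Koszul (t + 1)) \<and> snd x \<in> gcarrier (Koszul (CARD('n) - 1))"
  by (auto simp: KK_def dsum_def mem_Times_iff)

lemma gpart_KK:
  "x \<in> gpart (KK t d :: (_, ('n::finite set \<Rightarrow> ('n, 'k::comm_ring_1) poly_ring) \<times> _) graded_module) m \<longleftrightarrow>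
     fst x \<in> gpart (Koszul (t + 1)) m \<and> snd x \<in> gpart (Koszul (CARD('n) - 1)) (d + m)"
  by (auto simp: KK_def dsum_def mem_Times_iff)

lemma gcarrier_EE_mod:
  "x \<in> gcarrier (EE_mod t d :: (_, ('n::{finite,linorder} set \<Rightarrow> ('n, 'k::comm_ring_1) poly_ring) \<times> _) graded_module) \<longleftrightarrow>
     fst x \<in> Syz (t + 1) \<and> snd x \<in> Syz (CARD('n) - 1)"
  by (auto simp: EE_mod_def dsum_def mem_Times_iff)

lemma gpart_EE_mod:
  "x \<in> gpart (EE_mod t d :: (_, ('n::{finite,linorder} set \<Rightarrow> ('n, 'k::comm_ring_1) poly_ring) \<times> _) graded_module) m \<longleftrightarrow>
     fst x \<in> gpart (Koszul t) m \<and> snd x \<in> gpart (Koszul (CARD('n) - 2)) (d + m) \<and>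
     fst x \<in> Syz (t + 1) \<and> snd x \<in> Syz (CARD('n) - 1)"
  by (auto simp: EE_mod_def dsum_def mem_Times_iff)

lemma subspace_KK:
  "module.subspace pscale (gcarrier (KK t d :: (_, ('n::finite set \<Rightarrow> ('n, 'k::comm_ring_1) poly_ring) \<times> _) graded_module))"
proof -
  interpret P: module "pscale :: ('n, 'k) poly_ring \<Rightarrow> ('n set \<Rightarrow> _) \<times> ('n set \<Rightarrow> _) \<Rightarrow> _" by (rule module_pscale)
  interpret N: module "fscale :: ('n, 'k) poly_ring \<Rightarrow> ('n set \<Rightarrow> _) \<Rightarrow> _" by (rule module_fscale)
  show ?thesis
    by (rule P.subspaceI)
      (auto simp: gcarrier_KK pscale_def intro: N.subspace_add[OF subspace_Koszul] N.subspace_scale[OF subspace_Koszul]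
        N.subspace_0[OF subspace_Koszul])
qed

lemma subspace_Syz_Times:
  "module.subspace pscale (Syz i \<times> Syz j ::
     (('n::{finite,linorder} set \<Rightarrow> ('n, 'k::comm_ring_1) poly_ring) \<times> ('n set \<Rightarrow> ('n, 'k) poly_ring)) set)"
proof -
  interpret P: module "pscale :: ('n, 'k) poly_ring \<Rightarrow> ('n set \<Rightarrow> _) \<times> ('n set \<Rightarrow> _) \<Rightarrow> _" by (rule module_pscale)
  interpret N: module "fscale :: ('n, 'k) poly_ring \<Rightarrow> ('n set \<Rightarrow> _) \<Rightarrow> _" by (rule module_fscale)
  show ?thesis
    by (rule P.subspaceI)
      (auto simp: pscale_def zero_prod_def intro: N.subspace_add[OF subspace_Syz] N.subspace_scale[OF subspace_Syz]
        N.subspace_0[OF subspace_Syz])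
qed

lemma gcarrier_EE_mod_Times:
  "gcarrier (EE_mod t d :: (_, ('n::{finite,linorder} set \<Rightarrow> ('n, 'k::comm_ring_1) poly_ring) \<times> _) graded_module)
     = Syz (t + 1) \<times> Syz (CARD('n) - 1)"
  by (auto simp: gcarrier_EE_mod)

text \<open>
  The differential \<open>K_(t+1) \<oplus> K_(n-1)(d) \<rightarrow> E_(t+1) \<oplus> E_(n-1)(d)\<close> and its degree-preserving set-theoretic section,
  which provides homogeneous preimages of homogeneous elements.
\<close>

definition koszul_d_pair where "koszul_d_pair = map_prod koszul_d koszul_d"
definition koszul_h_pair where "koszul_h_pair = map_prod koszul_h koszul_h"

lemma koszul_d_pair_add: "koszul_d_pair (x + y) = koszul_d_pair x + koszul_d_pair y"
  by (simp add: koszul_d_pair_def koszul_d_add map_prod_def case_prod_beta)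

lemma koszul_d_pair_diff: "koszul_d_pair (x - y) = koszul_d_pair x - koszul_d_pair y"
  by (simp add: koszul_d_pair_def koszul_d_diff map_prod_def case_prod_beta)

lemma koszul_d_pair_scale: "koszul_d_pair (pscale r x) = pscale r (koszul_d_pair x)"
  by (simp add: koszul_d_pair_def pscale_def koszul_d_scale map_prod_def case_prod_beta)

lemma koszul_d_pair_0 [simp]: "koszul_d_pair 0 = 0" by (simp add: koszul_d_pair_def zero_prod_def)

lemma koszul_d_pair_sum: "koszul_d_pair (sum f A) = (\<Sum>x\<in>A. koszul_d_pair (f x))"
  using sum_comp_morphism[where h = koszul_d_pair, OF koszul_d_pair_0 koszul_d_pair_add, of f A] by (simp only: comp_def)

lemma koszul_d_pair_gcarrier:
  fixes x :: "('n::{finite,linorder}, 'k::comm_ring_1) kpair"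
  shows "x \<in> gcarrier (KK t d) \<Longrightarrow> koszul_d_pair x \<in> gcarrier (EE_mod t d)"
  by (auto simp: gcarrier_KK gcarrier_EE_mod koszul_d_pair_def Syz_def)

lemma gpart_KK_subset:
  fixes x :: "('n::{finite,linorder}, 'k::comm_ring_1) kpair"
  shows "x \<in> gpart (KK t d) m \<Longrightarrow> x \<in> gcarrier (KK t d)"
  by (simp add: gpart_KK gcarrier_KK gpart_Koszul)

context
  fixes l :: nat
  assumes l: "CARD('n::{finite,linorder}) = Suc (Suc l)"
begin

lemma koszul_d_pair_gpart:
  fixes x :: "('n, 'k::field) kpair"
  assumes "x \<in> gpart (KK t d) m"
  shows "koszul_d_pair x \<in> gpart (EE_mod t d) m"
proof -
  have "fst x \<in> gpart (Koszul (Suc t)) m" "snd x \<in> gpart (Koszul (Suc l)) (d + m)"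
    using assms by (simp_all add: gpart_KK l)
  moreover from this have "fst x \<in> gcarrier (Koszul (Suc t))" "snd x \<in> gcarrier (Koszul (Suc l))"
    by (simp_all add: gpart_Koszul)
  ultimately show ?thesis
    by (auto simp: gpart_EE_mod koszul_d_pair_def Syz_def l koszul_d_gpart)
qed

lemma koszul_h_pair_gcarrier:
  fixes x :: "('n, 'k::field) kpair"
  shows "x \<in> gcarrier (EE_mod t d) \<Longrightarrow> koszul_h_pair x \<in> gcarrier (KK t d)"
  by (auto simp: gcarrier_KK gcarrier_EE_mod koszul_h_pair_def mem_Syz_Suc_iff l koszul_h_Koszul)

lemma koszul_h_pair_gpart:
  fixes x :: "('n, 'k::field) kpair"
  shows "x \<in> gpart (EE_mod t d) m \<Longrightarrow> koszul_h_pair x \<in> gpart (KK t d) m"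
  by (auto simp: gpart_KK gpart_EE_mod koszul_h_pair_def l koszul_h_gpart)

lemma koszul_d_pair_koszul_h_pair:
  fixes x :: "('n, 'k::field) kpair"
  shows "x \<in> gcarrier (EE_mod t d) \<Longrightarrow> koszul_d_pair (koszul_h_pair x) = x"
  by (cases x) (simp add: gcarrier_EE_mod koszul_h_pair_def koszul_d_pair_def l koszul_d_koszul_h_Syz[of _ t] koszul_d_koszul_h_Syz[of _ l])

lemma koszul_d_pair_kernel:
  fixes x :: "('n, 'k::field) kpair"
  shows "x \<in> EE_next t \<longleftrightarrow> x \<in> gcarrier (KK t d) \<and> koszul_d_pair x = 0"
proof -
  have 1: "u \<in> Syz (t + 2) \<longleftrightarrow> u \<in> gcarrier (Koszul (t + 1)) \<and> koszul_d u = 0" for u :: "'n set \<Rightarrow> ('n, 'k) poly_ring"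
    using mem_Syz_iff_cycle[of "Suc t" u] by simp
  have 2: "u \<in> Syz CARD('n) \<longleftrightarrow> u \<in> gcarrier (Koszul (CARD('n) - 1)) \<and> koszul_d u = 0" for u :: "'n set \<Rightarrow> ('n, 'k) poly_ring"
    using mem_Syz_iff_cycle[of "Suc l" u] by (simp add: l)
  show ?thesis
    unfolding EE_next_def mem_Times_iff gcarrier_KK koszul_d_pair_def 1 2 by (cases x) (auto simp: zero_prod_def)
qed

end

lemma has_rank_Times:
  fixes M M' :: "('i \<Rightarrow> 's::idom) set"
  assumes "module.subspace fscale M" "module.subspace fscale M'" "has_rank fscale M r" "has_rank fscale M' r'"
  shows "has_rank pscale (M \<times> M') (r' + r)"
proof -
  interpret P: module "pscale :: 's \<Rightarrow> ('i \<Rightarrow> 's) \<times> ('i \<Rightarrow> 's) \<Rightarrow> _" by (rule module_pscale)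
  interpret F: module "fscale :: 's \<Rightarrow> ('i \<Rightarrow> 's) \<Rightarrow> _" by (rule module_fscale)
  have sub: "P.subspace (A \<times> B)" if "F.subspace A" "F.subspace B" for A B
    using that unfolding P.subspace_def F.subspace_def by (auto simp: pscale_def zero_prod_def)
  have "0 \<in> M" using F.subspace_0 assms(1) by auto
  have "has_rank pscale ({0 :: 'i \<Rightarrow> 's} \<times> M') r'"
    by (rule has_rank_inj_image[OF module_pscale module_fscale, where f = snd])
      (use assms sub[of "{0}" M'] F.subspace_single_0 in \<open>auto simp: linear_on_def pscale_def zero_prod_def\<close>)
  moreover have "{x \<in> M \<times> M'. fst x = 0} = {0} \<times> M'" using \<open>0 \<in> M\<close> by auto
  moreover have "fst ` (M \<times> M') = M" using F.subspace_0[OF assms(2)] by auto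
  ultimately show ?thesis
    using assms by (intro has_rank_additive[OF module_pscale module_fscale, where f = fst])
      (auto simp: sub linear_on_def pscale_def)
qed

lemma lincomb_image:
  fixes s :: "('n::finite, 'k::comm_ring_1) poly_ring \<Rightarrow> 'm::ab_group_add \<Rightarrow> 'm"
  assumes "module s" "finite B"
  shows "(\<lambda>y. \<Sum>i\<in>B. s (y i) (\<beta> i)) ` gcarrier (free_mod B b) = module.span s (\<beta> ` B)"
proof -
  interpret module s by fact
  interpret F: module "fscale :: ('n, 'k) poly_ring \<Rightarrow> ('a \<Rightarrow> _) \<Rightarrow> _" by (rule module_fscale)
  let ?\<gamma> = "\<lambda>y. \<Sum>i\<in>B. s (y i) (\<beta> i)"
  interpret H: module_hom fscale s ?\<gamma>
    by unfold_locales (simp_all add: scale_left_distrib sum.distrib scale_sum_right fscale_def)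
  show ?thesis
  proof
    show "?\<gamma> ` gcarrier (free_mod B b) \<subseteq> span (\<beta> ` B)"
      by (intro image_subsetI span_sum span_scale span_base imageI)
    show "span (\<beta> ` B) \<subseteq> ?\<gamma> ` gcarrier (free_mod B b)"
    proof (rule span_minimal)
      show "\<beta> ` B \<subseteq> ?\<gamma> ` gcarrier (free_mod B b)"
      proof
        fix x assume "x \<in> \<beta> ` B"
        then obtain i where i: "i \<in> B" "x = \<beta> i" by auto
        have x: "x = ?\<gamma> (unit_vec i)" using sum_unit_vec[OF assms i(1), of \<beta>, symmetric] i(2) by (rule trans[rotated])
        show "x \<in> ?\<gamma> ` gcarrier (free_mod B b)"
          by (rule image_eqI[where x = "unit_vec i"]) (rule x, rule unit_vec_free_mod[OF i(1)])
      qed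
      show "subspace (?\<gamma> ` gcarrier (free_mod B b))"
        by (rule H.subspace_image[OF subspace_free_mod])
    qed
  qed
qed

lemma gpart_KK_lincomb:
  fixes \<beta> :: "'i \<Rightarrow> ('n::finite set \<Rightarrow> ('n, 'k::comm_ring_1) poly_ring) \<times> ('n set \<Rightarrow> ('n, 'k) poly_ring)"
  assumes y: "y \<in> gpart (free_mod B b) m" and \<beta>: "\<And>i. i \<in> B \<Longrightarrow> \<beta> i \<in> gpart (KK t d) (b i)"
  shows "(\<Sum>i\<in>B. pscale (y i) (\<beta> i)) \<in> gpart (KK t d) m"
proof -
  have hom: "homogeneous (m - b i) (y i)" if "i \<in> B" for i using y that by (simp add: gpart_free_mod)
  have 1: "(\<Sum>i\<in>B. fscale (y i) (v i)) \<in> gpart (Koszul j) (l + m)"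
    if v: "\<And>i. i \<in> B \<Longrightarrow> v i \<in> gpart (Koszul j) (l + b i)" for v :: "'i \<Rightarrow> 'n set \<Rightarrow> ('n, 'k) poly_ring" and j l
  proof -
    have "homogeneous (l + m - int j) (y i * v i J)" if "i \<in> B" for i J
      using homogeneous_mult[OF hom[OF that], of "l + b i - int j" "v i J"] v[OF that]
      by (simp add: gpart_Koszul algebra_simps)
    moreover have "y i * v i J = 0" if "i \<in> B" "card J \<noteq> j" for i J
      using v[OF that(1)] that by (simp add: gpart_Koszul gcarrier_Koszul)
    ultimately show ?thesis
      by (auto simp: gpart_Koszul gcarrier_Koszul sum_fun_apply fscale_def intro!: homogeneous_sum sum.neutral)
  qed
  show ?thesis
    using 1[of "\<lambda>i. fst (\<beta> i)" "t + 1" 0] 1[of "\<lambda>i. snd (\<beta> i)" "CARD('n) - 1" d] \<beta>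
    by (simp add: gpart_KK fst_sum snd_sum pscale_def)
qed

lemma unit_vec_gpart: "i \<in> B \<Longrightarrow> unit_vec i \<in> gpart (free_mod B b) (b i)"
  by (auto simp: gpart_free_mod unit_vec_def)

lemma gpart_free_mod_subset: "x \<in> gpart (free_mod B b) m \<Longrightarrow> x \<in> gcarrier (free_mod B b)"
  by (simp add: gpart_free_mod gcarrier_free_mod)

section \<open>Long Bourbaki sequences\<close>

lemma ghom_gcarrier: "ghom k M N f \<Longrightarrow> x \<in> gcarrier M \<Longrightarrow> f x \<in> gcarrier N"
  unfolding ghom_def by blast

lemma ghom_gpart: "ghom k M N f \<Longrightarrow> x \<in> gpart M m \<Longrightarrow> f x \<in> gpart N (m + k)"
  unfolding ghom_def by blast

text \<open>
  Applied to the two components of the last map \<open>h\<close> of a long Bourbaki sequence, this gives the functionals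
  \<open>a\<close> and \<open>b\<close>: as \<open>h \<circ> \<partial>\<close> vanishes on \<open>E_(j+2) = ker \<partial>\<close>, it is a combination of the functionals \<open>e_J^* \<circ> \<partial>\<close>.
\<close>

lemma functional_on_Koszul:
  fixes h :: "('n::{finite,linorder} set \<Rightarrow> ('n, 'k::field) poly_ring) \<Rightarrow> ('n, 'k) poly_ring"
  assumes j: "Suc j < CARD('n)"
    and lin: "linear_on fscale (*) (Syz (Suc j)) h"
  shows "\<exists>b\<in>gcarrier (Koszul j). \<forall>u\<in>gcarrier (Koszul (Suc j)). h (koszul_d u) = (\<Sum>J\<in>UNIV. b J * koszul_d u J)"
proof -
  define C where "C = {J :: 'n set. card J = Suc j}"
  define c where "c J = (if J \<in> C then h (koszul_d (unit_vec J)) else 0)" for J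
  have dS: "koszul_d u \<in> Syz (Suc j)" if "u \<in> gcarrier (Koszul (Suc j))" for u :: "'n set \<Rightarrow> ('n, 'k) poly_ring"
    using that unfolding Syz_def by blast
  have lin': "linear_on fscale (*) (gcarrier (free_mod C (\<lambda>_. int (Suc j)))) (\<lambda>u. h (koszul_d u))"
    using lin dS by (auto simp: linear_on_def C_def Koszul_def koszul_d_add koszul_d_scale)
  have h: "h (koszul_d u) = (\<Sum>J\<in>UNIV. c J * u J)" if "u \<in> gcarrier (Koszul (Suc j))" for u
  proof -
    have "h (koszul_d u) = (\<Sum>J\<in>C. u J * h (koszul_d (unit_vec J)))"
      using linear_on_free_mod[OF lin', of u] that by (simp add: C_def Koszul_def)
    also have "\<dots> = (\<Sum>J\<in>UNIV. c J * u J)"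
      by (intro sum.mono_neutral_cong_left) (auto simp: c_def)
    finally show ?thesis .
  qed
  have cK: "c \<in> gcarrier (Koszul (Suc j))" by (simp add: gcarrier_Koszul c_def C_def)
  have van: "(\<Sum>J\<in>UNIV. c J * u J) = 0" if "u \<in> Syz (Suc (Suc j))" for u
  proof -
    have u: "u \<in> gcarrier (Koszul (Suc j))" "koszul_d u = 0" using that by (simp_all add: mem_Syz_iff_cycle)
    have "h 0 = 0"
      using linear_on_zero[OF lin] module.subspace_0[OF module_fscale subspace_Syz] by blast
    then show ?thesis using h[OF u(1)] u(2) by simp
  qed
  obtain b where b: "b \<in> gcarrier (Koszul j)" "\<forall>u. (\<Sum>J\<in>UNIV. c J * u J) = (\<Sum>J\<in>UNIV. b J * koszul_d u J)"
    using functional_vanishing_on_Syz[OF cK j van] by blast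
  then have "\<forall>u\<in>gcarrier (Koszul (Suc j)). h (koszul_d u) = (\<Sum>J\<in>UNIV. b J * koszul_d u J)" by (simp add: h)
  then show ?thesis using b(1) by (rule bexI)
qed

lemma has_rank_EE_mod:
  assumes "CARD('n::{finite,linorder}) = Suc (Suc l)" "t < CARD('n)"
  shows "has_rank pscale (gcarrier (EE_mod t d :: (_, ('n, 'k::field) kpair) graded_module)) (Suc l + (Suc l choose t))"
proof -
  have "has_rank fscale (Syz (Suc t) :: ('n set \<Rightarrow> ('n, 'k) poly_ring) set) (Suc l choose t)"
    using has_rank_Syz[OF assms(2)] by (simp add: assms(1))
  moreover have "has_rank fscale (Syz (Suc l) :: ('n set \<Rightarrow> ('n, 'k) poly_ring) set) (Suc l)"
    using has_rank_Syz[of l, where 'n = 'n and 'k = 'k] binomial_symmetric[of l "Suc l"] by (simp add: assms(1))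
  ultimately have "has_rank pscale (Syz (Suc t) \<times> Syz (Suc l) :: ('n, 'k) kpair set) (Suc l + (Suc l choose t))"
    by (intro has_rank_Times subspace_Syz)
  then show ?thesis by (simp add: gcarrier_EE_mod_Times assms(1))
qed

text \<open>
  The ranks along the exact sequence add up, with \<open>rank I = 1\<close> because \<open>I \<noteq> 0\<close>. Indeed, for \<open>I = 0\<close> the sequence
  would be a free resolution of length one of a module with the summand \<open>E_(t+1)\<close>, whose projective
  dimension \<open>n - t - 1\<close> is at least \<open>2\<close>.
\<close>

lemma long_bourbaki_rank:
  fixes I :: "('n::{finite,linorder}, 'k::field) poly_ring set"
  assumes n: "CARD('n) = Suc (Suc l)" "t + 2 < CARD('n)"
    and f: "ghom 0 (free_mod {1..p} a) (free_mod {1..q} b) f" "inj_on f (gcarrier (free_mod {1..p} a))"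
    and g: "ghom 0 (free_mod {1..q} b) (EE_mod t d) g"
    and h: "ghom 0 (EE_mod t d) (shift (sub_mod ring_mod I) c) h"
    and fg: "f ` gcarrier (free_mod {1..p} a) = gker (free_mod {1..q} b) g"
    and gh: "g ` gcarrier (free_mod {1..q} b) = gker (EE_mod t d) h"
    and hI: "h ` gcarrier (EE_mod t d) = I"
  shows "q + 1 = p + Suc l + (Suc l choose t)"
proof -
  let ?F = "gcarrier (free_mod {1..p} a) :: (nat \<Rightarrow> ('n, 'k) poly_ring) set"
  let ?G = "gcarrier (free_mod {1..q} b) :: (nat \<Rightarrow> ('n, 'k) poly_ring) set"
  let ?E = "gcarrier (EE_mod t d) :: ('n, 'k) kpair set"
  have lf: "linear_on fscale fscale ?F f" using ghom_linear_on[OF f(1)] by simp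
  have lg: "linear_on fscale pscale ?G g" using ghom_linear_on[OF g] by simp
  have lh: "linear_on pscale (*) ?E h" using ghom_linear_on[OF h] by simp
  have gE: "g y \<in> ?E" if "y \<in> ?G" for y using ghom_gcarrier[OF g that] .
  have subE: "module.subspace pscale ?E" by (simp add: gcarrier_EE_mod_Times subspace_Syz_Times)
  have "\<exists>x\<in>I. x \<noteq> 0"
  proof (rule ccontr)
    assume "\<not> (\<exists>x\<in>I. x \<noteq> 0)"
    then have gG: "g ` ?G = ?E" using hI gh by (auto simp: gker_def)
    show False
    proof (rule no_short_resolution[of "Suc t" "{1..p}" "{1..q}" a f b g])
      fix x :: "'n set \<Rightarrow> ('n, 'k) poly_ring" assume "x \<in> Syz (Suc t)"
      then show "(x, 0) \<in> g ` ?G"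
        unfolding gG gcarrier_EE_mod using module.subspace_0[OF module_fscale subspace_Syz] by simp
    next
      fix y assume "y \<in> ?G"
      then show "fst (g y) \<in> Syz (Suc t)" using gE[of y] by (simp add: gcarrier_EE_mod)
    qed (use n lf lg f fg in auto)
  qed
  then obtain x where "x \<in> I" "x \<noteq> 0" by blast
  then have rI: "has_rank (*) (h ` ?E) 1" unfolding hI by (rule has_rank_ideal)
  have rE: "has_rank pscale ?E (Suc l + (Suc l choose t))"
    using n by (intro has_rank_EE_mod) auto
  obtain r where r: "has_rank pscale {x \<in> ?E. h x = 0} r"
    using has_rank_exists_subset[OF module_pscale rE, of "{x \<in> ?E. h x = 0}"] by auto
  have "has_rank pscale ?E (r + 1)"
    by (rule has_rank_additive[OF module_pscale module_ring subE lh r rI])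
  then have 1: "r + 1 = Suc l + (Suc l choose t)" using has_rank_unique[OF module_pscale] rE by blast
  have rG: "has_rank fscale ?G q" using has_rank_free_mod[of "{1..q}" b, where 'n = 'n and 'k = 'k] by simp
  have rF: "has_rank fscale ?F p" using has_rank_free_mod[of "{1..p}" a, where 'n = 'n and 'k = 'k] by simp
  have "f ` ?F \<subseteq> ?G" using fg by (auto simp: gker_def)
  then obtain r' where r': "has_rank fscale (f ` ?F) r'" using has_rank_exists_subset[OF module_fscale rG] by blast
  have "has_rank fscale ?F r'"
  proof (rule has_rank_inj_image[OF module_fscale module_fscale subspace_free_mod lf _ r'])
    have 0: "0 \<in> ?F" by (simp add: gcarrier_free_mod)
    fix x assume "x \<in> ?F" "f x = 0"
    then show "x = 0" using linear_on_zero[OF lf 0] inj_onD[OF f(2)] 0 by metis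
  qed
  then have "r' = p" using has_rank_unique[OF module_fscale] rF by blast
  then have ker: "has_rank fscale {y \<in> ?G. g y = 0} p" using r' fg by (simp add: gker_def)
  have im: "has_rank pscale (g ` ?G) r" using r gh by (simp add: gker_def)
  have "has_rank fscale ?G (p + r)"
    by (rule has_rank_additive[OF module_fscale module_pscale subspace_free_mod lg ker im])
  then have "q = p + r" using has_rank_unique[OF module_fscale] rG by blast
  then show ?thesis using 1 by simp
qed

text \<open>
  The \<open>\<beta>_i\<close> are homogeneous lifts of the images of the basis elements, \<open>\<phi>\<close> extends \<open>h \<circ> \<partial>\<close>, and in the
  diagram \<open>\<iota>\<close> and \<open>\<kappa>\<close> are the first map \<open>f\<close> of the sequence, \<open>\<gamma>\<close> is the linear extension of \<open>\<beta>\<close> and \<open>\<rho> = \<gamma> \<circ> f\<close>.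
\<close>

lemma bourbaki_data_if_long_bourbaki:
  fixes I :: "('n::{finite,linorder}, 'k::field) poly_ring set"
  assumes n: "CARD('n) \<ge> 4" "t \<le> CARD('n) - 4" and lb: "long_bourbaki t d c p a q b I"
  shows "\<exists>\<beta> \<phi>. bourbaki_data t d c p a q b \<beta> \<phi> \<and> I = \<phi> ` gcarrier (KK t d)"
proof -
  obtain l where l: "CARD('n) = Suc (Suc l)" using n(1) by (intro that[of "CARD('n) - 2"]) simp
  let ?F = "free_mod {1..p} a :: (('n, 'k) poly_ring, _) graded_module"
  let ?G = "free_mod {1..q} b :: (('n, 'k) poly_ring, _) graded_module"
  let ?E = "EE_mod t d :: (('n, 'k) poly_ring, ('n, 'k) kpair) graded_module"
  let ?K = "KK t d :: (('n, 'k) poly_ring, ('n, 'k) kpair) graded_module"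
  obtain f g h where f: "ghom 0 ?F ?G f" and g: "ghom 0 ?G ?E g" and h: "ghom 0 ?E (shift (sub_mod ring_mod I) c) h"
    and inj: "inj_on f (gcarrier ?F)" and fg: "f ` gcarrier ?F = gker ?G g" and gh: "g ` gcarrier ?G = gker ?E h"
    and hI: "h ` gcarrier ?E = I" and nz: "\<And>i. i \<in> {1..q} \<Longrightarrow> g (unit_vec i) \<noteq> 0"
    using lb unfolding long_bourbaki_def Let_def by auto
  interpret P: module "pscale :: ('n, 'k) poly_ring \<Rightarrow> ('n, 'k) kpair \<Rightarrow> _" by (rule module_pscale)
  have lf: "linear_on fscale fscale (gcarrier ?F) f" using ghom_linear_on[OF f] by simp
  have lg: "linear_on fscale pscale (gcarrier ?G) g" using ghom_linear_on[OF g] by simp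
  have lh: "linear_on pscale (*) (gcarrier ?E) h" using ghom_linear_on[OF h] by simp
  have S0: "0 \<in> (Syz j :: ('n set \<Rightarrow> ('n, 'k) poly_ring) set)" for j
    by (rule module.subspace_0[OF module_fscale subspace_Syz])
  have gpE: "g y \<in> gpart ?E m" if "y \<in> gpart ?G m" for y m using ghom_gpart[OF g that] by simp
  note gE = ghom_gcarrier[OF g] and fG = ghom_gcarrier[OF f]

  define \<beta> where "\<beta> i = koszul_h_pair (g (unit_vec i))" for i
  have \<beta>_part: "\<beta> i \<in> gpart ?K (b i)" if "i \<in> {1..q}" for i
    unfolding \<beta>_def using that by (intro koszul_h_pair_gpart[OF l] gpE unit_vec_gpart)
  have d\<beta>: "koszul_d_pair (\<beta> i) = g (unit_vec i)" if "i \<in> {1..q}" for i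
    unfolding \<beta>_def by (rule koszul_d_pair_koszul_h_pair[OF l gE[OF unit_vec_free_mod[OF that]]])
  have \<beta>K: "\<beta> i \<in> gcarrier ?K" if "i \<in> {1..q}" for i
    using \<beta>_part[OF that] gpart_KK_subset by blast

  have h_add: "h (x + y) = h x + h y" if "x \<in> gcarrier ?E" "y \<in> gcarrier ?E" for x y
    using lh that unfolding linear_on_def by blast
  have h_scale: "h (pscale r x) = r * h x" if "x \<in> gcarrier ?E" for r x
    using lh that unfolding linear_on_def by blast
  have E1: "(u, 0) \<in> gcarrier ?E" if "u \<in> Syz (Suc t)" for u
    using that S0 by (simp add: gcarrier_EE_mod)
  have E2: "(0, u) \<in> gcarrier ?E" if "u \<in> Syz (Suc l)" for u
    using that S0 by (simp add: gcarrier_EE_mod l)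
  have scale0: "fscale r 0 = (0 :: 'n set \<Rightarrow> ('n, 'k) poly_ring)" for r by (simp add: fscale_def zero_fun_def)
  have lin1: "linear_on fscale (*) (Syz (Suc t)) (\<lambda>u. h (u, 0))"
    unfolding linear_on_def
  proof (intro conjI ballI allI)
    fix u v :: "'n set \<Rightarrow> ('n, 'k) poly_ring" assume "u \<in> Syz (Suc t)" "v \<in> Syz (Suc t)"
    then show "h (u + v, 0) = h (u, 0) + h (v, 0)" using h_add[OF E1 E1, of u v] by simp
  next
    fix r and u :: "'n set \<Rightarrow> ('n, 'k) poly_ring" assume "u \<in> Syz (Suc t)"
    then show "h (fscale r u, 0) = r * h (u, 0)" using h_scale[OF E1, of u r] by (simp add: pscale_def scale0)
  qed
  have lin2: "linear_on fscale (*) (Syz (Suc l)) (\<lambda>u. h (0, u))"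
    unfolding linear_on_def
  proof (intro conjI ballI allI)
    fix u v :: "'n set \<Rightarrow> ('n, 'k) poly_ring" assume "u \<in> Syz (Suc l)" "v \<in> Syz (Suc l)"
    then show "h (0, u + v) = h (0, u) + h (0, v)" using h_add[OF E2 E2, of u v] by simp
  next
    fix r and u :: "'n set \<Rightarrow> ('n, 'k) poly_ring" assume "u \<in> Syz (Suc l)"
    then show "h (0, fscale r u) = r * h (0, u)" using h_scale[OF E2, of u r] by (simp add: pscale_def scale0)
  qed
  have "\<exists>b\<in>gcarrier (Koszul t). \<forall>u\<in>gcarrier (Koszul (Suc t)). h (koszul_d u, 0) = (\<Sum>J\<in>UNIV. b J * koszul_d u J)"
    by (rule functional_on_Koszul[OF _ lin1]) (use n in simp)
  then obtain b1 where b1: "b1 \<in> gcarrier (Koszul t)"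
    "\<And>u. u \<in> gcarrier (Koszul (Suc t)) \<Longrightarrow> h (koszul_d u, 0) = (\<Sum>J\<in>UNIV. b1 J * koszul_d u J)"
    by blast
  have "\<exists>b\<in>gcarrier (Koszul l). \<forall>u\<in>gcarrier (Koszul (Suc l)). h (0, koszul_d u) = (\<Sum>J\<in>UNIV. b J * koszul_d u J)"
    by (rule functional_on_Koszul[OF _ lin2]) (use l in simp)
  then obtain b2 where b2: "b2 \<in> gcarrier (Koszul l)"
    "\<And>u. u \<in> gcarrier (Koszul (Suc l)) \<Longrightarrow> h (0, koszul_d u) = (\<Sum>J\<in>UNIV. b2 J * koszul_d u J)"
    by blast
  define \<alpha>1 where "\<alpha>1 u = (\<Sum>J\<in>UNIV. b1 J * koszul_d u J)" for u
  define \<alpha>2 where "\<alpha>2 u = (\<Sum>J\<in>UNIV. b2 J * koszul_d u J)" for u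
  define \<phi> where "\<phi> = pair_hom \<alpha>1 \<alpha>2"
  have \<alpha>1: "\<alpha>1 \<in> \<A> t" using sum_in_\<A>[OF b1(1)] by (simp add: \<alpha>1_def[abs_def])
  have \<alpha>2: "\<alpha>2 \<in> \<B>" using sum_in_\<B>[OF b2(1)] l by (simp add: \<alpha>2_def[abs_def])
  have \<phi>: "\<phi> x = h (koszul_d_pair x)" if x: "x \<in> gcarrier ?K" for x
  proof -
    obtain u v where uv: "x = (u, v)" by (cases x)
    have K: "u \<in> gcarrier (Koszul (Suc t))" "v \<in> gcarrier (Koszul (Suc l))"
      using x by (simp_all add: uv gcarrier_KK l)
    have "(koszul_d u, 0) \<in> gcarrier ?E" "(0, koszul_d v) \<in> gcarrier ?E"
      using K S0 by (auto simp: gcarrier_EE_mod l Syz_def)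
    then have "h ((koszul_d u, 0) + (0, koszul_d v)) = h (koszul_d u, 0) + h (0, koszul_d v)"
      using lh unfolding linear_on_def by blast
    then show ?thesis using b1(2)[OF K(1)] b2(2)[OF K(2)]
      by (simp add: uv \<phi>_def pair_hom_def \<alpha>1_def \<alpha>2_def koszul_d_pair_def)
  qed

  define \<gamma> where "\<gamma> y = (\<Sum>i\<in>{1..q}. pscale (y i) (\<beta> i))" for y
  define W where "W = P.span (\<beta> ` {1..q})"
  have \<gamma>W: "\<gamma> ` gcarrier ?G = W"
    using lincomb_image[OF module_pscale, of "{1..q}" \<beta> b] by (simp add: \<gamma>_def[abs_def] W_def)
  have \<gamma>lin: "linear_on fscale pscale M \<gamma>" for M
    using linear_on_lincomb[OF module_pscale] unfolding \<gamma>_def[abs_def] .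
  have \<gamma>part: "\<gamma> y \<in> gpart ?K m" if "y \<in> gpart ?G m" for y m
    unfolding \<gamma>_def by (rule gpart_KK_lincomb[OF that \<beta>_part])
  have WK: "W \<subseteq> gcarrier ?K"
    unfolding W_def using \<beta>K by (intro P.span_minimal subspace_KK) auto
  have \<gamma>K: "\<gamma> y \<in> gcarrier ?K" if "y \<in> gcarrier ?G" for y using that \<gamma>W WK by blast
  have d\<gamma>: "koszul_d_pair (\<gamma> y) = g y" if "y \<in> gcarrier ?G" for y
  proof -
    have "koszul_d_pair (\<gamma> y) = (\<Sum>i\<in>{1..q}. pscale (y i) (g (unit_vec i)))"
      unfolding \<gamma>_def koszul_d_pair_sum by (intro sum.cong refl) (simp add: koszul_d_pair_scale d\<beta>)
    then show ?thesis using linear_on_free_mod[OF lg _ that] by simp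
  qed
  have \<gamma>U: "\<gamma> y \<in> EE_next t \<longleftrightarrow> y \<in> f ` gcarrier ?F" if "y \<in> gcarrier ?G" for y
    unfolding koszul_d_pair_kernel[OF l, where d = d] fg gker_def using \<gamma>K[OF that] d\<gamma>[OF that] that by simp

  have ker: "gker ?K \<phi> = {x + y |x y. x \<in> W \<and> y \<in> EE_next t}"
  proof (intro equalityI subsetI)
    fix x assume "x \<in> gker ?K \<phi>"
    then have x: "x \<in> gcarrier ?K" "h (koszul_d_pair x) = 0" by (auto simp: gker_def \<phi>)
    then have "koszul_d_pair x \<in> g ` gcarrier ?G" using koszul_d_pair_gcarrier[OF x(1)] x(2) unfolding gh gker_def by blast
    then obtain y where y: "y \<in> gcarrier ?G" "koszul_d_pair x = g y" by blast
    have "x - \<gamma> y \<in> gcarrier ?K" using x(1) \<gamma>K[OF y(1)] P.subspace_diff[OF subspace_KK] by blast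
    then have "x - \<gamma> y \<in> EE_next t"
      unfolding koszul_d_pair_kernel[OF l, where d = d] using y d\<gamma>[OF y(1)] by (simp add: koszul_d_pair_diff)
    moreover have "\<gamma> y \<in> W" using \<gamma>W y by blast
    moreover have "x = \<gamma> y + (x - \<gamma> y)" by simp
    ultimately show "x \<in> {x + y |x y. x \<in> W \<and> y \<in> EE_next t}" by blast
  next
    fix x assume "x \<in> {x + y |x y. x \<in> W \<and> y \<in> EE_next t}"
    then obtain y u where y: "y \<in> gcarrier ?G" and u: "u \<in> EE_next t" and x: "x = \<gamma> y + u"
      using \<gamma>W by blast
    have uK: "u \<in> gcarrier ?K" "koszul_d_pair u = 0" using u koszul_d_pair_kernel[OF l, where d = d] by blast+
    have xK: "x \<in> gcarrier ?K" unfolding x by (rule P.subspace_add[OF subspace_KK \<gamma>K[OF y] uK(1)])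
    have "h (g y) = 0" using gh y by (auto simp: gker_def)
    then show "x \<in> gker ?K \<phi>" using xK \<phi>[OF xK] uK by (simp add: gker_def x koszul_d_pair_add d\<gamma>[OF y])
  qed

  have dK: "koszul_d_pair ` gcarrier ?K = gcarrier ?E"
  proof
    show "koszul_d_pair ` gcarrier ?K \<subseteq> gcarrier ?E" using koszul_d_pair_gcarrier by blast
    show "gcarrier ?E \<subseteq> koszul_d_pair ` gcarrier ?K"
      using koszul_d_pair_koszul_h_pair[OF l] koszul_h_pair_gcarrier[OF l] by (metis imageI subsetI)
  qed
  have I: "I = \<phi> ` gcarrier ?K"
    unfolding hI[symmetric] dK[symmetric] image_image by (intro image_cong refl) (simp add: \<phi>)

  have \<phi>hom: "ghom (int CARD('n) + c) ?K (shift ring_mod (- int CARD('n))) \<phi>"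
  proof (rule ghomI)
    show "linear_on (gscale ?K) (gscale (shift ring_mod (- int CARD('n)))) (gcarrier ?K) \<phi>"
      using lh koszul_d_pair_gcarrier[where t = t and d = d and 'n = 'n and 'k = 'k]
        P.subspace_add[OF subspace_KK[of t d]] P.subspace_scale[OF subspace_KK[of t d]]
      by (simp add: linear_on_def \<phi> koszul_d_pair_add koszul_d_pair_scale)
    fix m x assume x: "x \<in> gpart ?K m"
    have "h (koszul_d_pair x) \<in> gpart (shift (sub_mod ring_mod I) c) (m + 0)"
      using h koszul_d_pair_gpart[OF l x] unfolding ghom_def by blast
    then show "\<phi> x \<in> gpart (shift ring_mod (- int CARD('n))) (m + (int CARD('n) + c))"
      using \<phi>[OF gpart_KK_subset[OF x]] by (simp add: add.commute)
  qed simp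

  have W': "module.span (gscale ?K) (\<beta> ` {1..q}) = W" by (simp add: W_def)
  have diagram: "res_diagram ?K (EE_next t) p a q b \<beta>"
    unfolding res_diagram_def Let_def W'
  proof (intro exI conjI)
    show "ghom 0 ?G (sub_mod ?K W) \<gamma>"
    proof (rule ghomI)
      fix y assume "y \<in> gcarrier ?G"
      then show "\<gamma> y \<in> gcarrier (sub_mod ?K W)" using \<gamma>W by auto
    next
      fix m y assume y: "y \<in> gpart ?G m"
      then have "\<gamma> y \<in> W" using \<gamma>W gpart_free_mod_subset by blast
      then show "\<gamma> y \<in> gpart (sub_mod ?K W) (m + 0)" using \<gamma>part[OF y] by simp
    qed (simp add: \<gamma>lin)
    show "\<forall>i\<in>{1..q}. \<gamma> (unit_vec i) = \<beta> i"
      unfolding \<gamma>_def by (auto intro!: sum_unit_vec[OF module_pscale])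
    show "\<gamma> ` gcarrier ?G = gcarrier (sub_mod ?K W)" using \<gamma>W by simp
    have fpart: "f x \<in> gpart ?G m" if "x \<in> gpart ?F m" for x m using ghom_gpart[OF f that] by simp
    have \<rho>U: "\<gamma> (f x) \<in> W \<inter> EE_next t" if "x \<in> gcarrier ?F" for x
      using that fG[OF that] \<gamma>W \<gamma>U by blast
    show "ghom 0 ?F (sub_mod ?K (W \<inter> EE_next t)) (\<lambda>x. \<gamma> (f x))"
    proof (rule ghomI)
      show "linear_on (gscale ?F) (gscale (sub_mod ?K (W \<inter> EE_next t))) (gcarrier ?F) (\<lambda>x. \<gamma> (f x))"
        using lf \<gamma>lin[of UNIV] by (simp add: linear_on_def)
    next
      fix m x assume x: "x \<in> gpart ?F m"
      then show "\<gamma> (f x) \<in> gpart (sub_mod ?K (W \<inter> EE_next t)) (m + 0)"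
        using \<rho>U[OF gpart_free_mod_subset[OF x]] \<gamma>part[OF fpart[OF x]] by simp
    qed (use \<rho>U in simp)
    show "(\<lambda>x. \<gamma> (f x)) ` gcarrier ?F = gcarrier (sub_mod ?K (W \<inter> EE_next t))"
    proof (intro equalityI subsetI)
      fix w assume "w \<in> gcarrier (sub_mod ?K (W \<inter> EE_next t))"
      then have w: "w \<in> W" "w \<in> EE_next t" by auto
      then obtain y where y: "y \<in> gcarrier ?G" "w = \<gamma> y" using \<gamma>W by blast
      then have "y \<in> f ` gcarrier ?F" using \<gamma>U w by blast
      then show "w \<in> (\<lambda>x. \<gamma> (f x)) ` gcarrier ?F" using y by blast
    qed (use \<rho>U in auto)
    show "ghom 0 ?F ?G f" by (rule f)
    show "inj_on f (gcarrier ?F)" by (rule inj)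
    have kf: "f ` gker ?F (\<lambda>x. \<gamma> (f x)) = gker ?G \<gamma>"
    proof (intro equalityI subsetI)
      fix y assume y: "y \<in> gker ?G \<gamma>"
      then have "y \<in> gcarrier ?G" "g y = 0" using d\<gamma>[of y] by (auto simp: gker_def)
      then have "y \<in> f ` gcarrier ?F" unfolding fg gker_def by blast
      then show "y \<in> f ` gker ?F (\<lambda>x. \<gamma> (f x))" using y by (auto simp: gker_def)
    qed (use fG in \<open>auto simp: gker_def\<close>)
    have sub: "gker ?F (\<lambda>x. \<gamma> (f x)) \<subseteq> gcarrier ?F" by (auto simp: gker_def)
    show "ghom 0 (sub_mod ?F (gker ?F (\<lambda>x. \<gamma> (f x)))) (sub_mod ?G (gker ?G \<gamma>)) f"
    proof (rule ghomI)
      show "linear_on (gscale (sub_mod ?F (gker ?F (\<lambda>x. \<gamma> (f x))))) (gscale (sub_mod ?G (gker ?G \<gamma>)))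
         (gcarrier (sub_mod ?F (gker ?F (\<lambda>x. \<gamma> (f x))))) f"
        using lf sub unfolding linear_on_def gscale_simps gcarrier_simps by blast
    qed (use kf fpart in auto)
    show "bij_betw f (gker ?F (\<lambda>x. \<gamma> (f x))) (gker ?G \<gamma>)"
      unfolding bij_betw_def using kf inj_on_subset[OF inj sub] by blast
  qed auto

  have "\<beta> i \<in> gcarrier ?K - EE_next t" if "i \<in> {1..q}" for i
    using \<beta>K[OF that] d\<beta>[OF that] nz[OF that] koszul_d_pair_kernel[OF l, of "\<beta> i" t d] by simp
  moreover have "int p = int q - int CARD('n) + 2 - int ((CARD('n) - 1) choose t)"
    using long_bourbaki_rank[OF l _ f inj g h fg gh hI] n l by simp
  ultimately have "bourbaki_data t d c p a q b \<beta> \<phi>"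
    unfolding bourbaki_data_def W' using \<alpha>1 \<alpha>2 \<phi>_def \<phi>hom ker diagram by blast
  then show ?thesis using I by blast
qed

text \<open>
  As \<open>\<phi>\<close> vanishes on \<open>ker \<partial>\<close>, it induces the map \<open>h\<close> onto its image; the first two maps are \<open>\<iota>\<close> and
  \<open>\<partial> \<circ> \<gamma>\<close>. The kernel of \<open>\<partial> \<circ> \<gamma>\<close> is \<open>\<gamma>\<^sup>-\<^sup>1(W \<inter> ker \<partial>)\<close> with \<open>W = \<langle>\<beta>_1,...,\<beta>_q\<rangle>\<close>: modulo \<open>ker \<gamma>\<close> it is covered by \<open>\<iota>\<close> because \<open>\<rho>\<close> is onto, and
  \<open>ker \<gamma>\<close> itself is covered because \<open>\<kappa>\<close> is onto.
\<close>

lemma long_bourbaki_if_bourbaki_data: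
  fixes \<phi> :: "('n::{finite,linorder}, 'k::field) kpair \<Rightarrow> ('n, 'k) poly_ring"
  assumes n: "CARD('n) \<ge> 4" and data: "bourbaki_data t d c p a q b \<beta> \<phi>"
  shows "graded_ideal (\<phi> ` gcarrier (KK t d)) \<and> long_bourbaki t d c p a q b (\<phi> ` gcarrier (KK t d))"
proof -
  obtain l where l: "CARD('n) = Suc (Suc l)" using n(1) by (intro that[of "CARD('n) - 2"]) simp
  let ?F = "free_mod {1..p} a :: (('n, 'k) poly_ring, _) graded_module"
  let ?G = "free_mod {1..q} b :: (('n, 'k) poly_ring, _) graded_module"
  let ?E = "EE_mod t d :: (('n, 'k) poly_ring, ('n, 'k) kpair) graded_module"
  let ?K = "KK t d :: (('n, 'k) poly_ring, ('n, 'k) kpair) graded_module"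
  interpret P: module "pscale :: ('n, 'k) poly_ring \<Rightarrow> ('n, 'k) kpair \<Rightarrow> _" by (rule module_pscale)
  interpret R: module "(*) :: ('n, 'k) poly_ring \<Rightarrow> ('n, 'k) poly_ring \<Rightarrow> _" by (rule module_ring)
  interpret N: module "fscale :: ('n, 'k) poly_ring \<Rightarrow> ('n set \<Rightarrow> _) \<Rightarrow> _" by (rule module_fscale)
  define W where "W = P.span (\<beta> ` {1..q})"
  define I where "I = \<phi> ` gcarrier ?K"
  have W': "module.span (gscale ?K) (\<beta> ` {1..q}) = W" by (simp add: W_def)
  have \<beta>: "\<And>i. i \<in> {1..q} \<Longrightarrow> \<beta> i \<in> gcarrier ?K - EE_next t"
    and \<phi>: "ghom (int CARD('n) + c) ?K (shift ring_mod (- int CARD('n))) \<phi>"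
    and ker: "gker ?K \<phi> = {x + y |x y. x \<in> W \<and> y \<in> EE_next t}"
    and diagram: "res_diagram ?K (EE_next t) p a q b \<beta>"
    using data unfolding bourbaki_data_def W' by blast+
  obtain \<iota> \<kappa> \<gamma> \<rho> where \<gamma>: "ghom 0 ?G (sub_mod ?K W) \<gamma>" "\<And>i. i \<in> {1..q} \<Longrightarrow> \<gamma> (unit_vec i) = \<beta> i"
      "\<gamma> ` gcarrier ?G = W"
    and \<rho>: "ghom 0 ?F (sub_mod ?K (W \<inter> EE_next t)) \<rho>" "\<rho> ` gcarrier ?F = W \<inter> EE_next t"
    and \<iota>: "ghom 0 ?F ?G \<iota>" "inj_on \<iota> (gcarrier ?F)"
    and \<kappa>: "bij_betw \<kappa> (gker ?F \<rho>) (gker ?G \<gamma>)" "\<And>x. x \<in> gker ?F \<rho> \<Longrightarrow> \<kappa> x = \<iota> x"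
    and comm: "\<And>x. x \<in> gcarrier ?F \<Longrightarrow> \<rho> x = \<gamma> (\<iota> x)"
    using diagram unfolding res_diagram_def Let_def W' gcarrier_simps by auto
  have l\<phi>: "linear_on pscale (*) (gcarrier ?K) \<phi>" using ghom_linear_on[OF \<phi>] by simp
  have l\<gamma>: "linear_on fscale pscale (gcarrier ?G) \<gamma>" using ghom_linear_on[OF \<gamma>(1)] by simp
  have l\<iota>: "linear_on fscale fscale (gcarrier ?F) \<iota>" using ghom_linear_on[OF \<iota>(1)] by simp
  have \<phi>part: "homogeneous (m + c) (\<phi> x)" if "x \<in> gpart ?K m" for x m
  proof -
    have "\<phi> x \<in> gpart (shift ring_mod (- int CARD('n))) (m + (int CARD('n) + c))"
      using \<phi> that unfolding ghom_def by blast
    then show ?thesis by (simp add: add.commute)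
  qed
  have U: "x \<in> EE_next t \<longleftrightarrow> x \<in> gcarrier ?K \<and> koszul_d_pair x = 0" for x by (rule koszul_d_pair_kernel[OF l])
  have WK: "W \<subseteq> gcarrier ?K"
    unfolding W_def using \<beta> by (intro P.span_minimal subspace_KK) auto
  have Uker: "\<phi> x = 0" if "x \<in> EE_next t" for x
  proof -
    have "0 \<in> W" unfolding W_def by (rule P.span_zero)
    then have "0 + x \<in> gker ?K \<phi>" unfolding ker using that by blast
    then show ?thesis by (simp add: gker_def)
  qed
  have \<phi>eq: "\<phi> x = \<phi> y" if "x \<in> gcarrier ?K" "y \<in> gcarrier ?K" "koszul_d_pair x = koszul_d_pair y" for x y
  proof -
    have "x - y \<in> EE_next t" unfolding U using that P.subspace_diff[OF subspace_KK] by (simp add: koszul_d_pair_diff)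
    then have "\<phi> x - \<phi> y = 0"
      using Uker linear_on_diff[OF l\<phi> module_pscale module_ring subspace_KK that(1,2)] by simp
    then show ?thesis by simp
  qed
  \<comment> \<open>the section is not linear, but its failure to be so lies in \<open>ker \<partial>\<close>, where \<open>\<phi>\<close> vanishes\<close>
  define h where "h y = \<phi> (koszul_h_pair y)" for y
  have hd: "h (koszul_d_pair x) = \<phi> x" if "x \<in> gcarrier ?K" for x
    unfolding h_def using that koszul_d_pair_gcarrier[OF that]
    by (intro \<phi>eq) (auto simp: koszul_h_pair_gcarrier[OF l] koszul_d_pair_koszul_h_pair[OF l, where t = t and d = d])
  have Edd: "\<exists>x\<in>gcarrier ?K. y = koszul_d_pair x" if "y \<in> gcarrier ?E" for y
    using that koszul_d_pair_koszul_h_pair[OF l] koszul_h_pair_gcarrier[OF l] by metis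
  have hE: "h ` gcarrier ?E = I"
  proof
    show "h ` gcarrier ?E \<subseteq> I" unfolding h_def I_def using koszul_h_pair_gcarrier[OF l] by blast
    show "I \<subseteq> h ` gcarrier ?E"
    proof
      fix x assume "x \<in> I"
      then obtain z where "z \<in> gcarrier ?K" "x = \<phi> z" by (auto simp: I_def)
      then show "x \<in> h ` gcarrier ?E" using hd koszul_d_pair_gcarrier by (metis imageI)
    qed
  qed
  have lh: "linear_on pscale (*) (gcarrier ?E) h"
    unfolding linear_on_def
  proof (intro conjI ballI allI)
    fix x y assume "x \<in> gcarrier ?E" "y \<in> gcarrier ?E"
    then obtain x' y' where xy: "x' \<in> gcarrier ?K" "x = koszul_d_pair x'" "y' \<in> gcarrier ?K" "y = koszul_d_pair y'" using Edd by metis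
    then have "x' + y' \<in> gcarrier ?K" using P.subspace_add[OF subspace_KK] by blast
    then have "h (x + y) = \<phi> (x' + y')" using hd by (simp add: xy flip: koszul_d_pair_add)
    then show "h (x + y) = h x + h y" using l\<phi> xy hd by (simp add: linear_on_def)
  next
    fix r x assume "x \<in> gcarrier ?E"
    then obtain x' where x: "x' \<in> gcarrier ?K" "x = koszul_d_pair x'" using Edd by metis
    then have "pscale r x' \<in> gcarrier ?K" using P.subspace_scale[OF subspace_KK] by blast
    then have "h (pscale r x) = \<phi> (pscale r x')" using hd by (simp add: x flip: koszul_d_pair_scale)
    then show "h (pscale r x) = r * h x" using l\<phi> x hd by (simp add: linear_on_def)
  qed
  have hhom: "ghom 0 ?E (shift (sub_mod ring_mod I) c) h"
  proof (rule ghomI)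
    fix m x assume x: "x \<in> gpart ?E m"
    then have "x \<in> gcarrier ?E" by (simp add: gpart_EE_mod gcarrier_EE_mod)
    then have "h x \<in> I" using hE by blast
    then show "h x \<in> gpart (shift (sub_mod ring_mod I) c) (m + 0)"
      using \<phi>part[OF koszul_h_pair_gpart[OF l x]] by (simp add: h_def add.commute)
  qed (use hE lh in auto)
  define g where "g y = koszul_d_pair (\<gamma> y)" for y
  have \<gamma>K: "\<gamma> y \<in> gcarrier ?K" if "y \<in> gcarrier ?G" for y using that \<gamma>(3) WK by blast
  have ghom_g: "ghom 0 ?G ?E g"
  proof (rule ghomI)
    fix m y assume "y \<in> gpart ?G m"
    then have "\<gamma> y \<in> gpart (sub_mod ?K W) (m + 0)" using \<gamma>(1) unfolding ghom_def by blast
    then have "\<gamma> y \<in> gpart ?K (m + 0)" by simp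
    then show "g y \<in> gpart ?E (m + 0)" unfolding g_def by (rule koszul_d_pair_gpart[OF l])
  next
    fix y assume "y \<in> gcarrier ?G"
    then show "g y \<in> gcarrier ?E" unfolding g_def by (intro koszul_d_pair_gcarrier \<gamma>K)
  qed (use l\<gamma> in \<open>simp add: g_def linear_on_def koszul_d_pair_add koszul_d_pair_scale\<close>)
  have \<iota>G: "\<iota> x \<in> gcarrier ?G" if "x \<in> gcarrier ?F" for x by (rule ghom_gcarrier[OF \<iota>(1) that])
  have g0: "g y = 0 \<longleftrightarrow> \<gamma> y \<in> EE_next t" if "y \<in> gcarrier ?G" for y
    unfolding g_def U using \<gamma>K[OF that] by simp
  have exG: "\<iota> ` gcarrier ?F = gker ?G g"
  proof (intro equalityI subsetI)
    fix y assume "y \<in> \<iota> ` gcarrier ?F"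
    then obtain x where x: "x \<in> gcarrier ?F" "y = \<iota> x" by blast
    then have "\<rho> x \<in> EE_next t" using \<rho>(2) by blast
    then have "\<gamma> y \<in> EE_next t" using comm[OF x(1)] x(2) by simp
    then show "y \<in> gker ?G g" using g0 \<iota>G x by (simp add: gker_def)
  next
    fix y assume "y \<in> gker ?G g"
    then have y: "y \<in> gcarrier ?G" "\<gamma> y \<in> EE_next t" using g0 by (auto simp: gker_def)
    then have "\<gamma> y \<in> \<rho> ` gcarrier ?F" using \<gamma>(3) \<rho>(2) by blast
    then obtain x where x: "x \<in> gcarrier ?F" "\<gamma> y = \<gamma> (\<iota> x)" using comm by auto
    have "y - \<iota> x \<in> gcarrier ?G"
      using y(1) \<iota>G[OF x(1)] by (simp add: gcarrier_free_mod)
    moreover have "\<gamma> (y - \<iota> x) = 0"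
      using linear_on_diff[OF l\<gamma> module_fscale module_pscale subspace_free_mod y(1) \<iota>G[OF x(1)]] x(2) by simp
    ultimately have "y - \<iota> x \<in> \<kappa> ` gker ?F \<rho>"
      using \<kappa>(1) by (simp add: gker_def bij_betw_def)
    then obtain z where z: "z \<in> gcarrier ?F" "y - \<iota> x = \<iota> z" using \<kappa>(2) by (auto simp: gker_def)
    then have "y = \<iota> z + \<iota> x" by (simp add: algebra_simps)
    then have "y = \<iota> (z + x)" using l\<iota> z(1) x(1) by (simp add: linear_on_def)
    moreover have "z + x \<in> gcarrier ?F" using z x by (simp add: gcarrier_free_mod)
    ultimately show "y \<in> \<iota> ` gcarrier ?F" by blast
  qed
  have exE: "g ` gcarrier ?G = gker ?E h"
  proof (intro equalityI subsetI)
    fix x assume "x \<in> g ` gcarrier ?G"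
    then obtain y where y: "y \<in> gcarrier ?G" "x = koszul_d_pair (\<gamma> y)" by (auto simp: g_def)
    have "\<gamma> y + 0 \<in> gker ?K \<phi>"
      unfolding ker using y(1) \<gamma>(3) P.subspace_0[OF subspace_KK] by (blast intro: U[THEN iffD2] koszul_d_pair_0)
    then have "\<phi> (\<gamma> y) = 0" by (simp add: gker_def)
    then show "x \<in> gker ?E h" using y hd[OF \<gamma>K[OF y(1)]] koszul_d_pair_gcarrier[OF \<gamma>K[OF y(1)]] by (simp add: gker_def)
  next
    fix x assume "x \<in> gker ?E h"
    then have "x \<in> gcarrier ?E" "h x = 0" by (auto simp: gker_def)
    then obtain z where z: "z \<in> gcarrier ?K" "x = koszul_d_pair z" "\<phi> z = 0" using Edd hd by metis
    then have "z \<in> gker ?K \<phi>" by (simp add: gker_def)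
    then obtain w u where wu: "w \<in> W" "u \<in> EE_next t" "z = w + u" unfolding ker by blast
    then obtain y where y: "y \<in> gcarrier ?G" "w = \<gamma> y" using \<gamma>(3) by blast
    have "x = g y" using wu(2) U by (simp add: z(2) wu(3) y(2) g_def koszul_d_pair_add)
    then show "x \<in> g ` gcarrier ?G" using y by blast
  qed
  have nz: "g (unit_vec i) \<noteq> 0" if "i \<in> {1..q}" for i
    using g0[OF unit_vec_free_mod[OF that]] \<gamma>(2)[OF that] \<beta>[OF that] by simp
  have "long_bourbaki t d c p a q b I"
    unfolding long_bourbaki_def Let_def
    by (intro exI[of _ \<iota>] exI[of _ g] exI[of _ h] conjI ballI \<iota> ghom_g hhom exG exE nz) (simp_all add: hE)
  moreover have "graded_ideal I"
  proof -
    define H where "H = \<phi> ` (\<Union>m. gpart ?K m)"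
    have "I = R.span H"
    proof
      have part: "(unit_vec J, 0) \<in> gpart ?K (int (Suc t))" if "card J = Suc t" for J
        using that by (auto simp: gpart_KK gpart_Koszul gcarrier_Koszul unit_vec_def)
      have part': "(0, unit_vec J) \<in> gpart ?K (int (Suc l) - d)" if "card J = Suc l" for J
        using that by (auto simp: gpart_KK gpart_Koszul gcarrier_Koszul unit_vec_def l)
      note carrier = gpart_KK_subset[OF part] and carrier' = gpart_KK_subset[OF part']
      show "I \<subseteq> R.span H"
      proof
        fix x assume "x \<in> I"
        then obtain u v where uv: "(u, v) \<in> gcarrier ?K" "x = \<phi> (u, v)" by (auto simp: I_def)
        define C where "C j = {J :: 'n set. card J = j}" for j
        have uvK: "u \<in> gcarrier (free_mod (C (Suc t)) (\<lambda>_. int (Suc t)))" "v \<in> gcarrier (free_mod (C (Suc l)) (\<lambda>_. int (Suc l)))"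
          using uv(1) by (simp_all add: gcarrier_KK l C_def Koszul_def)
        have "u = (\<Sum>J\<in>C (Suc t). fscale (u J) (unit_vec J))" "v = (\<Sum>J\<in>C (Suc l). fscale (v J) (unit_vec J))"
          by (rule free_mod_expansion[OF _ uvK(1)] free_mod_expansion[OF _ uvK(2)], simp)+
        then have "(u, v) = (\<Sum>J\<in>C (Suc t). pscale (u J) (unit_vec J, 0)) + (\<Sum>J\<in>C (Suc l). pscale (v J) (0, unit_vec J))"
          by (simp add: pscale_def sum_prod)
        moreover have "(\<Sum>J\<in>C (Suc t). pscale (u J) (unit_vec J, 0)) \<in> gcarrier ?K"
          "(\<Sum>J\<in>C (Suc l). pscale (v J) (0, unit_vec J)) \<in> gcarrier ?K"
          by (intro P.subspace_sum[OF subspace_KK] P.subspace_scale[OF subspace_KK] carrier carrier'; simp add: C_def)+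
        ultimately have "x = \<phi> (\<Sum>J\<in>C (Suc t). pscale (u J) (unit_vec J, 0)) + \<phi> (\<Sum>J\<in>C (Suc l). pscale (v J) (0, unit_vec J))"
          using l\<phi> uv(2) by (simp add: linear_on_def)
        also have "\<phi> (\<Sum>J\<in>C (Suc t). pscale (u J) (unit_vec J, 0)) = (\<Sum>J\<in>C (Suc t). u J * \<phi> (unit_vec J, 0))"
          by (rule linear_on_sum[OF l\<phi> module_pscale subspace_KK])
            (simp add: C_def carrier)
        also have "\<phi> (\<Sum>J\<in>C (Suc l). pscale (v J) (0, unit_vec J)) = (\<Sum>J\<in>C (Suc l). v J * \<phi> (0, unit_vec J))"
          by (rule linear_on_sum[OF l\<phi> module_pscale subspace_KK])
            (simp add: C_def carrier')
        also have "(\<Sum>J\<in>C (Suc t). u J * \<phi> (unit_vec J, 0)) + (\<Sum>J\<in>C (Suc l). v J * \<phi> (0, unit_vec J)) \<in> R.span H"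
          using part part' unfolding C_def H_def
          by (intro R.span_add R.span_sum R.span_scale R.span_base imageI) auto
        finally show "x \<in> R.span H" .
      qed
      have "R.subspace I"
      proof (rule R.subspaceI)
        have "0 \<in> gcarrier ?K" by (rule P.subspace_0[OF subspace_KK])
        moreover from this have "\<phi> 0 = 0" by (rule linear_on_zero[OF l\<phi>])
        ultimately show "0 \<in> I" unfolding I_def by force
      next
        fix x y assume "x \<in> I" "y \<in> I"
        then obtain u v where "u \<in> gcarrier ?K" "v \<in> gcarrier ?K" "x = \<phi> u" "y = \<phi> v" by (auto simp: I_def)
        moreover from this have "u + v \<in> gcarrier ?K" "\<phi> (u + v) = \<phi> u + \<phi> v"
          using P.subspace_add[OF subspace_KK] l\<phi> unfolding linear_on_def by blast+
        ultimately show "x + y \<in> I" unfolding I_def by (metis imageI)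
      next
        fix r x assume "x \<in> I"
        then obtain u where "u \<in> gcarrier ?K" "x = \<phi> u" by (auto simp: I_def)
        moreover from this have "pscale r u \<in> gcarrier ?K" "\<phi> (pscale r u) = r * \<phi> u"
          using P.subspace_scale[OF subspace_KK] l\<phi> unfolding linear_on_def by blast+
        ultimately show "r * x \<in> I" unfolding I_def by (metis imageI)
      qed
      moreover have "H \<subseteq> I" unfolding H_def I_def using gpart_KK_subset by blast
      ultimately show "R.span H \<subseteq> I" by (rule R.span_minimal[rotated])
    qed
    moreover have "\<forall>x\<in>H. \<exists>m. homogeneous m x" unfolding H_def using \<phi>part by blast
    ultimately show ?thesis unfolding graded_ideal_def by blast
  qed
  ultimately show ?thesis unfolding I_def by blast
qed

theorem theorem2p2:
  fixes t p q :: nat and c d :: int and a b :: "nat \<Rightarrow> int"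
  assumes "CARD('n::{finite,linorder}) \<ge> 4" and "t \<le> CARD('n) - 4"
  shows "((\<exists>I :: ('n, 'k::field) poly_ring set. graded_ideal I \<and> long_bourbaki t d c p a q b I)
          \<longleftrightarrow> (\<exists>\<beta> (\<phi> :: _ \<Rightarrow> ('n, 'k) poly_ring). bourbaki_data t d c p a q b \<beta> \<phi>))
       \<and> (\<forall>I :: ('n, 'k) poly_ring set. graded_ideal I \<and> long_bourbaki t d c p a q b I \<longrightarrow>
            (\<exists>\<beta> \<phi>. bourbaki_data t d c p a q b \<beta> \<phi> \<and> I = \<phi> ` gcarrier (KK t d)))
       \<and> (\<forall>\<beta> (\<phi> :: _ \<Rightarrow> ('n, 'k) poly_ring). bourbaki_data t d c p a q b \<beta> \<phi> \<longrightarrow>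
            graded_ideal (\<phi> ` gcarrier (KK t d)) \<and>
            long_bourbaki t d c p a q b (\<phi> ` gcarrier (KK t d)))"
  using bourbaki_data_if_long_bourbaki[OF assms] long_bourbaki_if_bourbaki_data[OF assms(1)] by blast

end
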